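(* Let $\mathcal X$ be a separable metric space, $\mathcal Y=\mathbb R$, $\mathrm P$ a probability distribution on $\mathcal X\times\mathbb R$ with $\mathrm P[y^2]<\infty$, and $\mathrm P_n$ the empirical measure of an i.i.d. sample of size $n$ from $\mathrm P$. Let $\mathcal H$ be an RKHS on $\mathcal X$ with continuous kernel $k$ such that $\sup_xk(x,x)<\infty$, and $\Phi(x)=k(x,\cdot)$. Set $$B_n=\mathrm P_n[\Phi(x)\otimes\Phi(x)],\quad C_n=\mathrm P_n[y\Phi(x)],\quad B=\mathrm P[\Phi(x)\otimes\Phi(x)],\quad C=\mathrm P[y\Phi(x)],$$ and let $F^n,F$ be the kernel gradient flows for the loss $\ell(z,y)=\frac12(z-y)^2$, i.e. the solutions in $\mathcal H$ of $\frac{\mathrm dF^n_t}{\mathrm dt}=-B_nF^n_t+C_n$, $F^n_0=0$, and $\frac{\mathrm dF_t}{\mathrm dt}=-BF_t+C$, $F_0=0$. Then: (i) As $n\to\infty$, $(B_n,C_n)\to(B,C)$ almost surely in $(\mathcal H\otimes\mathcal H)\times\mathcal H$, and $$\big(\sqrt n(B_n-B),\sqrt n(C_n-C)\big)\xrightarrow{d}(\mathscr B,\mathscr C),$$ where $(\mathscr B,\mathscr C)$ is centered Gaussian in $(\mathcal H\otimes\mathcal H)\times\mathcal H$ with the same covariance structure as $(\Phi(x)\otimes\Phi(x),y\Phi(x))$ under $\mathrm P$. (ii) Consequently, $F^n\to F$ almost surely in $C^1([0,+\infty),\mathcal H)$, and $\sqrt n(F^n-F)\xrightarrow{d}\mathscr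 F$ in $C^1([0,+\infty),\mathcal H)$, where the centered Gaussian limit process $\mathscr F=(\mathscr F_t)_{t\ge0}$ is characterized by the linear ODE $$\frac{\mathrm d\mathscr F_t}{\mathrm dt}=-B\mathscr F_t-\mathscr BF_t+\mathscr C,\qquad\mathscr F_0=0,$$ equivalently, $$\mathscr F_t=\int_0^t\mathrm e^{-(t-s)B}\big(-\mathscr BF_s+\mathscr C\big)\,\mathrm ds,\qquad t\ge0.$$
   Context: For measurable $f$, $\mathrm P[f]=\mathrm P[f(x,y)]=\int f\,\mathrm d\mathrm P$ and $\mathrm P_n[f]=\frac1n\sum_if(x_i,y_i)$ (Bochner integrals for Hilbert-valued $f$). For $u,v\in\mathcal H$, $u\otimes v$ is the operator $w\mapsto\langle u,w\rangle_{\mathcal H}v$, and $\mathcal H\otimes\mathcal H$ is the Hilbert space of Hilbert–Schmidt operators on $\mathcal H$ with the Hilbert–Schmidt norm. $C^1([0,+\infty),\mathcal H)$ carries the topology of uniform convergence of functions and derivatives on bounded time sets. Two random elements of a Hilbert space have the same covariance structure if their covariance operators (after centering) coincide. *)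

theory Defs
  imports "HOL-Probability.Probability"
begin

section \<open>Orthonormal bases of a Hilbert space\<close>

definition orthonormal_set :: "'a::real_inner set \<Rightarrow> bool" where
  "orthonormal_set E \<longleftrightarrow> (\<forall>e\<in>E. \<forall>f\<in>E. e \<bullet> f = (if e = f then 1 else 0))"

definition is_onb :: "'a::real_inner set \<Rightarrow> bool" where
  "is_onb E \<longleftrightarrow> orthonormal_set E \<and> closure (span E) = UNIV"

lemma orthonormal_norm: "orthonormal_set E \<Longrightarrow> e \<in> E \<Longrightarrow> norm e = 1"
  by (simp add: orthonormal_set_def norm_eq_sqrt_inner)

lemma orthonormal_norm_sum:
  assumes "orthonormal_set E" "finite S" "S \<subseteq> E"
  shows "(norm (\<Sum>e\<in>S. c e *\<^sub>R e))\<^sup>2 = (\<Sum>e\<in>S. (c e)\<^sup>2)"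
proof -
  have "(norm (\<Sum>e\<in>S. c e *\<^sub>R e))\<^sup>2 = (\<Sum>e\<in>S. \<Sum>f\<in>S. c e * (c f * (f \<bullet> e)))"
    by (simp add: power2_norm_eq_inner inner_sum_left inner_sum_right sum_distrib_left)
  also have "\<dots> = (\<Sum>e\<in>S. \<Sum>f\<in>S. if e = f then (c e)\<^sup>2 else 0)"
    using assms(1,3) unfolding orthonormal_set_def
    by (intro sum.cong refl) (auto simp: power2_eq_square subset_iff)
  also have "\<dots> = (\<Sum>e\<in>S. (c e)\<^sup>2)"
    using assms(2) by simp
  finally show ?thesis .
qed

lemma has_sum_blinear:
  assumes "bounded_linear f" "(g has_sum s) A"
  shows "((\<lambda>x. f (g x)) has_sum f s) A"
proof -
  interpret bounded_linear f by fact
  have "((\<lambda>S. f (sum g S)) \<longlongrightarrow> f s) (finite_subsets_at_top A)"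
    using assms(2) unfolding has_sum_def by (rule tendsto)
  then show ?thesis
    by (simp add: has_sum_def sum)
qed

lemma orthonormal_series_summable:
  fixes E :: "'a::{real_inner,banach} set"
  assumes E: "orthonormal_set E" and c: "(\<lambda>e. (c e)\<^sup>2) summable_on E"
  shows "(\<lambda>e. c e *\<^sub>R e) summable_on E"
proof -
  obtain s where s: "((\<lambda>e. (c e)\<^sup>2) has_sum s) E"
    using c unfolding summable_on_def by (rule exE)
  have ex: "\<exists>F. finite F \<and> F \<subseteq> E \<and> (\<forall>Y. finite Y \<and> Y \<subseteq> E \<and> Y \<inter> F = {} \<longrightarrow> (\<Sum>e\<in>Y. (c e)\<^sup>2) \<le> d)"
    if "d > 0" for d
  proof -
    obtain F where F: "finite F" "F \<subseteq> E" "dist (\<Sum>e\<in>F. (c e)\<^sup>2) s \<le> d"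
      using has_sum_finite_approximation[OF s \<open>d > 0\<close>] by auto
    have "(\<Sum>e\<in>Y. (c e)\<^sup>2) \<le> d" if Y: "finite Y" "Y \<subseteq> E" "Y \<inter> F = {}" for Y
    proof -
      have "(\<Sum>e\<in>Y \<union> F. (c e)\<^sup>2) \<le> s"
        using F Y by (intro finite_sum_le_has_sum[OF s]) auto
      moreover have "(\<Sum>e\<in>Y \<union> F. (c e)\<^sup>2) = (\<Sum>e\<in>Y. (c e)\<^sup>2) + (\<Sum>e\<in>F. (c e)\<^sup>2)"
        using F Y by (intro sum.union_disjoint) auto
      ultimately show ?thesis
        using F(3) by (simp add: dist_real_def)
    qed
    then show ?thesis using F by blast
  qed
  define P where "P d F \<longleftrightarrow> finite F \<and> F \<subseteq> E \<and>
    (\<forall>Y. finite Y \<and> Y \<subseteq> E \<and> Y \<inter> F = {} \<longrightarrow> (\<Sum>e\<in>Y. (c e)\<^sup>2) \<le> d)" for d F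
  have "\<forall>n::nat. \<exists>F. P ((1 / real (Suc n))\<^sup>2) F"
    unfolding P_def by (intro allI ex) simp
  then obtain F where "\<And>n::nat. P ((1 / real (Suc n))\<^sup>2) (F n)"
    by metis
  then have F: "\<And>n::nat. finite (F n)" "\<And>n. F n \<subseteq> E"
    "\<And>n Y. finite Y \<Longrightarrow> Y \<subseteq> E \<Longrightarrow> Y \<inter> F n = {} \<Longrightarrow> (\<Sum>e\<in>Y. (c e)\<^sup>2) \<le> (1 / real (Suc n))\<^sup>2"
    unfolding P_def by blast+
  define G where "G n = (\<Union>i\<le>n. F i)" for n
  have G: "finite (G n)" "G n \<subseteq> E" "F n \<subseteq> G n" for n
    using F by (auto simp: G_def)
  have Gmono: "m \<le> n \<Longrightarrow> G m \<subseteq> G n" for m n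
    by (auto simp: G_def) (meson atMost_iff order_trans)
  define x where "x n = (\<Sum>e\<in>G n. c e *\<^sub>R e)" for n
  have close: "dist (\<Sum>e\<in>Y. c e *\<^sub>R e) (x n) \<le> 1 / real (Suc n)"
    if Y: "finite Y" "Y \<subseteq> E" "G n \<subseteq> Y" for Y n
  proof -
    have "(\<Sum>e\<in>Y. c e *\<^sub>R e) - x n = (\<Sum>e\<in>Y - G n. c e *\<^sub>R e)"
      unfolding x_def using Y by (simp add: sum_diff)
    moreover have "(norm (\<Sum>e\<in>Y - G n. c e *\<^sub>R e))\<^sup>2 \<le> (1 / real (Suc n))\<^sup>2"
    proof (subst orthonormal_norm_sum[OF E])
      show "(\<Sum>e\<in>Y - G n. (c e)\<^sup>2) \<le> (1 / real (Suc n))\<^sup>2"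
        by (rule F(3)) (use Y G(3)[of n] in blast)+
    qed (use Y in auto)
    ultimately have "(dist (\<Sum>e\<in>Y. c e *\<^sub>R e) (x n))\<^sup>2 \<le> (1 / real (Suc n))\<^sup>2"
      by (simp only: dist_norm)
    then show ?thesis
      by (rule power2_le_imp_le) simp
  qed
  have "Cauchy x"
  proof (rule metric_CauchyI)
    fix e :: real assume "e > 0"
    then obtain N where N: "1 / real (Suc N) < e / 2"
      using reals_Archimedean[of "e / 2"] by (auto simp: inverse_eq_divide)
    show "\<exists>M. \<forall>m\<ge>M. \<forall>n\<ge>M. dist (x m) (x n) < e"
    proof (intro exI allI impI)
      fix m n assume "N \<le> m" "N \<le> n"
      then have "dist (x m) (x N) \<le> 1 / real (Suc N)" "dist (x n) (x N) \<le> 1 / real (Suc N)"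
        using close[of "G m" N] close[of "G n" N] G Gmono by (auto simp: x_def)
      then show "dist (x m) (x n) < e"
        using N dist_triangle2[of "x m" "x n" "x N"] by linarith
    qed
  qed
  then obtain l where l: "x \<longlonglongrightarrow> l"
    using Cauchy_convergent convergent_def by blast
  have "((\<lambda>e. c e *\<^sub>R e) has_sum l) E"
    unfolding has_sum_def tendsto_iff
  proof (intro allI impI)
    fix e :: real assume "e > 0"
    then obtain N1 where N1: "\<And>n. n \<ge> N1 \<Longrightarrow> dist (x n) l < e / 2"
      using metric_LIMSEQ_D[OF l, of "e / 2"] by auto
    obtain N2 where N2: "1 / real (Suc N2) < e / 2"
      using reals_Archimedean[of "e / 2"] \<open>e > 0\<close> by (auto simp: inverse_eq_divide)
    define n where "n = max N1 N2"
    have "1 / real (Suc n) \<le> 1 / real (Suc N2)"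
      by (simp add: n_def frac_le)
    then have n: "dist (x n) l < e / 2" "1 / real (Suc n) < e / 2"
      using N1[of n] N2 by (simp_all add: n_def)
    have "dist (\<Sum>e\<in>Y. c e *\<^sub>R e) l < e" if "finite Y" "G n \<subseteq> Y" "Y \<subseteq> E" for Y
      using close[OF that(1,3,2)] n dist_triangle[of "\<Sum>e\<in>Y. c e *\<^sub>R e" l "x n"] by linarith
    then show "\<forall>\<^sub>F S in finite_subsets_at_top E. dist (\<Sum>e\<in>S. c e *\<^sub>R e) l < e"
      unfolding eventually_finite_subsets_at_top using G(1,2)[of n] by (intro exI[of _ "G n"]) simp
  qed
  then show ?thesis
    by (auto simp: summable_on_def)
qed

lemma bessel_finite:
  assumes "orthonormal_set E" "finite S" "S \<subseteq> E"
  shows "(\<Sum>e\<in>S. (x \<bullet> e)\<^sup>2) \<le> (norm x)\<^sup>2"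
proof -
  let ?s = "\<Sum>e\<in>S. (x \<bullet> e) *\<^sub>R e"
  have "x \<bullet> ?s = (\<Sum>e\<in>S. (x \<bullet> e)\<^sup>2)"
    by (simp add: inner_sum_right power2_eq_square)
  moreover have "?s \<bullet> ?s = (\<Sum>e\<in>S. (x \<bullet> e)\<^sup>2)"
    using orthonormal_norm_sum[OF assms, of "\<lambda>e. x \<bullet> e"] by (simp add: power2_norm_eq_inner)
  moreover have "0 \<le> (x - ?s) \<bullet> (x - ?s)"
    by simp
  ultimately show ?thesis
    by (simp add: inner_diff_left inner_diff_right power2_norm_eq_inner inner_commute)
qed

lemma bessel_summable:
  assumes "orthonormal_set E"
  shows "(\<lambda>e. (x \<bullet> e)\<^sup>2) summable_on E"
proof (rule nonneg_bdd_above_summable_on)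
  show "bdd_above (sum (\<lambda>e. (x \<bullet> e)\<^sup>2) ` {F. F \<subseteq> E \<and> finite F})"
    by (rule bdd_aboveI2[where M = "(norm x)\<^sup>2"]) (use bessel_finite[OF assms] in auto)
qed simp

lemma orthogonal_to_closure_span:
  assumes "\<And>e. e \<in> E \<Longrightarrow> x \<bullet> e = 0" "y \<in> closure (span E)"
  shows "x \<bullet> y = 0"
proof -
  have "subspace {y. x \<bullet> y = 0}"
    by (auto simp: subspace_def inner_add_right)
  then have "span E \<subseteq> {y. x \<bullet> y = 0}"
    using assms(1) by (intro span_minimal) auto
  moreover have "closed {y. x \<bullet> y = 0}"
    by (intro closed_Collect_eq continuous_intros)
  ultimately show ?thesis
    using assms(2) closure_minimal by blast
qed

lemma orthogonal_expansion:
  fixes E :: "'a::{real_inner,banach} set"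
  assumes E: "orthonormal_set E"
  obtains s where "((\<lambda>e. (x \<bullet> e) *\<^sub>R e) has_sum s) E" "s \<in> closure (span E)"
    "\<And>y. y \<in> closure (span E) \<Longrightarrow> (x - s) \<bullet> y = 0"
proof -
  obtain s where s: "((\<lambda>e. (x \<bullet> e) *\<^sub>R e) has_sum s) E"
    using orthonormal_series_summable[OF E bessel_summable[OF E]] by (auto simp: summable_on_def)
  have "s \<in> closure (span E)"
  proof (rule Lim_in_closed_set[OF closed_closure _ _ s[unfolded has_sum_def]])
    show "\<forall>\<^sub>F S in finite_subsets_at_top E. (\<Sum>e\<in>S. (x \<bullet> e) *\<^sub>R e) \<in> closure (span E)"
      by (intro eventually_finite_subsets_at_top_weakI closure_subset[THEN subsetD] span_sum span_scale span_base) auto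
  qed simp
  moreover have "(x - s) \<bullet> y = 0" if "y \<in> closure (span E)" for y
  proof (rule orthogonal_to_closure_span[OF _ that])
    fix e assume e: "e \<in> E"
    have "((\<lambda>f. ((x \<bullet> f) *\<^sub>R f) \<bullet> e) has_sum s \<bullet> e) E"
      by (rule has_sum_blinear[OF bounded_linear_inner_left s])
    moreover have "((\<lambda>f. ((x \<bullet> f) *\<^sub>R f) \<bullet> e) has_sum x \<bullet> e) E"
    proof -
      have "((\<lambda>f. ((x \<bullet> f) *\<^sub>R f) \<bullet> e) has_sum x \<bullet> e) {e}"
        using E e by (intro has_sum_finiteI) (auto simp: orthonormal_set_def)
      then show ?thesis
        using E e by (subst has_sum_cong_neutral[where T = "{e}"]) (auto simp: orthonormal_set_def)
    qed
    ultimately show "(x - s) \<bullet> e = 0"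
      using has_sum_unique by (fastforce simp: inner_diff_left)
  qed
  ultimately show thesis using s that by blast
qed

lemma maximal_orthonormal:
  fixes V :: "'a::{real_inner,banach} set"
  assumes V: "subspace V" "closed V"
  obtains E where "orthonormal_set E" "closure (span E) = V"
proof -
  let ?A = "{E. orthonormal_set E \<and> E \<subseteq> V}"
  have "\<exists>M\<in>?A. \<forall>X\<in>?A. M \<subseteq> X \<longrightarrow> X = M"
  proof (rule subset_Zorn_nonempty)
    show "?A \<noteq> {}" by (auto simp: orthonormal_set_def intro: exI[of _ "{}"])
    fix C assume C: "C \<noteq> {}" "subset.chain ?A C"
    have "e \<bullet> f = (if e = f then 1 else 0)" if "X \<in> C" "e \<in> X" "Y \<in> C" "f \<in> Y" for e f X Y
    proof -
      have "X \<subseteq> Y \<or> Y \<subseteq> X" "orthonormal_set X" "orthonormal_set Y"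
        using C that by (auto simp: subset_chain_def)
      then show ?thesis using that unfolding orthonormal_set_def by blast
    qed
    then have "orthonormal_set (\<Union> C)"
      unfolding orthonormal_set_def by (meson UnionE)
    moreover have "\<Union> C \<subseteq> V"
      using C(2) by (auto simp: subset_chain_def)
    ultimately show "\<Union> C \<in> ?A" by blast
  qed
  then obtain E where E: "orthonormal_set E" "E \<subseteq> V"
    and max: "\<And>X. orthonormal_set X \<Longrightarrow> X \<subseteq> V \<Longrightarrow> E \<subseteq> X \<Longrightarrow> X = E"
    by auto
  have sub: "closure (span E) \<subseteq> V"
    using E(2) V by (meson closure_minimal span_minimal)
  have "x \<in> closure (span E)" if x: "x \<in> V" for x
  proof -
    obtain s where s: "s \<in> closure (span E)"
      "\<And>y. y \<in> closure (span E) \<Longrightarrow> (x - s) \<bullet> y = 0"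
      using orthogonal_expansion[OF E(1), of x] by metis
    have "x - s = 0"
    proof (rule ccontr)
      assume ne: "x - s \<noteq> 0"
      define u where "u = (x - s) /\<^sub>R norm (x - s)"
      have "norm u = 1"
        using ne by (simp add: u_def)
      then have "u \<bullet> u = 1"
        by (simp add: dot_square_norm)
      have ort: "u \<bullet> e = 0" if "e \<in> E" for e
        using s(2)[of e] that closure_subset[of "span E"] span_base[of e E] unfolding u_def by auto
      have "x - s \<in> V" using x s(1) sub V(1) by (meson subsetD subspace_diff)
      then have "u \<in> V" using V(1) by (simp add: u_def subspace_scale)
      have "insert u E = E"
        using E \<open>u \<in> V\<close> \<open>u \<bullet> u = 1\<close> ort
        by (intro max) (auto simp: orthonormal_set_def inner_commute)
      then show False using ort[of u] \<open>u \<bullet> u = 1\<close> by auto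
    qed
    then show ?thesis using s(1) by simp
  qed
  then show thesis using that E(1) sub by blast
qed

lemma onb_exists: "\<exists>E :: 'a::{real_inner,banach} set. is_onb E"
proof -
  obtain E :: "'a set" where "orthonormal_set E" "closure (span E) = UNIV"
    by (rule maximal_orthonormal[of "UNIV :: 'a set"]) auto
  then show ?thesis unfolding is_onb_def by blast
qed

lemma onb_expansion:
  fixes E :: "'a::{real_inner,banach} set"
  assumes "is_onb E"
  shows "((\<lambda>e. (x \<bullet> e) *\<^sub>R e) has_sum x) E"
proof -
  obtain s where s: "((\<lambda>e. (x \<bullet> e) *\<^sub>R e) has_sum s) E" 
    "\<And>y. y \<in> closure (span E) \<Longrightarrow> (x - s) \<bullet> y = 0"
    using orthogonal_expansion[of E x] assms unfolding is_onb_def by metis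
  then have "(x - s) \<bullet> (x - s) = 0"
    using assms by (simp add: is_onb_def)
  then show ?thesis using s(1) by simp
qed

lemma parseval:
  fixes E :: "'a::{real_inner,banach} set"
  assumes "is_onb E"
  shows "((\<lambda>e. (x \<bullet> e)\<^sup>2) has_sum (norm x)\<^sup>2) E"
  using has_sum_blinear[OF bounded_linear_inner_right onb_expansion[OF assms], of x x]
  unfolding power2_norm_eq_inner by (simp add: power2_eq_square)

lemma subspace_closureI:
  fixes S :: "'a::real_normed_vector set"
  assumes "subspace S"
  shows "subspace (closure S)"
proof (rule subspaceI)
  show "0 \<in> closure S"
    using assms closure_subset subspace_0 by blast
next
  fix x y assume "x \<in> closure S" "y \<in> closure S"
  then obtain f g where "\<And>n. f n \<in> S" "f \<longlonglongrightarrow> x" "\<And>n. g n \<in> S" "g \<longlonglongrightarrow> y"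
    by (meson closure_sequential)
  then show "x + y \<in> closure S"
    unfolding closure_sequential using assms
    by (intro exI[of _ "\<lambda>n. f n + g n"]) (auto intro: tendsto_add subspace_add)
next
  fix c x assume "x \<in> closure S"
  then obtain f where "\<And>n. f n \<in> S" "f \<longlonglongrightarrow> x"
    by (meson closure_sequential)
  then show "c *\<^sub>R x \<in> closure S"
    unfolding closure_sequential using assms
    by (intro exI[of _ "\<lambda>n. c *\<^sub>R f n"]) (auto intro: tendsto_intros subspace_scale)
qed

lemma closed_subspace_eq_UNIV:
  fixes V :: "'a::{real_inner,banach} set"
  assumes "\<And>x. (\<And>v. v \<in> V \<Longrightarrow> x \<bullet> v = 0) \<Longrightarrow> x = 0"
  shows "closure (span V) = UNIV"
proof -
  have "subspace (closure (span V))" by (rule subspace_closureI) simp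
  then obtain E where E: "orthonormal_set E" "closure (span E) = closure (span V)"
    using maximal_orthonormal by (metis closed_closure)
  have "x \<in> closure (span V)" for x
  proof -
    obtain s where s: "s \<in> closure (span V)"
      "\<And>y. y \<in> closure (span V) \<Longrightarrow> (x - s) \<bullet> y = 0"
      using orthogonal_expansion[OF E(1), of x] E(2) by metis
    have "x - s = 0"
      by (rule assms) (meson closure_subset s(2) span_base subsetD)
    then show ?thesis using s(1) by simp
  qed
  then show ?thesis by blast
qed


lemma riesz_representation:
  fixes f :: "'a::{real_inner,banach} \<Rightarrow> real"
  assumes "bounded_linear f"
  shows "\<exists>r. \<forall>x. f x = x \<bullet> r"
proof -
  interpret bounded_linear f by fact
  obtain K where K: "0 \<le> K" "\<And>x. norm (f x) \<le> norm x * K"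
    using nonneg_bounded by blast
  obtain E :: "'a set" where E: "is_onb E"
    using onb_exists by (rule exE)
  then have oE: "orthonormal_set E"
    by (simp add: is_onb_def)
  have bound: "(\<Sum>e\<in>S. (f e)\<^sup>2) \<le> K\<^sup>2" if S: "finite S" "S \<subseteq> E" for S
  proof -
    define v where "v = (\<Sum>e\<in>S. f e *\<^sub>R e)"
    have Q: "(norm v)\<^sup>2 = (\<Sum>e\<in>S. (f e)\<^sup>2)"
      unfolding v_def by (rule orthonormal_norm_sum[OF oE S])
    also have "\<dots> = f v"
      by (simp add: v_def sum scaleR power2_eq_square)
    finally have "norm v * norm v \<le> norm v * K"
      using K(2)[of v] by (simp add: power2_eq_square)
    then have "norm v \<le> K"
      using K(1) by (cases "norm v = 0") auto
    then show ?thesis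
      unfolding Q[symmetric] by (intro power_mono) auto
  qed
  have "(\<lambda>e. (f e)\<^sup>2) summable_on E"
  proof (rule nonneg_bdd_above_summable_on)
    show "bdd_above (sum (\<lambda>e. (f e)\<^sup>2) ` {F. F \<subseteq> E \<and> finite F})"
      by (rule bdd_aboveI2[where M = "K\<^sup>2"]) (use bound in auto)
  qed simp
  then have "(\<lambda>e. f e *\<^sub>R e) summable_on E"
    by (rule orthonormal_series_summable[OF oE])
  then obtain r where r: "((\<lambda>e. f e *\<^sub>R e) has_sum r) E"
    unfolding summable_on_def by (rule exE)
  have "f x = x \<bullet> r" for x
  proof -
    have "((\<lambda>e. f ((x \<bullet> e) *\<^sub>R e)) has_sum f x) E"
      by (rule has_sum_blinear[OF assms onb_expansion[OF E]])
    moreover have "((\<lambda>e. x \<bullet> (f e *\<^sub>R e)) has_sum x \<bullet> r) E"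
      by (rule has_sum_blinear[OF bounded_linear_inner_right r])
    ultimately show ?thesis
      using has_sum_unique by (fastforce simp: scaleR mult.commute)
  qed
  then show ?thesis by blast
qed

section \<open>Hilbert--Schmidt operators\<close>

definition hilbert_schmidt :: "('a::{real_inner,banach} \<Rightarrow>\<^sub>L 'a) \<Rightarrow> bool" where
  "hilbert_schmidt A \<longleftrightarrow> (\<exists>E. is_onb E \<and> (\<lambda>e. (norm (blinfun_apply A e))\<^sup>2) summable_on E)"

lemma onb_sum_transfer:
  fixes E G :: "'a::{real_inner,banach} set" and a b :: "'a \<Rightarrow> 'a"
  assumes E: "is_onb E" and G: "is_onb G"
    and adj: "\<And>e g. a e \<bullet> g = e \<bullet> b g"
    and s: "((\<lambda>e. (norm (a e))\<^sup>2) has_sum s) E"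
  shows "((\<lambda>g. (norm (b g))\<^sup>2) has_sum s) G"
proof -
  define h where "h e g = (a e \<bullet> g)\<^sup>2" for e g
  have h1: "(h e has_sum (norm (a e))\<^sup>2) G" for e
    unfolding h_def by (rule parseval[OF G])
  have h2: "((\<lambda>e. h e g) has_sum (norm (b g))\<^sup>2) E" for g
    using parseval[OF E, of "b g"] by (simp only: h_def adj inner_commute[of "b g"])
  have hn: "norm (h e g) = h e g" for e g
    by (simp add: h_def)
  have "(\<lambda>z. norm (case z of (e, g) \<Rightarrow> h e g)) summable_on E \<times> G"
  proof (rule iffD2[OF Infinite_Sum.abs_summable_on_Sigma_iff], intro conjI ballI)
    show "(\<lambda>g. norm (case (e, g) of (e, g) \<Rightarrow> h e g)) summable_on G" for e
      using has_sum_imp_summable[OF h1] by (simp only: prod.case hn)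
    have "norm (infsum (\<lambda>g. norm (case (e, g) of (e, g) \<Rightarrow> h e g)) G) = (norm (a e))\<^sup>2" for e
      by (simp only: prod.case hn infsumI[OF h1]) simp
    then show "(\<lambda>e. norm (infsum (\<lambda>g. norm (case (e, g) of (e, g) \<Rightarrow> h e g)) G)) summable_on E"
      using has_sum_imp_summable[OF s] by (simp only:)
  qed
  then have sm: "(\<lambda>(e, g). h e g) summable_on E \<times> G"
    by (rule Infinite_Sum.abs_summable_summable)
  have "(\<lambda>(g, e). h e g) summable_on G \<times> E"
  proof -
    have "(\<lambda>(e, g). h e g) summable_on prod.swap ` (G \<times> E)"
      using sm by (simp only: product_swap)
    then have "((\<lambda>(e, g). h e g) \<circ> prod.swap) summable_on G \<times> E"
      by (simp only: summable_on_reindex inj_swap)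
    moreover have "(\<lambda>(e, g). h e g) \<circ> prod.swap = (\<lambda>(g, e). h e g)"
      by (simp add: fun_eq_iff)
    ultimately show ?thesis by (simp only:)
  qed
  then have "(\<lambda>g. (norm (b g))\<^sup>2) summable_on G"
    using summable_on_Sigma_banach[of "\<lambda>g e. h e g" G "\<lambda>_. E"] by (simp only: infsumI[OF h2])
  moreover have "infsum (\<lambda>g. (norm (b g))\<^sup>2) G = s"
    using infsum_swap_banach[OF sm] infsumI[OF s] by (simp only: infsumI[OF h1] infsumI[OF h2])
  ultimately show ?thesis
    by (simp add: has_sum_iff)
qed

text \<open>Basis independence: it makes \<open>\<exists>E\<close> above and the choice of \<open>some_onb\<close> below harmless.\<close>

lemma hs_sum_onb_independent:
  fixes A :: "'a::{real_inner,banach} \<Rightarrow>\<^sub>L 'a"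
  assumes E: "is_onb E" and F: "is_onb F"
    and s: "((\<lambda>e. (norm (blinfun_apply A e))\<^sup>2) has_sum s) E"
  shows "((\<lambda>e. (norm (blinfun_apply A e))\<^sup>2) has_sum s) F"
proof -
  have "\<exists>r. \<forall>x. blinfun_apply A x \<bullet> h = x \<bullet> r" for h
    by (rule riesz_representation)
      (rule bounded_linear_compose[OF bounded_linear_inner_left blinfun.bounded_linear_right])
  then obtain r where r: "\<And>h x. blinfun_apply A x \<bullet> h = x \<bullet> r h"
    by metis
  have "((\<lambda>e. (norm (r e))\<^sup>2) has_sum s) E"
    by (rule onb_sum_transfer[OF E E r s])
  then show ?thesis
    by (rule onb_sum_transfer[OF E F, rotated]) (metis inner_commute r)
qed

lemma hilbert_schmidt_iff:
  assumes E: "is_onb E"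
  shows "hilbert_schmidt A \<longleftrightarrow> (\<lambda>e. (norm (blinfun_apply A e))\<^sup>2) summable_on E"
proof
  assume "hilbert_schmidt A"
  then obtain F s where F: "is_onb F" "((\<lambda>e. (norm (blinfun_apply A e))\<^sup>2) has_sum s) F"
    unfolding hilbert_schmidt_def summable_on_def by (elim exE conjE)
  show "(\<lambda>e. (norm (blinfun_apply A e))\<^sup>2) summable_on E"
    by (rule has_sum_imp_summable[OF hs_sum_onb_independent[OF F(1) E F(2)]])
next
  assume "(\<lambda>e. (norm (blinfun_apply A e))\<^sup>2) summable_on E"
  with E show "hilbert_schmidt A"
    unfolding hilbert_schmidt_def by (intro exI[of _ E] conjI)
qed

definition some_onb :: "'a::{real_inner,banach} set" where
  "some_onb = (SOME E. is_onb E)"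

lemma is_onb_some_onb: "is_onb some_onb"
  unfolding some_onb_def using onb_exists by (rule someI_ex)

lemma hilbert_schmidt_summable:
  "hilbert_schmidt A \<longleftrightarrow> (\<lambda>e. (norm (blinfun_apply A e))\<^sup>2) summable_on some_onb"
  by (rule hilbert_schmidt_iff[OF is_onb_some_onb])

lemma real_summable_on_le:
  fixes f g :: "'a \<Rightarrow> real"
  assumes "g summable_on E" "\<And>x. x \<in> E \<Longrightarrow> \<bar>f x\<bar> \<le> g x"
  shows "f summable_on E"
proof -
  have "(\<lambda>x. norm (g x)) summable_on E"
    using assms(1) by (rule iffD1[OF summable_on_iff_abs_summable_on_real])
  then have "(\<lambda>x. norm (f x)) summable_on E"
    by (rule Infinite_Sum.abs_summable_on_comparison_test) (use assms(2) in force)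
  then show ?thesis by (rule Infinite_Sum.abs_summable_summable)
qed

lemma inner_le_norm_squares: "\<bar>x \<bullet> y\<bar> \<le> (norm x)\<^sup>2 + (norm y)\<^sup>2"
  for x y :: "'a::real_inner"
proof -
  have "\<bar>x \<bullet> y\<bar> \<le> norm x * norm y" by (rule Cauchy_Schwarz_ineq2)
  also have "\<dots> \<le> (norm x)\<^sup>2 + (norm y)\<^sup>2"
    using sum_squares_bound[of "norm x" "norm y"] mult_nonneg_nonneg[OF norm_ge_zero[of x] norm_ge_zero[of y]]
    unfolding mult.assoc by linarith
  finally show ?thesis .
qed

lemma norm_add_squares: "(norm (x + y))\<^sup>2 \<le> 2 * (norm x)\<^sup>2 + 2 * (norm y)\<^sup>2"
  for x y :: "'a::real_inner"
proof -
  have "0 \<le> (x - y) \<bullet> (x - y)" by simp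
  then show ?thesis
    by (simp add: power2_norm_eq_inner inner_add_left inner_add_right inner_diff_left
        inner_diff_right inner_commute)
qed

lemma hilbert_schmidt_zero: "hilbert_schmidt 0"
  by (simp add: hilbert_schmidt_summable)

lemma hilbert_schmidt_scaleR: "hilbert_schmidt A \<Longrightarrow> hilbert_schmidt (c *\<^sub>R A)"
  unfolding hilbert_schmidt_summable
  by (simp add: scaleR_blinfun.rep_eq power_mult_distrib summable_on_cmult_right)

lemma hilbert_schmidt_add:
  assumes "hilbert_schmidt A" "hilbert_schmidt B"
  shows "hilbert_schmidt (A + B)"
  unfolding hilbert_schmidt_summable
proof (rule real_summable_on_le)
  show "(\<lambda>e. 2 * (norm (blinfun_apply A e))\<^sup>2 + 2 * (norm (blinfun_apply B e))\<^sup>2) summable_on some_onb"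
    using assms unfolding hilbert_schmidt_summable
    by (intro summable_on_add summable_on_cmult_right)
qed (simp add: plus_blinfun.rep_eq norm_add_squares)

lemma hilbert_schmidt_uminus: "hilbert_schmidt A \<Longrightarrow> hilbert_schmidt (- A)"
  using hilbert_schmidt_scaleR[of A "-1"] by simp

lemma hilbert_schmidt_diff:
  "hilbert_schmidt A \<Longrightarrow> hilbert_schmidt B \<Longrightarrow> hilbert_schmidt (A - B)"
  using hilbert_schmidt_add[OF _ hilbert_schmidt_uminus, of A B] by simp

typedef (overloaded) ('a::"{real_inner,banach}") hs =
  "{A :: 'a \<Rightarrow>\<^sub>L 'a. hilbert_schmidt A}"
  morphisms hs_op Abs_hs
  using hilbert_schmidt_zero by blast

setup_lifting type_definition_hs

abbreviation hs_apply :: "'a::{real_inner,banach} hs \<Rightarrow> 'a \<Rightarrow> 'a" where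
  "hs_apply A \<equiv> blinfun_apply (hs_op A)"

lemma hs_op: "hilbert_schmidt (hs_op A)"
  using hs_op by auto

lemma hs_inner_summable:
  "(\<lambda>e. hs_apply A e \<bullet> hs_apply B e) summable_on some_onb"
proof (rule real_summable_on_le)
  show "(\<lambda>e. (norm (hs_apply A e))\<^sup>2 + (norm (hs_apply B e))\<^sup>2) summable_on some_onb"
    using hs_op[of A] hs_op[of B] unfolding hilbert_schmidt_summable by (intro summable_on_add)
qed (rule inner_le_norm_squares)

instantiation hs :: ("{real_inner,banach}") real_vector
begin

lift_definition zero_hs :: "'a hs" is 0 by (rule hilbert_schmidt_zero)
lift_definition plus_hs :: "'a hs \<Rightarrow> 'a hs \<Rightarrow> 'a hs" is "(+)" by (rule hilbert_schmidt_add)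
lift_definition minus_hs :: "'a hs \<Rightarrow> 'a hs \<Rightarrow> 'a hs" is "(-)" by (rule hilbert_schmidt_diff)
lift_definition uminus_hs :: "'a hs \<Rightarrow> 'a hs" is uminus by (rule hilbert_schmidt_uminus)
lift_definition scaleR_hs :: "real \<Rightarrow> 'a hs \<Rightarrow> 'a hs" is "(*\<^sub>R)" by (rule hilbert_schmidt_scaleR)

instance
  by standard (transfer, simp add: algebra_simps)+

end

instantiation hs :: ("{real_inner,banach}") real_inner
begin

definition inner_hs :: "'a hs \<Rightarrow> 'a hs \<Rightarrow> real" where
  "A \<bullet> B = (\<Sum>\<^sub>\<infinity>e\<in>some_onb. hs_apply A e \<bullet> hs_apply B e)"

definition norm_hs :: "'a hs \<Rightarrow> real" where
  "norm_hs A = sqrt (A \<bullet> A)"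

definition dist_hs :: "'a hs \<Rightarrow> 'a hs \<Rightarrow> real" where
  "dist_hs A B = sqrt ((A - B) \<bullet> (A - B))"

definition sgn_hs :: "'a hs \<Rightarrow> 'a hs" where
  "sgn_hs A = A /\<^sub>R sqrt (A \<bullet> A)"

definition uniformity_hs :: "('a hs \<times> 'a hs) filter" where
  "uniformity_hs = (INF e\<in>{0 <..}. principal {(A, B). sqrt ((A - B) \<bullet> (A - B)) < e})"

definition open_hs :: "'a hs set \<Rightarrow> bool" where
  "open_hs S = (\<forall>x\<in>S. \<forall>\<^sub>F (x', y) in
    (INF e\<in>{0 <..}. principal {(A, B). sqrt ((A - B) \<bullet> (A - B)) < e}). x' = x \<longrightarrow> y \<in> S)"

lemma inner_hs_commute: "A \<bullet> B = B \<bullet> A" for A B :: "'a hs"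
  by (simp add: inner_hs_def inner_commute)

lemma inner_hs_add_left: "(A + B) \<bullet> C = A \<bullet> C + B \<bullet> C" for A B C :: "'a hs"
  unfolding inner_hs_def
  by (subst infsum_add[OF hs_inner_summable hs_inner_summable, symmetric])
    (simp add: plus_hs.rep_eq plus_blinfun.rep_eq inner_add_left)

lemma inner_hs_scaleR_left: "r *\<^sub>R A \<bullet> B = r * (A \<bullet> B)" for A B :: "'a hs"
  unfolding inner_hs_def
  by (subst infsum_cmult_right[OF hs_inner_summable, symmetric])
    (simp add: scaleR_hs.rep_eq scaleR_blinfun.rep_eq)

lemma inner_hs_nonneg: "0 \<le> A \<bullet> A" for A :: "'a hs"
  unfolding inner_hs_def by (rule infsum_nonneg) simp

lemma inner_hs_eq_0: "A \<bullet> A = 0 \<longleftrightarrow> A = 0" for A :: "'a hs"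
proof
  assume 0: "A \<bullet> A = 0"
  have z: "hs_apply A e = 0" if "e \<in> some_onb" for e
    using nonneg_infsum_le_0D[OF _ hs_inner_summable[of A A], of e] that 0
    unfolding inner_hs_def by simp
  have "hs_apply A x = 0" for x
  proof -
    have "((\<lambda>e. hs_apply A ((x \<bullet> e) *\<^sub>R e)) has_sum hs_apply A x) some_onb"
      by (rule has_sum_blinear[OF blinfun.bounded_linear_right onb_expansion[OF is_onb_some_onb]])
    moreover have "((\<lambda>e. hs_apply A ((x \<bullet> e) *\<^sub>R e)) has_sum 0) some_onb"
      by (rule has_sum_0) (simp add: z blinfun.scaleR_right)
    ultimately show ?thesis by (rule has_sum_unique)
  qed
  then show "A = 0"
    by (intro hs_op_inject[THEN iffD1] blinfun_eqI) (simp add: zero_hs.rep_eq)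
qed (simp add: inner_hs_def zero_hs.rep_eq)

instance
  apply standard
  unfolding dist_hs_def open_hs_def sgn_hs_def uniformity_hs_def norm_hs_def
  apply (rule refl inner_hs_commute inner_hs_add_left inner_hs_scaleR_left inner_hs_nonneg
      inner_hs_eq_0)+
  done

end

lemma hs_norm_has_sum:
  "is_onb E \<Longrightarrow> ((\<lambda>e. (norm (hs_apply A e))\<^sup>2) has_sum (norm A)\<^sup>2) E"
proof (rule hs_sum_onb_independent[OF is_onb_some_onb])
  show "((\<lambda>e. (norm (hs_apply A e))\<^sup>2) has_sum (norm A)\<^sup>2) some_onb"
    using has_sum_infsum[OF hs_inner_summable[of A A]]
    by (simp add: power2_norm_eq_inner inner_hs_def)
qed


lemma hs_norm_le_if_finite_sums:
  assumes "0 \<le> c" "\<And>S. finite S \<Longrightarrow> S \<subseteq> some_onb \<Longrightarrow> (\<Sum>e\<in>S. (norm (hs_apply A e))\<^sup>2) \<le> c\<^sup>2"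
  shows "norm A \<le> c"
proof -
  have "(norm A)\<^sup>2 \<le> c\<^sup>2"
    by (rule has_sum_le_finite_sums[OF hs_norm_has_sum[OF is_onb_some_onb]]) (rule assms(2))
  then show ?thesis
    using assms(1) by (rule power2_le_imp_le)
qed

lemma norm_hs_op_le: "norm (hs_op A) \<le> norm A"
proof (rule norm_blinfun_bound)
  fix x :: 'a
  have onb: "orthonormal_set (some_onb :: 'a set)"
    using is_onb_some_onb is_onb_def by blast
  have lim: "((\<lambda>e. hs_apply A ((x \<bullet> e) *\<^sub>R e)) has_sum hs_apply A x) some_onb"
    by (rule has_sum_blinear[OF blinfun.bounded_linear_right onb_expansion[OF is_onb_some_onb]])
  have "norm (\<Sum>e\<in>S. hs_apply A ((x \<bullet> e) *\<^sub>R e)) \<le> norm A * norm x"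
    if S: "finite S" "S \<subseteq> some_onb" for S
  proof -
    have "norm (\<Sum>e\<in>S. hs_apply A ((x \<bullet> e) *\<^sub>R e)) \<le> (\<Sum>e\<in>S. \<bar>norm (hs_apply A e)\<bar> * \<bar>x \<bullet> e\<bar>)"
      by (rule sum_norm_le) (simp add: blinfun.scaleR_right mult.commute)
    also have "\<dots> \<le> L2_set (\<lambda>e. norm (hs_apply A e)) S * L2_set (\<lambda>e. x \<bullet> e) S"
      by (rule L2_set_mult_ineq)
    also have "\<dots> \<le> norm A * norm x"
    proof (rule mult_mono)
      show "L2_set (\<lambda>e. norm (hs_apply A e)) S \<le> norm A"
        unfolding L2_set_def
        by (rule real_le_lsqrt)
          (auto intro!: finite_sum_le_has_sum[OF hs_norm_has_sum[OF is_onb_some_onb]] sum_nonneg S)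
      show "L2_set (\<lambda>e. x \<bullet> e) S \<le> norm x"
        unfolding L2_set_def
        by (rule real_le_lsqrt) (auto intro!: bessel_finite[OF onb] sum_nonneg S)
    qed auto
    finally show ?thesis .
  qed
  then show "norm (hs_apply A x) \<le> norm A * norm x"
    by (intro Lim_norm_ubound[OF _ lim[unfolded has_sum_def]] eventually_finite_subsets_at_top_weakI)
      auto
qed simp

lemma hs_op_diff: "hs_op (A - B) = hs_op A - hs_op B"
  by (rule minus_hs.rep_eq)

lemma bounded_linear_hs_op: "bounded_linear hs_op"
  by (rule bounded_linear_intro[where K = 1])
    (simp_all add: plus_hs.rep_eq scaleR_hs.rep_eq norm_hs_op_le)

instance hs :: ("{real_inner,banach}") complete_space
proof
  fix X :: "nat \<Rightarrow> 'a hs"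
  assume X: "Cauchy X"
  have "Cauchy (\<lambda>n. hs_op (X n))"
    by (rule bounded_linear.Cauchy[OF bounded_linear_hs_op X])
  then obtain L where L: "(\<lambda>n. hs_op (X n)) \<longlonglongrightarrow> L"
    using Cauchy_convergent convergent_def by blast
  have fin: "(\<Sum>e\<in>S. (norm (blinfun_apply (hs_op (X n) - L) e))\<^sup>2) \<le> d\<^sup>2"
    if N: "\<And>m. m \<ge> N \<Longrightarrow> norm (X n - X m) < d" and S: "finite S" "S \<subseteq> some_onb" for N n d S
  proof (rule LIMSEQ_le_const2)
    have "(\<lambda>m. blinfun_apply (hs_op (X n) - hs_op (X m)) e) \<longlonglongrightarrow> blinfun_apply (hs_op (X n) - L) e" for e
      by (intro blinfun.tendsto tendsto_intros L)
    then show "(\<lambda>m. \<Sum>e\<in>S. (norm (blinfun_apply (hs_op (X n) - hs_op (X m)) e))\<^sup>2)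
        \<longlonglongrightarrow> (\<Sum>e\<in>S. (norm (blinfun_apply (hs_op (X n) - L) e))\<^sup>2)"
      by (intro tendsto_sum tendsto_power tendsto_norm)
    have "(\<Sum>e\<in>S. (norm (blinfun_apply (hs_op (X n) - hs_op (X m)) e))\<^sup>2) \<le> d\<^sup>2" if "m \<ge> N" for m
    proof -
      have "(\<Sum>e\<in>S. (norm (hs_apply (X n - X m) e))\<^sup>2) \<le> (norm (X n - X m))\<^sup>2"
        by (rule finite_sum_le_has_sum[OF hs_norm_has_sum[OF is_onb_some_onb]]) (use S in auto)
      also have "\<dots> \<le> d\<^sup>2"
        using N[OF that] by (intro power_mono) auto
      finally show ?thesis by (simp only: hs_op_diff)
    qed
    then show "\<exists>N. \<forall>m\<ge>N. (\<Sum>e\<in>S. (norm (blinfun_apply (hs_op (X n) - hs_op (X m)) e))\<^sup>2) \<le> d\<^sup>2"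
      by (intro exI[of _ N]) simp
  qed
  have cau: "\<exists>N. \<forall>n\<ge>N. \<forall>m\<ge>N. norm (X n - X m) < d" if "d > 0" for d
    using CauchyD[OF X that] by (simp add: dist_norm)
  have "hilbert_schmidt L"
  proof -
    obtain N where N: "\<And>n m. n \<ge> N \<Longrightarrow> m \<ge> N \<Longrightarrow> norm (X n - X m) < 1"
      using cau[of 1] by auto
    have "hilbert_schmidt (hs_op (X N) - L)"
      unfolding hilbert_schmidt_summable
    proof (rule nonneg_bdd_above_summable_on)
      show "bdd_above (sum (\<lambda>e. (norm (blinfun_apply (hs_op (X N) - L) e))\<^sup>2) ` {F. F \<subseteq> some_onb \<and> finite F})"
        by (rule bdd_aboveI2[where M = "1\<^sup>2"]) (use fin[of N N 1] N in auto)
    qed simp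
    then have "hilbert_schmidt (hs_op (X N) - (hs_op (X N) - L))"
      by (rule hilbert_schmidt_diff[OF hs_op])
    then show ?thesis by simp
  qed
  then obtain Y where Y: "hs_op Y = L"
    using Abs_hs_inverse by blast
  have "X \<longlonglongrightarrow> Y"
  proof (rule LIMSEQ_I)
    fix r :: real assume "r > 0"
    then obtain N where N: "\<And>n m. n \<ge> N \<Longrightarrow> m \<ge> N \<Longrightarrow> norm (X n - X m) < r / 2"
      using cau[of "r / 2"] by auto
    have "norm (X n - Y) \<le> r / 2" if "n \<ge> N" for n
      using \<open>r > 0\<close> fin[of N n "r / 2"] N that
      by (intro hs_norm_le_if_finite_sums) (auto simp only: hs_op_diff Y)
    then show "\<exists>N. \<forall>n\<ge>N. norm (X n - Y) < r"
      using \<open>r > 0\<close> by (intro exI[of _ N]) fastforce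
  qed
  then show "convergent X"
    by (auto simp: convergent_def)
qed

instance hs :: ("{real_inner,banach}") banach ..

text \<open>\<^term>\<open>tensor u v\<close> is the operator \<open>u \<otimes> v\<close>.\<close>

lift_definition rank_one :: "'a::real_inner \<Rightarrow> 'a \<Rightarrow> 'a \<Rightarrow>\<^sub>L 'a" is "\<lambda>u v w. (u \<bullet> w) *\<^sub>R v"
  by (intro bounded_linear_scaleR_const bounded_linear_inner_right)

lemma rank_one_has_sum:
  fixes u v :: "'a::{real_inner,banach}"
  shows "((\<lambda>e. (norm (blinfun_apply (rank_one u v) e))\<^sup>2) has_sum (norm u)\<^sup>2 * (norm v)\<^sup>2) some_onb"
  using has_sum_cmult_left[OF parseval[OF is_onb_some_onb, of u], of "(norm v)\<^sup>2"]
  by (simp add: rank_one.rep_eq power_mult_distrib)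

lift_definition tensor :: "'a::{real_inner,banach} \<Rightarrow> 'a \<Rightarrow> 'a hs" is rank_one
  unfolding hilbert_schmidt_summable using rank_one_has_sum has_sum_imp_summable by blast

lemma hs_apply_tensor [simp]: "hs_apply (tensor u v) w = (u \<bullet> w) *\<^sub>R v"
  by (simp add: tensor.rep_eq rank_one.rep_eq)

lemma norm_tensor: "norm (tensor u v) = norm u * norm v"
proof -
  have "((\<lambda>e. (norm (hs_apply (tensor u v) e))\<^sup>2) has_sum (norm u)\<^sup>2 * (norm v)\<^sup>2) some_onb"
    unfolding tensor.rep_eq by (rule rank_one_has_sum)
  then have "(norm (tensor u v))\<^sup>2 = (norm u * norm v)\<^sup>2"
    unfolding power_mult_distrib by (rule has_sum_unique[OF hs_norm_has_sum[OF is_onb_some_onb]])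
  then show ?thesis
    by (rule power2_eq_imp_eq) simp_all
qed

lemma inner_tensor: "A \<bullet> tensor u v = hs_apply A u \<bullet> v"
proof -
  have "((\<lambda>e. hs_apply A ((u \<bullet> e) *\<^sub>R e) \<bullet> v) has_sum hs_apply A u \<bullet> v) some_onb"
    by (rule has_sum_blinear[OF _ onb_expansion[OF is_onb_some_onb]])
      (rule bounded_linear_compose[OF bounded_linear_inner_left blinfun.bounded_linear_right])
  then show ?thesis
    unfolding inner_hs_def by (intro infsumI) (simp add: blinfun.scaleR_right)
qed

section \<open>Separability\<close>

lemma separable_span:
  fixes T :: "'a::real_normed_vector set"
  assumes T: "countable T" "closure (span T) = UNIV"
  shows "\<exists>D :: 'a set. countable D \<and> closure D = UNIV"
proof -
  define f where "f xs = sum_list (map (\<lambda>(q, t). (of_rat q :: real) *\<^sub>R t) xs)" for xs :: "(rat \<times> 'a) list"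
  define D where "D = f ` lists (UNIV \<times> T)"
  have "countable (UNIV \<times> T :: (rat \<times> 'a) set)"
    using T(1) by simp
  then have "countable D"
    unfolding D_def by (intro countable_image countable_lists)
  have cons: "(of_rat q :: real) *\<^sub>R t + d \<in> D" if "t \<in> T" "d \<in> D" for q t d
  proof -
    from \<open>d \<in> D\<close> obtain xs where "d = f xs" "xs \<in> lists (UNIV \<times> T)"
      by (auto simp: D_def)
    then show ?thesis
      using \<open>t \<in> T\<close> unfolding D_def by (intro image_eqI[of _ _ "(q, t) # xs"]) (auto simp: f_def)
  qed
  have "x \<in> closure D" if "x \<in> span T" for x
    using that
  proof (induction rule: span_induct_alt)
    case base
    have "f [] \<in> D" unfolding D_def by (intro imageI) auto
    then show ?case
      using closure_subset[of D] by (auto simp: f_def)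
  next
    case (step c x y)
    obtain g where g: "\<And>n::nat. g n \<in> D" "g \<longlonglongrightarrow> y"
      using step(2) by (meson closure_sequential)
    have "(c::real) \<in> closure \<rat>" by (simp add: Rats_closure_real)
    then obtain q where q: "\<And>n::nat. q n \<in> \<rat>" "q \<longlonglongrightarrow> c"
      by (meson closure_sequential)
    have "q n *\<^sub>R x + g n \<in> D" for n
      using cons[OF step(1) g(1)] q(1)[of n] by (metis Rats_cases)
    moreover have "(\<lambda>n. q n *\<^sub>R x + g n) \<longlonglongrightarrow> c *\<^sub>R x + y"
      by (intro tendsto_intros q g)
    ultimately show ?case
      unfolding closure_sequential by (intro exI[of _ "\<lambda>n. q n *\<^sub>R x + g n"]) simp
  qed
  then have "closure (span T) \<subseteq> closure D"
    by (intro closure_minimal) auto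
  then show ?thesis
    using T(2) \<open>countable D\<close> by blast
qed

lemma countable_dense_subbasis:
  fixes D :: "'a::metric_space set"
  assumes "countable D" "closure D = UNIV"
  shows "\<exists>B :: 'a set set. countable B \<and> open = generate_topology B"
proof -
  define B where "B = (\<lambda>(d, n). ball d (1 / real (Suc n))) ` (D \<times> (UNIV :: nat set))"
  have "countable B"
    unfolding B_def using assms(1) by (intro countable_image) simp
  moreover have "open U = generate_topology B U" for U
  proof
    assume "open U"
    have "\<exists>b\<in>B. x \<in> b \<and> b \<subseteq> U" if x: "x \<in> U" for x
    proof -
      obtain r where r: "r > 0" "ball x r \<subseteq> U"
        using \<open>open U\<close> x open_contains_ball by blast
      obtain n where n: "1 / real (Suc n) < r / 2"
        using reals_Archimedean[of "r / 2"] r(1) by (auto simp: inverse_eq_divide)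
      have "x \<in> closure D" using assms(2) by simp
      then obtain d where d: "d \<in> D" "dist d x < 1 / real (Suc n)"
        by (meson closure_approachable of_nat_0_less_iff zero_less_Suc zero_less_divide_1_iff)
      have "ball d (1 / real (Suc n)) \<subseteq> ball x r"
      proof
        fix z assume "z \<in> ball d (1 / real (Suc n))"
        then show "z \<in> ball x r"
          using d(2) n dist_triangle[of x z d] by (simp add: dist_commute)
      qed
      then show ?thesis
        using d r unfolding B_def by (intro bexI[of _ "ball d (1 / real (Suc n))"]) auto
    qed
    then have "U = \<Union> {b \<in> B. b \<subseteq> U}" by blast
    moreover have "generate_topology B (\<Union> {b \<in> B. b \<subseteq> U})"
      by (rule generate_topology.UN) (auto intro: generate_topology.Basis)
    ultimately show "generate_topology B U" by simp
  next
    assume "generate_topology B U"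
    then show "open U"
      by induction (auto simp: B_def)
  qed
  ultimately show ?thesis by blast
qed

lemma countable_orthonormal:
  fixes E :: "'a::{real_inner,second_countable_topology} set"
  assumes "orthonormal_set E"
  shows "countable E"
proof -
  obtain D :: "'a set" where D: "countable D" "\<And>X. open X \<Longrightarrow> X \<noteq> {} \<Longrightarrow> \<exists>d\<in>D. d \<in> X"
    by (rule countable_dense_setE) blast
  have "\<exists>d\<in>D. dist e d < 1 / 2" for e
    using D(2)[of "ball e (1 / 2)"] by auto
  then obtain p where p: "\<And>e. p e \<in> D" "\<And>e. dist e (p e) < 1 / 2"
    by metis
  have "inj_on p E"
  proof (rule inj_onI, rule ccontr)
    fix e f assume ef: "e \<in> E" "f \<in> E" "p e = p f" "e \<noteq> f"
    have "dist e f < 1"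
      using p(2)[of e] p(2)[of f] ef(3) dist_triangle2[of e f "p e"] by simp
    moreover have "(norm (e - f))\<^sup>2 = 2"
      using assms ef unfolding orthonormal_set_def power2_norm_eq_inner
      by (simp add: inner_diff_left inner_diff_right)
    moreover have "(norm (e - f))\<^sup>2 \<le> 1\<^sup>2" if "norm (e - f) < 1"
      using that by (intro power_mono) auto
    ultimately show False by (simp add: dist_norm)
  qed
  moreover have "countable (p ` E)"
    using D(1) p(1) by (meson countable_subset image_subsetI)
  ultimately show ?thesis
    by (rule countable_image_inj_on[rotated])
qed

instance hs :: ("{real_inner,banach,second_countable_topology}") second_countable_topology
proof
  let ?T = "(\<lambda>(e, f). tensor e f) ` (some_onb \<times> some_onb) :: 'a hs set"
  have "countable (some_onb :: 'a set)"
    using is_onb_some_onb[where 'a = 'a] by (intro countable_orthonormal) (simp add: is_onb_def)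
  then have "countable ?T" by simp
  moreover have "closure (span ?T) = UNIV"
  proof (rule closed_subspace_eq_UNIV)
    fix A :: "'a hs"
    assume A: "\<And>v. v \<in> ?T \<Longrightarrow> A \<bullet> v = 0"
    have "hs_apply A e = 0" if "e \<in> some_onb" for e
    proof -
      have "hs_apply A e \<bullet> f = 0" if "f \<in> some_onb" for f
        using A[of "tensor e f"] that \<open>e \<in> some_onb\<close> by (force simp: inner_tensor)
      then have "hs_apply A e \<bullet> hs_apply A e = 0"
        by (rule orthogonal_to_closure_span) (use is_onb_some_onb is_onb_def in blast)+
      then show ?thesis by simp
    qed
    then have "A \<bullet> A = 0"
      by (simp add: inner_hs_def infsum_0)
    then show "A = 0" by simp
  qed
  ultimately show "\<exists>B :: 'a hs set set. countable B \<and> open = generate_topology B"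
    using separable_span countable_dense_subbasis by blast
qed


section \<open>Reproducing kernel Hilbert spaces\<close>

text \<open>
  The Hilbert space is a type \<open>'h\<close> whose elements are identified with functions on \<open>'x\<close> through
  the injective linear evaluation map \<open>fun_of\<close>; \<open>\<Phi> x\<close> is the element of \<open>'h\<close> that represents the
  function \<open>k x = k(x, \<cdot>)\<close>.
\<close>

definition rkhs :: "('h::{real_inner,banach} \<Rightarrow> 'x \<Rightarrow> real) \<Rightarrow> ('x \<Rightarrow> 'x \<Rightarrow> real) \<Rightarrow> ('x \<Rightarrow> 'h) \<Rightarrow> bool" where
  "rkhs fun_of k \<Phi> \<longleftrightarrow>
    (\<forall>x. linear (\<lambda>h. fun_of h x)) \<and> inj fun_of \<and>
    (\<forall>x. fun_of (\<Phi> x) = k x) \<and>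
    (\<forall>h x. fun_of h x = h \<bullet> \<Phi> x)"

text \<open>
  The Bochner integral of the library is defined for second countable spaces only. For the
  RKHS of a continuous kernel on a separable metric space second countability is automatic, so
  putting the Hilbert space into that class is no restriction.
\<close>

lemma rkhs_second_countable:
  fixes fun_of :: "'h::{real_inner,banach} \<Rightarrow> 'x::{metric_space,second_countable_topology} \<Rightarrow> real"
  assumes H: "rkhs fun_of k \<Phi>" and k: "continuous_on UNIV (\<lambda>(x, y). k x y)"
  shows "\<exists>B :: 'h set set. countable B \<and> open = generate_topology B"
proof -
  have kip: "k x y = \<Phi> x \<bullet> \<Phi> y" for x y
    using H unfolding rkhs_def by metis
  obtain D :: "'x set" where D: "countable D" "\<And>X. open X \<Longrightarrow> X \<noteq> {} \<Longrightarrow> \<exists>d\<in>D. d \<in> X"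
    by (rule countable_dense_setE) blast
  have "closure (span (\<Phi> ` D)) = UNIV"
  proof (rule closed_subspace_eq_UNIV)
    fix h assume h: "\<And>v. v \<in> \<Phi> ` D \<Longrightarrow> h \<bullet> v = 0"
    have "fun_of h x = 0" for x
    proof -
      have "\<exists>d\<in>D. dist x d < 1 / real (Suc n)" for n
        using D(2)[of "ball x (1 / real (Suc n))"] by auto
      then obtain d where d: "\<And>n. d n \<in> D" "\<And>n. dist x (d n) < 1 / real (Suc n)"
        by metis
      have "d \<longlonglongrightarrow> x"
      proof (rule metric_LIMSEQ_I)
        fix r :: real assume "r > 0"
        then obtain N where N: "1 / real (Suc N) < r"
          using reals_Archimedean[of r] by (auto simp: inverse_eq_divide)
        have "dist (d n) x < r" if "n \<ge> N" for n
        proof -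
          have "1 / real (Suc n) \<le> 1 / real (Suc N)"
            using that by (simp add: frac_le)
          then show ?thesis
            using d(2)[of n] N by (simp add: dist_commute)
        qed
        then show "\<exists>N. \<forall>n\<ge>N. dist (d n) x < r" by blast
      qed
      have kl: "(\<lambda>n. k (f n) (g n)) \<longlonglongrightarrow> k a b" if "f \<longlonglongrightarrow> a" "g \<longlonglongrightarrow> b" for f g a b
        using continuous_on_tendsto_compose[OF k tendsto_Pair[OF that]] by simp
      have "(\<lambda>n. (norm (\<Phi> (d n) - \<Phi> x))\<^sup>2) \<longlonglongrightarrow> k x x - k x x - (k x x - k x x)"
        unfolding power2_norm_eq_inner inner_diff_left inner_diff_right kip[symmetric]
        by (intro tendsto_diff kl \<open>d \<longlonglongrightarrow> x\<close> tendsto_const)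
      then have "(\<lambda>n. sqrt ((norm (\<Phi> (d n) - \<Phi> x))\<^sup>2)) \<longlonglongrightarrow> sqrt 0"
        by (intro tendsto_real_sqrt) simp
      then have "(\<lambda>n. \<Phi> (d n)) \<longlonglongrightarrow> \<Phi> x"
        by (subst LIM_zero_iff[symmetric], subst tendsto_norm_zero_iff[symmetric]) simp
      then have "(\<lambda>n. h \<bullet> \<Phi> (d n)) \<longlonglongrightarrow> h \<bullet> \<Phi> x"
        by (intro tendsto_intros)
      moreover have "h \<bullet> \<Phi> (d n) = 0" for n
        using h d(1) by blast
      ultimately have "h \<bullet> \<Phi> x = 0"
        using LIMSEQ_unique[OF _ tendsto_const] by simp
      then show ?thesis
        using H unfolding rkhs_def by simp
    qed
    moreover have "fun_of 0 x = 0" for x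
      using H unfolding rkhs_def by simp
    ultimately have "fun_of h = fun_of 0" by (simp add: fun_eq_iff)
    then show "h = 0"
      using H unfolding rkhs_def by (simp add: inj_eq)
  qed
  then show ?thesis
    using D(1) separable_span[of "\<Phi> ` D"] countable_dense_subbasis by blast
qed

section \<open>The space of continuously differentiable functions on the half-line\<close>

abbreviation deriv_halfline :: "(real \<Rightarrow> 'a::real_normed_vector) \<Rightarrow> real \<Rightarrow> 'a" where
  "deriv_halfline f t \<equiv> vector_derivative f (at t within {0..})"

text \<open>Functions on \<open>[0, \<infinity>)\<close> are elements of \<^term>\<open>extensional {0..}\<close>; the derivative at 0 is
  one-sided.\<close>

definition C1_halfline :: "(real \<Rightarrow> 'a::real_normed_vector) set" where
  "C1_halfline = {f \<in> extensional {0..}.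
    (\<forall>t\<ge>0. f differentiable (at t within {0..})) \<and> continuous_on {0..} (deriv_halfline f)}"

definition C1_near :: "real \<Rightarrow> real \<Rightarrow> (real \<Rightarrow> 'a::real_normed_vector) \<Rightarrow> (real \<Rightarrow> 'a) set" where
  "C1_near T \<epsilon> f = {g \<in> C1_halfline. \<forall>t\<in>{0..T}.
    dist (g t) (f t) < \<epsilon> \<and> dist (deriv_halfline g t) (deriv_halfline f t) < \<epsilon>}"

definition C1_topology :: "(real \<Rightarrow> 'a::real_normed_vector) topology" where
  "C1_topology = topology (\<lambda>U. U \<subseteq> C1_halfline \<and> (\<forall>f\<in>U. \<exists>T. \<exists>\<epsilon>>0. C1_near T \<epsilon> f \<subseteq> U))"

lemma C1_near_mono: "T' \<le> T \<Longrightarrow> \<epsilon> \<le> \<epsilon>' \<Longrightarrow> C1_near T \<epsilon> f \<subseteq> C1_near T' \<epsilon>' f"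
  unfolding C1_near_def
  by (intro subsetI CollectI conjI ballI) (auto intro: less_le_trans)

lemma openin_C1_topology:
  "openin C1_topology U \<longleftrightarrow> U \<subseteq> C1_halfline \<and> (\<forall>f\<in>U. \<exists>T. \<exists>\<epsilon>>0. C1_near T \<epsilon> f \<subseteq> U)"
proof -
  let ?P = "\<lambda>U :: (real \<Rightarrow> 'a) set. U \<subseteq> C1_halfline \<and> (\<forall>f\<in>U. \<exists>T. \<exists>\<epsilon>>0. C1_near T \<epsilon> f \<subseteq> U)"
  have "?P (S \<inter> S')" if SS: "?P S" "?P S'" for S S'
  proof (intro conjI ballI)
    fix f assume f: "f \<in> S \<inter> S'"
    obtain T \<epsilon> where 1: "\<epsilon> > 0" "C1_near T \<epsilon> f \<subseteq> S" using SS f by blast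
    obtain T' \<epsilon>' where 2: "\<epsilon>' > 0" "C1_near T' \<epsilon>' f \<subseteq> S'" using SS f by blast
    have "C1_near (max T T') (min \<epsilon> \<epsilon>') f \<subseteq> S \<inter> S'"
      using 1(2) 2(2) C1_near_mono[of T "max T T'" "min \<epsilon> \<epsilon>'" \<epsilon> f]
        C1_near_mono[of T' "max T T'" "min \<epsilon> \<epsilon>'" \<epsilon>' f] by auto
    then show "\<exists>T. \<exists>\<epsilon>>0. C1_near T \<epsilon> f \<subseteq> S \<inter> S'"
      using 1(1) 2(1) by (intro exI[of _ "max T T'"] exI[of _ "min \<epsilon> \<epsilon>'"]) auto
  qed (use SS in blast)
  moreover have "?P (\<Union>\<K>)" if KK: "\<forall>K\<in>\<K>. ?P K" for \<K>
  proof (intro conjI ballI)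
    fix f assume "f \<in> \<Union>\<K>"
    then obtain K where K: "K \<in> \<K>" "f \<in> K" by blast
    then obtain T \<epsilon> where "\<epsilon> > 0" "C1_near T \<epsilon> f \<subseteq> K" using KK by blast
    then show "\<exists>T. \<exists>\<epsilon>>0. C1_near T \<epsilon> f \<subseteq> \<Union>\<K>"
      using K(1) by (meson Union_upper order_trans)
  qed (use KK in blast)
  ultimately have "istopology ?P"
    unfolding istopology_def by blast
  then show ?thesis
    unfolding C1_topology_def by (simp add: topology_inverse')
qed

lemma topspace_C1_topology [simp]: "topspace C1_topology = C1_halfline"
proof -
  have "openin C1_topology (C1_halfline :: (real \<Rightarrow> 'a) set)"
    unfolding openin_C1_topology C1_near_def by (auto intro: exI[of _ 1])
  then show ?thesis
    by (meson openin_C1_topology openin_subset openin_topspace subset_antisym)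
qed

text \<open>Pointwise strict bounds in \<^const>\<open>C1_near\<close> generate the same topology as suprema over \<open>[0, T]\<close>.\<close>

lemma limitin_C1_topology:
  fixes f :: "real \<Rightarrow> 'a::real_normed_vector"
  shows "limitin C1_topology F f G \<longleftrightarrow> f \<in> C1_halfline \<and> (\<forall>\<^sub>F i in G. F i \<in> C1_halfline) \<and>
    (\<forall>T. uniform_limit {0..T} F f G \<and>
      uniform_limit {0..T} (\<lambda>i. deriv_halfline (F i)) (deriv_halfline f) G)" (is "?L \<longleftrightarrow> ?R")
proof
  assume L: ?L
  then have f: "f \<in> C1_halfline" by (simp add: limitin_def)
  have near: "\<forall>\<^sub>F i in G. F i \<in> C1_near T \<epsilon> f" if "\<epsilon> > 0" for T \<epsilon>
  proof -
    define N where "N \<delta> g h \<longleftrightarrow> (\<forall>t\<in>{0..T}. dist (g t) (h t) \<le> \<delta> \<and>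
      dist (deriv_halfline g t) (deriv_halfline h t) \<le> \<delta>)" for \<delta> and g h :: "real \<Rightarrow> 'a"
    define U where "U = {g \<in> C1_halfline. \<exists>\<delta><\<epsilon>. N \<delta> g f}"
    have "\<exists>T. \<exists>\<epsilon>>0. C1_near T \<epsilon> g \<subseteq> U" if g: "g \<in> U" for g
    proof -
      obtain \<delta> where \<delta>: "\<delta> < \<epsilon>" "N \<delta> g f" using g by (auto simp: U_def)
      have "h \<in> U" if h: "h \<in> C1_near T ((\<epsilon> - \<delta>) / 2) g" for h
      proof -
        have "N ((\<epsilon> + \<delta>) / 2) h f"
          unfolding N_def
        proof (intro ballI conjI)
          fix t assume t: "t \<in> {0..T}"
          show "dist (h t) (f t) \<le> (\<epsilon> + \<delta>) / 2"
            using h t \<delta>(2) dist_triangle[of "h t" "f t" "g t"]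
            by (auto simp: C1_near_def N_def field_simps) (smt (verit) atLeastAtMost_iff)
          show "dist (deriv_halfline h t) (deriv_halfline f t) \<le> (\<epsilon> + \<delta>) / 2"
            using h t \<delta>(2) dist_triangle[of "deriv_halfline h t" "deriv_halfline f t" "deriv_halfline g t"]
            by (auto simp: C1_near_def N_def field_simps) (smt (verit) atLeastAtMost_iff)
        qed
        then show ?thesis
          using \<delta>(1) h by (auto simp: U_def C1_near_def intro!: exI[of _ "(\<epsilon> + \<delta>) / 2"])
      qed
      then show ?thesis
        using \<delta>(1) by (intro exI[of _ T] exI[of _ "(\<epsilon> - \<delta>) / 2"]) auto
    qed
    then have "openin C1_topology U"
      unfolding openin_C1_topology by (auto simp: U_def)
    moreover have "f \<in> U"
      using f \<open>\<epsilon> > 0\<close> by (auto simp: U_def N_def intro!: exI[of _ 0])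
    ultimately have "\<forall>\<^sub>F i in G. F i \<in> U"
      using L by (simp add: limitin_def)
    then show ?thesis
      by (rule eventually_mono) (force simp: U_def N_def C1_near_def)
  qed
  have "\<forall>\<^sub>F i in G. F i \<in> C1_halfline"
    by (rule eventually_mono[OF near[OF zero_less_one, of 0]]) (simp add: C1_near_def)
  moreover have "uniform_limit {0..T} F f G" for T
    unfolding uniform_limit_iff
    by (intro allI impI, rule eventually_mono[OF near[of _ T]]) (auto simp: C1_near_def)
  moreover have "uniform_limit {0..T} (\<lambda>i. deriv_halfline (F i)) (deriv_halfline f) G" for T
    unfolding uniform_limit_iff
    by (intro allI impI, rule eventually_mono[OF near[of _ T]]) (auto simp: C1_near_def)
  ultimately show ?R
    using f by blast
next
  assume R: ?R
  show ?L
    unfolding limitin_def topspace_C1_topology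
  proof (intro conjI allI impI)
    fix U assume "openin C1_topology U \<and> f \<in> U"
    then obtain T \<epsilon> where U: "\<epsilon> > 0" "C1_near T \<epsilon> f \<subseteq> U"
      unfolding openin_C1_topology by blast
    have "\<forall>\<^sub>F i in G. F i \<in> C1_halfline"
      "\<forall>\<^sub>F i in G. \<forall>t\<in>{0..T}. dist (F i t) (f t) < \<epsilon>"
      "\<forall>\<^sub>F i in G. \<forall>t\<in>{0..T}. dist (deriv_halfline (F i) t) (deriv_halfline f t) < \<epsilon>"
      using R U(1) unfolding uniform_limit_iff by auto
    then show "\<forall>\<^sub>F i in G. F i \<in> U"
      by eventually_elim (use U(2) in \<open>auto simp: C1_near_def\<close>)
  qed (use R in blast)
qed

definition solves_ivp :: "(real \<Rightarrow> 'a \<Rightarrow> 'a) \<Rightarrow> (real \<Rightarrow> 'a::real_normed_vector) \<Rightarrow> bool" where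
  "solves_ivp v f \<longleftrightarrow> f \<in> C1_halfline \<and> f 0 = 0 \<and>
    (\<forall>t\<ge>0. (f has_vector_derivative v t (f t)) (at t within {0..}))"

definition op_exp :: "('a::banach \<Rightarrow>\<^sub>L 'a) \<Rightarrow> 'a \<Rightarrow>\<^sub>L 'a" where
  "op_exp A = (\<Sum>n. (1 / fact n) *\<^sub>R ((\<lambda>X. A o\<^sub>L X) ^^ n) id_blinfun)"

section \<open>Convergence in distribution and Gaussian random elements\<close>

definition borel_of :: "'a topology \<Rightarrow> 'a measure" where
  "borel_of T = sigma (topspace T) {U. openin T U}"

text \<open>The Borel sets are those of \<open>T\<close>, which may be a topology on a proper subset of the type; the
  limit \<open>Y\<close> may live on another probability space.\<close>

definition conv_in_distr ::
    "'a topology \<Rightarrow> 'w measure \<Rightarrow> (nat \<Rightarrow> 'w \<Rightarrow> 'a) \<Rightarrow> 'v measure \<Rightarrow> ('v \<Rightarrow> 'a) \<Rightarrow> bool" where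
  "conv_in_distr T M X N Y \<longleftrightarrow>
    (\<forall>n. X n \<in> measurable M (borel_of T)) \<and> Y \<in> measurable N (borel_of T) \<and>
    (\<forall>f. continuous_map T euclideanreal f \<and> bounded (f ` topspace T) \<longrightarrow>
      (\<lambda>n. \<integral>\<omega>. f (X n \<omega>) \<partial>M) \<longlonglongrightarrow> (\<integral>\<omega>. f (Y \<omega>) \<partial>N))"

text \<open>The degenerate law concentrated at 0 counts as Gaussian.\<close>

definition centered_gaussian_real :: "'w measure \<Rightarrow> ('w \<Rightarrow> real) \<Rightarrow> bool" where
  "centered_gaussian_real M X \<longleftrightarrow> X \<in> borel_measurable M \<and>
    ((AE \<omega> in M. X \<omega> = 0) \<or> (\<exists>\<sigma>>0. distributed M lborel X (normal_density 0 \<sigma>)))"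

definition centered_gaussian :: "'w measure \<Rightarrow> ('w \<Rightarrow> 'a::real_inner) \<Rightarrow> bool" where
  "centered_gaussian M X \<longleftrightarrow> X \<in> borel_measurable M \<and>
    (\<forall>h. centered_gaussian_real M (\<lambda>\<omega>. h \<bullet> X \<omega>))"

definition centered_gaussian_process ::
    "'w measure \<Rightarrow> 't set \<Rightarrow> ('w \<Rightarrow> 't \<Rightarrow> 'a::real_inner) \<Rightarrow> bool" where
  "centered_gaussian_process M I X \<longleftrightarrow>
    (\<forall>t\<in>I. (\<lambda>\<omega>. X \<omega> t) \<in> borel_measurable M) \<and>
    (\<forall>J h. finite J \<and> J \<subseteq> I \<longrightarrow> centered_gaussian_real M (\<lambda>\<omega>. \<Sum>t\<in>J. h t \<bullet> X \<omega> t))"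

definition cov_op :: "'w measure \<Rightarrow> ('w \<Rightarrow> 'a::{real_inner,banach,second_countable_topology}) \<Rightarrow> 'a hs" where
  "cov_op M X = (\<integral>\<omega>. tensor (X \<omega> - (\<integral>\<omega>'. X \<omega>' \<partial>M)) (X \<omega> - (\<integral>\<omega>'. X \<omega>' \<partial>M)) \<partial>M)"

text \<open>Square integrability is what makes the integrals in the covariance operator meaningful.\<close>

definition same_covariance ::
    "'w measure \<Rightarrow> ('w \<Rightarrow> 'a::{real_inner,banach,second_countable_topology}) \<Rightarrow> 'v measure \<Rightarrow> ('v \<Rightarrow> 'a) \<Rightarrow> bool" where
  "same_covariance M X N Y \<longleftrightarrow>
    X \<in> borel_measurable M \<and> integrable M (\<lambda>\<omega>. (norm (X \<omega>))\<^sup>2) \<and>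
    Y \<in> borel_measurable N \<and> integrable N (\<lambda>\<omega>. (norm (Y \<omega>))\<^sup>2) \<and>
    cov_op M X = cov_op N Y"

end

theory Submission
  imports Defs
begin

text \<open>
  The pair \<open>(B\<^sub>n, C\<^sub>n)\<close> is an average of independent copies of \<open>(\<Phi>(x) \<otimes> \<Phi>(x), y \<Phi>(x))\<close> in a separable
  Hilbert space. Orthogonality of centered independent summands gives the strong law, by passing to
  the subsequence of squares, and shows that the normalized sums are uniformly close in mean square
  to their projections on finitely many coordinates. So the central limit theorem only has to be
  tested on functions of finitely many coordinates. These are approximated by trigonometric
  polynomials, for which convergence is the one-dimensional central limit theorem. The Gaussian limit
  is a random series whose coefficients come from a Cholesky factorization of the covariance matrix.

  The rescaled error \<open>\<surd>n (F\<^sup>n - F)\<close> solves \<open>u' = - B\<^sub>n u - b\<^sub>n F\<^sub>t + c\<^sub>n\<close> with \<open>b\<^sub>n = \<surd>n (B\<^sub>n - B)\<close> and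
  \<open>c\<^sub>n = \<surd>n (C\<^sub>n - C)\<close>. By variation of constants its solution is a continuous function of
  \<open>(B\<^sub>n, b\<^sub>n, c\<^sub>n)\<close> with values in the \<open>C\<^sup>1\<close> space, and Slutsky's lemma gives the joint convergence
  in distribution of this triple.
\<close>

section \<open>Expansions along a sequence\<close>

text \<open>In infinite dimension, convergence of all one-dimensional projections does not imply
  convergence in distribution; some compactness must be added. Here it comes from a single estimate:
  for bounded linear \<open>A\<close>, the second moment of \<open>A (normalized n \<omega>)\<close>
  is at most that of \<open>A\<close> applied to one centered observation. With \<open>A\<close> the
  identity this bounds second moments independently of n; with
  \<open>A x = x - proj_seq e m x\<close> it bounds the tails independently of n. Test functions can
  then be compared in mean on the whole space, without passing through tightness and relative
  compactness of laws.

  The flow depends nonlinearly on its operator, so a linearization around \<open>B\<close> would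
  leave a second order remainder. Keeping the random operator \<open>Bn n \<omega>\<close>, rather
  than \<open>B\<close>, as the coefficient makes the equation of the rescaled error exact. The
  price is one more random argument, whose limit is the constant \<open>B\<close>.\<close>

definition onb_sequence :: "(nat \<Rightarrow> 'a::real_inner) \<Rightarrow> bool" where
  "onb_sequence e \<longleftrightarrow> (\<forall>i j. i \<noteq> j \<longrightarrow> e i \<bullet> e j = 0) \<and> (\<forall>i. e i = 0 \<or> e i \<bullet> e i = 1) \<and>
    (\<forall>x. (\<lambda>i. (x \<bullet> e i) *\<^sub>R e i) sums x)"

text \<open>The zero vectors pad an orthonormal basis that is finite to a sequence.\<close>

lemma onb_sequence_exists:
  "\<exists>e :: nat \<Rightarrow> 'a::{real_inner,banach,second_countable_topology}. onb_sequence e"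
proof -
  define E where "E = (some_onb :: 'a set)"
  have E: "is_onb E" "orthonormal_set E" "countable E"
    using is_onb_some_onb[where 'a = 'a] countable_orthonormal[of E]
    by (simp_all add: is_onb_def E_def)
  define I where "I = to_nat_on E ` E"
  define e where "e n = (if n \<in> I then from_nat_into E n else 0)" for n
  have inj: "inj_on (to_nat_on E) E"
    using E(3) by (rule inj_on_to_nat_on)
  have e_to_nat: "e (to_nat_on E x) = x" if "x \<in> E" for x
    using E(3) that by (simp add: e_def I_def)
  have eE: "e n \<in> E" if "n \<in> I" for n
    using that e_to_nat by (auto simp: I_def)
  have e0: "e n = 0" if "n \<notin> I" for n
    using that by (simp add: e_def)
  have inj_e: "inj_on e I"
    by (auto simp: inj_on_def I_def e_to_nat)
  have "e i \<bullet> e j = 0" if "i \<noteq> j" for i j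
  proof (cases "i \<in> I \<and> j \<in> I")
    case True
    then have "e i \<noteq> e j" using inj_e that by (auto simp: inj_on_def)
    then show ?thesis using E(2) True eE unfolding orthonormal_set_def by auto
  next
    case False
    then show ?thesis using e0 by auto
  qed
  moreover have "e i = 0 \<or> e i \<bullet> e i = 1" for i
    using E(2) eE e0 unfolding orthonormal_set_def by (cases "i \<in> I") auto
  moreover have "(\<lambda>i. (x \<bullet> e i) *\<^sub>R e i) sums x" for x
  proof -
    have "((\<lambda>y. (x \<bullet> y) *\<^sub>R y) has_sum x) E"
      by (rule onb_expansion[OF E(1)])
    then have "((\<lambda>i. (x \<bullet> e i) *\<^sub>R e i) has_sum x) I"
      unfolding I_def by (subst has_sum_reindex[OF inj]) (simp add: comp_def e_to_nat cong: has_sum_cong)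
    then have "((\<lambda>i. (x \<bullet> e i) *\<^sub>R e i) has_sum x) UNIV"
      by (subst has_sum_cong_neutral[where T = I]) (auto simp: e0)
    then show ?thesis by (rule has_sum_imp_sums)
  qed
  ultimately show ?thesis unfolding onb_sequence_def by blast
qed

definition proj_seq :: "(nat \<Rightarrow> 'a::real_inner) \<Rightarrow> nat \<Rightarrow> 'a \<Rightarrow> 'a" where
  "proj_seq e m x = (\<Sum>i<m. (x \<bullet> e i) *\<^sub>R e i)"

lemma onb_sequence_parseval:
  assumes "onb_sequence e"
  shows "(\<lambda>i. (x \<bullet> e i)\<^sup>2) sums (norm x)\<^sup>2"
proof -
  have "(\<lambda>i. (x \<bullet> e i) *\<^sub>R e i) sums x"
    using assms by (simp add: onb_sequence_def)
  then have "(\<lambda>i. x \<bullet> ((x \<bullet> e i) *\<^sub>R e i)) sums (x \<bullet> x)"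
    by (rule bounded_linear.sums[OF bounded_linear_inner_right])
  then show ?thesis by (simp add: power2_norm_eq_inner flip: power2_eq_square)
qed

text \<open>The factor \<open>e j \<bullet> e j\<close> is 1 for a basis vector and 0 for a padding
  vector, so one formula serves both.\<close>

lemma inner_sum_onb_sequence:
  assumes "onb_sequence e"
  shows "(\<Sum>i<m. c i *\<^sub>R e i) \<bullet> e j = (if j < m then c j * (e j \<bullet> e j) else 0)"
proof -
  have "(\<Sum>i<m. c i *\<^sub>R e i) \<bullet> e j = (\<Sum>i<m. if i = j then c j * (e j \<bullet> e j) else 0)"
    unfolding inner_sum_left inner_scaleR_left
    using assms unfolding onb_sequence_def by (intro sum.cong refl) auto
  then show ?thesis by simp
qed

lemma norm_sum_onb_sequence:
  assumes "onb_sequence e"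
  shows "(norm (\<Sum>i<m. c i *\<^sub>R e i))\<^sup>2 = (\<Sum>i<m. (c i)\<^sup>2 * (e i \<bullet> e i))"
proof -
  have "(norm (\<Sum>i<m. c i *\<^sub>R e i))\<^sup>2 = (\<Sum>j<m. c j * ((\<Sum>i<m. c i *\<^sub>R e i) \<bullet> e j))"
    by (simp add: power2_norm_eq_inner inner_sum_right)
  then show ?thesis
    by (simp add: inner_sum_onb_sequence[OF assms] power2_eq_square mult.assoc)
qed

lemma norm_diff_proj_seq_le:
  assumes "onb_sequence e"
  shows "norm (x - proj_seq e m x) \<le> norm x"
proof -
  have "x \<bullet> proj_seq e m x = (\<Sum>i<m. (x \<bullet> e i)\<^sup>2)"
    by (simp add: proj_seq_def inner_sum_right power2_eq_square)
  moreover have "(norm (proj_seq e m x))\<^sup>2 \<le> (\<Sum>i<m. (x \<bullet> e i)\<^sup>2)"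
    unfolding proj_seq_def norm_sum_onb_sequence[OF assms]
    using assms unfolding onb_sequence_def by (intro sum_mono mult_left_le) (auto, metis inner_zero_left le_numeral_extra(4) zero_le_one)
  moreover have "0 \<le> (\<Sum>i<m. (x \<bullet> e i)\<^sup>2)" by (simp add: sum_nonneg)
  ultimately have "(norm (x - proj_seq e m x))\<^sup>2 \<le> (norm x)\<^sup>2"
    unfolding power2_norm_eq_inner by (simp add: inner_diff_left inner_diff_right inner_commute)
  then show ?thesis by (rule power2_le_imp_le) simp
qed

lemma bounded_linear_proj_seq: "bounded_linear (proj_seq e m)"
  unfolding proj_seq_def
  by (intro bounded_linear_sum bounded_linear_compose[OF bounded_linear_scaleR_left] bounded_linear_inner_left)

lemma proj_seq_tendsto:
  assumes "onb_sequence e"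
  shows "(\<lambda>m. proj_seq e m x) \<longlonglongrightarrow> x"
  using assms unfolding onb_sequence_def sums_def proj_seq_def by simp

section \<open>Convergence in distribution from Lipschitz test functions\<close>

text \<open>The inf-convolution of \<open>g\<close> with the cone \<open>real k * dist x y\<close>
  inherits the Lipschitz constant of the cone, and taking y = x shows that it stays below
  \<open>g\<close>.\<close>

lemma lipschitz_minorants:
  fixes g :: "'a::metric_space \<Rightarrow> real"
  assumes bd: "\<And>x. \<bar>g x\<bar> \<le> K" and cont: "continuous_on UNIV g"
  obtains f where "\<And>k::nat. (real k)-lipschitz_on UNIV (f k)" "\<And>k x. \<bar>f k x\<bar> \<le> K"
    "\<And>k x. f k x \<le> g x" "\<And>x. (\<lambda>k. f k x) \<longlonglongrightarrow> g x"
proof -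
  define f where "f k x = (INF y. g y + real k * dist x y)" for k x
  have lb: "- K \<le> g y + real k * dist x y" for k x y
    using bd[of y] by (auto simp: abs_le_iff intro!: add_increasing2)
  then have bb: "bdd_below (range (\<lambda>y. g y + real k * dist x y))" for k x
    by (intro bdd_belowI2[where m = "-K"])
  have low: "f k x \<le> g y + real k * dist x y" for k x y
    unfolding f_def by (intro cINF_lower bb) simp
  have gr: "c \<le> f k x" if "\<And>y. c \<le> g y + real k * dist x y" for c k x
    unfolding f_def by (rule cINF_greatest) (use that in auto)
  have le: "f k x \<le> g x" for k x
    using low[of k x x] by simp
  have lip: "f k x - f k y \<le> real k * dist x y" for k x y
  proof -
    have "f k x - real k * dist x y \<le> f k y"
    proof (rule gr)
      fix z
      have "f k x \<le> g z + real k * dist x z" by (rule low)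
      also have "real k * dist x z \<le> real k * (dist x y + dist y z)"
        by (intro mult_left_mono dist_triangle) simp
      finally show "f k x - real k * dist x y \<le> g z + real k * dist y z"
        by (simp add: algebra_simps)
    qed
    then show ?thesis by simp
  qed
  show thesis
  proof
    show "(real k)-lipschitz_on UNIV (f k)" for k
    proof (rule lipschitz_onI)
      show "dist (f k x) (f k y) \<le> real k * dist x y" for x y
        using lip[of k x y] lip[of k y x] by (simp add: dist_real_def abs_le_iff dist_commute)
    qed simp
    show "\<bar>f k x\<bar> \<le> K" for k x
      using gr[OF lb, of k x] le[of k x] bd[of x] by (auto simp: abs_le_iff)
    show "f k x \<le> g x" for k x by (rule le)
    show "(\<lambda>k. f k x) \<longlonglongrightarrow> g x" for x
    proof (rule metric_LIMSEQ_I)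
      fix r :: real assume "r > 0"
      obtain \<delta> where \<delta>: "\<delta> > 0" "\<And>y. dist y x < \<delta> \<Longrightarrow> dist (g y) (g x) < r / 2"
        using cont \<open>r > 0\<close> unfolding continuous_on_iff by (metis UNIV_I half_gt_zero)
      \<comment> \<open>From this slope on, the penalty for moving by \<delta> or more exceeds the
        largest possible gain \<open>2 * K\<close>, so only points within \<delta> of
        \<open>x\<close> matter in the infimum.\<close>
      obtain N :: nat where N: "2 * K / \<delta> < real N"
        using reals_Archimedean2 by blast
      have "g x - r / 2 \<le> f k x" if "k \<ge> N" for k
      proof (rule gr)
        fix y
        show "g x - r / 2 \<le> g y + real k * dist x y"
        proof (cases "dist x y < \<delta>")
          case True
          then have "\<bar>g y - g x\<bar> < r / 2" using True \<delta>(2)[of y] unfolding dist_commute[of y x] dist_real_def by blast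
          then have "g x - r / 2 \<le> g y" by linarith
          then show ?thesis by (simp add: add_increasing2)
        next
          case False
          have "2 * K \<le> real N * \<delta>" using N \<delta>(1) by (simp add: field_simps)
          also have "\<dots> \<le> real k * dist x y" using that False \<delta>(1) by (intro mult_mono) auto
          finally show ?thesis using bd[of x] bd[of y] \<open>r > 0\<close> by (auto simp: abs_le_iff)
        qed
      qed
      then have "dist (f k x) (g x) < r" if "k \<ge> N" for k
        using that le[of k x] \<open>r > 0\<close> by (fastforce simp: dist_real_def)
      then show "\<exists>N. \<forall>k\<ge>N. dist (f k x) (g x) < r" by blast
    qed
  qed
qed

lemma (in prob_space) integrable_bounded_continuous:
  fixes g :: "'b::topological_space \<Rightarrow> real"
  assumes "continuous_on UNIV g" "\<And>x. \<bar>g x\<bar> \<le> K" "X \<in> borel_measurable M"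
  shows "integrable M (\<lambda>\<omega>. g (X \<omega>))"
  by (rule integrable_const_bound[where B = K])
    (use assms borel_measurable_continuous_onI[OF assms(1)] in auto)

text \<open>Lipschitz minorants give only a lower bound on the limit inferior of the integrals.
  Applying it to \<open>- g\<close> as well supplies the upper bound.\<close>

lemma conv_in_distr_euclideanI:
  fixes X :: "nat \<Rightarrow> 'w \<Rightarrow> 'a::metric_space"
  assumes M: "prob_space M" and N: "prob_space N"
    and X: "\<And>n. X n \<in> borel_measurable M" and Y: "Y \<in> borel_measurable N"
    and lip: "\<And>g L K. L-lipschitz_on UNIV g \<Longrightarrow> (\<And>x. \<bar>g x\<bar> \<le> (K::real)) \<Longrightarrow>
      (\<lambda>n. \<integral>\<omega>. g (X n \<omega>) \<partial>M) \<longlonglongrightarrow> (\<integral>\<omega>. g (Y \<omega>) \<partial>N)"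
  shows "conv_in_distr euclidean M X N Y"
proof -
  interpret M: prob_space M by fact
  interpret N: prob_space N by fact
  have lower: "\<forall>\<^sub>F n in sequentially. (\<integral>\<omega>. g (Y \<omega>) \<partial>N) - r < (\<integral>\<omega>. g (X n \<omega>) \<partial>M)"
    if g: "continuous_on UNIV g" and K: "\<And>x. \<bar>g x\<bar> \<le> K" and r: "r > 0" for g :: "'a \<Rightarrow> real" and K r :: real
  proof -
    obtain f where f: "\<And>k::nat. (real k)-lipschitz_on UNIV (f k)" "\<And>k x. \<bar>f k x\<bar> \<le> K"
      "\<And>k x. f k x \<le> g x" "\<And>x. (\<lambda>k. f k x) \<longlonglongrightarrow> g x"
      using lipschitz_minorants[OF K g] by metis
    have fc: "continuous_on UNIV (f k)" for k
      using f(1) by (rule lipschitz_on_continuous_on)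
    have "(\<lambda>k. \<integral>\<omega>. f k (Y \<omega>) \<partial>N) \<longlonglongrightarrow> (\<integral>\<omega>. g (Y \<omega>) \<partial>N)"
      by (rule integral_dominated_convergence[where w = "\<lambda>_. K"])
        (use f Y borel_measurable_continuous_onI[OF fc] borel_measurable_continuous_onI[OF g] in auto)
    then obtain k where k: "(\<integral>\<omega>. g (Y \<omega>) \<partial>N) - r < (\<integral>\<omega>. f k (Y \<omega>) \<partial>N)"
      using order_tendstoD(1)[where a = "(\<integral>\<omega>. g (Y \<omega>) \<partial>N) - r"] r eventually_happens'[of sequentially]
      by fastforce
    have "\<forall>\<^sub>F n in sequentially. (\<integral>\<omega>. g (Y \<omega>) \<partial>N) - r < (\<integral>\<omega>. f k (X n \<omega>) \<partial>M)"
      using order_tendstoD(1)[OF lip[OF f(1)[of k] f(2)] k] by simp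
    moreover have "(\<integral>\<omega>. f k (X n \<omega>) \<partial>M) \<le> (\<integral>\<omega>. g (X n \<omega>) \<partial>M)" for n
      by (intro integral_mono M.integrable_bounded_continuous[OF fc f(2) X] M.integrable_bounded_continuous[OF g K X] f(3))
    ultimately show ?thesis
      by (auto elim!: eventually_mono intro: less_le_trans)
  qed
  have "(\<lambda>n. \<integral>\<omega>. g (X n \<omega>) \<partial>M) \<longlonglongrightarrow> (\<integral>\<omega>. g (Y \<omega>) \<partial>N)"
    if g: "continuous_on UNIV g" and K: "\<And>x. \<bar>g x\<bar> \<le> K" for g :: "'a \<Rightarrow> real" and K
    unfolding tendsto_iff
  proof (intro allI impI)
    fix r :: real assume r: "r > 0"
    have "\<forall>\<^sub>F n in sequentially. (\<integral>\<omega>. - g (Y \<omega>) \<partial>N) - r < (\<integral>\<omega>. - g (X n \<omega>) \<partial>M)"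
      by (rule lower) (use g K r in \<open>auto intro: continuous_intros\<close>)
    with lower[OF g K r] show "\<forall>\<^sub>F n in sequentially. dist (\<integral>\<omega>. g (X n \<omega>) \<partial>M) (\<integral>\<omega>. g (Y \<omega>) \<partial>N) < r"
      by eventually_elim (auto simp: dist_real_def)
  qed
  moreover have "borel_of (euclidean :: 'a topology) = borel"
    by (simp add: borel_of_def borel_def)
  ultimately show ?thesis
    unfolding conv_in_distr_def using X Y by (auto simp: bounded_iff image_iff)
qed

section \<open>Trigonometric test functions\<close>

text \<open>The phase \<open>b\<close> brings in the sines and lets the product-to-sum formula close
  the set under multiplication. This yields a real algebra whose integrals are controlled by
  characteristic functions.\<close>

inductive_set trig :: "('a::real_inner \<Rightarrow> real) set" where
  trig_cos: "(\<lambda>x. c * cos (t \<bullet> x + b)) \<in> trig"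
| trig_add: "p \<in> trig \<Longrightarrow> q \<in> trig \<Longrightarrow> (\<lambda>x. p x + q x) \<in> trig"

lemma trig_mult_cos: "p \<in> trig \<Longrightarrow> (\<lambda>x. (c * cos (t \<bullet> x + b)) * p x) \<in> trig"
proof (induction rule: trig.induct)
  case (trig_cos c' t' b')
  have "(\<lambda>x. (c * cos (t \<bullet> x + b)) * (c' * cos (t' \<bullet> x + b'))) =
      (\<lambda>x. c * c' / 2 * cos ((t - t') \<bullet> x + (b - b')) + c * c' / 2 * cos ((t + t') \<bullet> x + (b + b')))"
  proof
    fix x
    have "(c * cos (t \<bullet> x + b)) * (c' * cos (t' \<bullet> x + b')) = c * c' * (cos (t \<bullet> x + b) * cos (t' \<bullet> x + b'))"
      by simp
    also have "\<dots> = c * c' / 2 * cos ((t \<bullet> x + b) - (t' \<bullet> x + b')) + c * c' / 2 * cos ((t \<bullet> x + b) + (t' \<bullet> x + b'))"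
      unfolding cos_times_cos by (simp add: algebra_simps add_divide_distrib)
    also have "(t \<bullet> x + b) - (t' \<bullet> x + b') = (t - t') \<bullet> x + (b - b')"
      by (simp add: inner_diff_left)
    also have "(t \<bullet> x + b) + (t' \<bullet> x + b') = (t + t') \<bullet> x + (b + b')"
      by (simp add: inner_add_left)
    finally show "(c * cos (t \<bullet> x + b)) * (c' * cos (t' \<bullet> x + b')) =
      c * c' / 2 * cos ((t - t') \<bullet> x + (b - b')) + c * c' / 2 * cos ((t + t') \<bullet> x + (b + b'))" .
  qed
  then show ?case by (simp only:) (intro trig.intros)
next
  case (trig_add p q)
  then show ?case unfolding distrib_left by (intro trig.intros)
qed

lemma trig_mult: "p \<in> trig \<Longrightarrow> q \<in> trig \<Longrightarrow> (\<lambda>x. p x * q x) \<in> trig"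
proof (induction rule: trig.induct)
  case (trig_cos c t b)
  then show ?case by (rule trig_mult_cos)
next
  case (trig_add p p')
  then show ?case unfolding distrib_right by (intro trig.intros)
qed

lemma trig_const: "(\<lambda>x. c) \<in> trig"
  using trig_cos[of c 0 0] by simp

lemma trig_cmult: "p \<in> trig \<Longrightarrow> (\<lambda>x. c * p x) \<in> trig"
  using trig_mult[OF trig_const] .

lemma trig_sin: "(\<lambda>x. sin (t \<bullet> x)) \<in> trig"
  using trig_cos[of 1 t "- (pi / 2)"] by (simp add: cos_diff flip: diff_conv_add_uminus)

lemma trig_continuous_on: "p \<in> trig \<Longrightarrow> continuous_on UNIV p"
  by (induction rule: trig.induct) (intro continuous_intros | assumption)+

lemma trig_bounded: "p \<in> trig \<Longrightarrow> \<exists>K. \<forall>x. \<bar>p x\<bar> \<le> K"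
proof (induction rule: trig.induct)
  case (trig_cos c t b)
  have "\<bar>c * cos (t \<bullet> x + b)\<bar> \<le> \<bar>c\<bar>" for x
    by (simp add: abs_mult mult_left_le)
  then show ?case by blast
next
  case (trig_add p q)
  then obtain K L where "\<And>x. \<bar>p x\<bar> \<le> K" "\<And>x. \<bar>q x\<bar> \<le> L" by blast
  then show ?case by (intro exI[of _ "K + L"] allI order_trans[OF abs_triangle_ineq] add_mono)
qed

lemma (in prob_space) trig_integrable:
  "p \<in> trig \<Longrightarrow> X \<in> borel_measurable M \<Longrightarrow> integrable M (\<lambda>\<omega>. p (X \<omega>))"
  using trig_bounded[of p] trig_continuous_on[of p] integrable_bounded_continuous[of p _ X] by blast

lemma trig_integral_tendsto:
  assumes M: "prob_space M" and N: "prob_space N"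
    and X: "\<And>n. X n \<in> borel_measurable M" and Y: "Y \<in> borel_measurable N"
    and lim: "\<And>t b. (\<lambda>n. \<integral>\<omega>. cos (t \<bullet> X n \<omega> + b) \<partial>M) \<longlonglongrightarrow> (\<integral>\<omega>. cos (t \<bullet> Y \<omega> + b) \<partial>N)"
    and p: "p \<in> trig"
  shows "(\<lambda>n. \<integral>\<omega>. p (X n \<omega>) \<partial>M) \<longlonglongrightarrow> (\<integral>\<omega>. p (Y \<omega>) \<partial>N)"
  using p
proof (induction rule: trig.induct)
  case (trig_cos c t b)
  then show ?case by (simp add: tendsto_mult_left lim)
next
  case (trig_add p q)
  then show ?case
    using tendsto_add[OF trig_add.IH]
    by (simp add: prob_space.trig_integrable[OF M _ X] prob_space.trig_integrable[OF N _ Y])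
qed

text \<open>This is the range available to finitely many sines, hence the compact domain for
  Stone-Weierstrass. Each new coordinate adds a factor [-1, 1] followed by a continuous map.\<close>

lemma compact_onb_cube:
  "compact {\<Sum>i<m. s i *\<^sub>R e i |s. \<forall>i. \<bar>s i\<bar> \<le> (1::real)}" for e :: "nat \<Rightarrow> 'a::real_normed_vector"
proof (induction m)
  case (Suc m)
  let ?S = "\<lambda>m. {\<Sum>i<m. s i *\<^sub>R e i |s. \<forall>i. \<bar>s i\<bar> \<le> (1::real)}"
  have "?S (Suc m) = (\<lambda>(x, u). x + u *\<^sub>R e m) ` (?S m \<times> {-1..1})" (is "_ = ?R")
  proof
    show "?S (Suc m) \<subseteq> ?R"
    proof
      fix x assume "x \<in> ?S (Suc m)"
      then obtain s where s: "\<forall>i. \<bar>s i\<bar> \<le> 1" "x = (\<Sum>i<Suc m. s i *\<^sub>R e i)" by blast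
      then show "x \<in> ?R"
        by (intro image_eqI[of _ _ "(\<Sum>i<m. s i *\<^sub>R e i, s m)"]) (auto simp: abs_le_iff minus_le_iff)
    qed
    show "?R \<subseteq> ?S (Suc m)"
    proof (clarsimp)
      fix s :: "nat \<Rightarrow> real" and u :: real assume "\<forall>i. \<bar>s i\<bar> \<le> 1" "- 1 \<le> u" "u \<le> (1::real)"
      then show "\<exists>s'. (\<Sum>i<m. s i *\<^sub>R e i) + u *\<^sub>R e m = (\<Sum>i<m. s' i *\<^sub>R e i) + s' m *\<^sub>R e m \<and> (\<forall>i. \<bar>s' i\<bar> \<le> 1)"
        by (intro exI[of _ "s(m := u)"]) auto
    qed
  qed
  moreover have "compact ?R"
    by (intro compact_continuous_image compact_Times Suc)
      (auto simp: case_prod_beta intro!: continuous_intros)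
  ultimately show ?case by simp
next
  case 0
  have "{\<Sum>i<0. s i *\<^sub>R e i |s. \<forall>i. \<bar>s i\<bar> \<le> (1::real)} = {0}"
    by (auto intro: exI[of _ "\<lambda>_. 0"])
  then show ?case by simp
qed

text \<open>The triangle wave \<open>u \<mapsto> (2 R / \<pi>) arcsin (sin (\<pi> u / (2 R)))\<close> is the identity on \<open>[-R, R]\<close> and a
  continuous function of a sine, so cutting off coordinates with it leads to functions that are
  uniformly close to trigonometric polynomials on the whole space.\<close>

definition triangle_wave :: "real \<Rightarrow> real \<Rightarrow> real" where
  "triangle_wave R u = 2 * R / pi * arcsin (sin (pi / (2 * R) * u))"

text \<open>Inside [-R, R] the error vanishes. Outside, the wave is bounded by R, so the error is at
  most 2|u|, and |u| > R turns this into a quadratic bound that second moments can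
  integrate.\<close>

lemma triangle_wave_error:
  assumes "R > 0"
  shows "\<bar>u - triangle_wave R u\<bar> \<le> 2 * u\<^sup>2 / R"
proof (cases "\<bar>u\<bar> \<le> R")
  case True
  then have "\<bar>pi / (2 * R) * u\<bar> \<le> pi / (2 * R) * R"
    using assms by (simp add: abs_mult field_simps)
  then have "\<bar>pi / (2 * R) * u\<bar> \<le> pi / 2"
    using assms by simp
  then have "- (pi / 2) \<le> pi / (2 * R) * u" "pi / (2 * R) * u \<le> pi / 2"
    unfolding abs_le_iff by linarith+
  then have "arcsin (sin (pi / (2 * R) * u)) = pi / (2 * R) * u"
    by (rule arcsin_sin)
  then show ?thesis using assms by (simp add: triangle_wave_def)
next
  case False
  have "\<bar>arcsin (sin (pi / (2 * R) * u))\<bar> \<le> pi / 2"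
    using arcsin_bounded[of "sin (pi / (2 * R) * u)"] by (auto simp: abs_le_iff)
  then have "\<bar>triangle_wave R u\<bar> \<le> 2 * R / pi * (pi / 2)"
    unfolding triangle_wave_def abs_mult using assms by (intro mult_mono) auto
  then have "\<bar>u - triangle_wave R u\<bar> \<le> 2 * \<bar>u\<bar>"
    using assms False by simp
  also have "2 * \<bar>u\<bar> * R \<le> 2 * \<bar>u\<bar> * \<bar>u\<bar>"
    using False by (intro mult_left_mono) auto
  then have "2 * \<bar>u\<bar> \<le> 2 * u\<^sup>2 / R"
    using assms by (simp add: field_simps power2_eq_square)
  finally show ?thesis .
qed

text \<open>The cut-off argument factors through the vector of sines \<open>w x\<close>, which never
  leaves the compact cube \<open>S\<close>. Approximating \<open>h\<close> uniformly on
  \<open>S\<close> therefore approximates the composite uniformly on all of the Hilbert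
  space.\<close>

lemma trig_approximation:
  fixes f :: "'a::real_inner \<Rightarrow> real"
  assumes e: "onb_sequence e" and f: "continuous_on UNIV f" and "R > 0" "\<epsilon> > 0"
  obtains q where "q \<in> trig"
    "\<And>x. \<bar>f (\<Sum>i<m. triangle_wave R (x \<bullet> e i) *\<^sub>R e i) - q x\<bar> < \<epsilon>"
proof -
  define c where "c = pi / (2 * R)"
  define w where "w x = (\<Sum>i<m. sin (c * (x \<bullet> e i)) *\<^sub>R e i)" for x
  define S where "S = {\<Sum>i<m. s i *\<^sub>R e i |s. \<forall>i. \<bar>s i\<bar> \<le> (1::real)}"
  define h where "h s = f (\<Sum>i<m. (2 * R / pi * arcsin (s \<bullet> e i)) *\<^sub>R e i)" for s
  \<comment> \<open>The algebra for Stone-Weierstrass: functions continuous on the cube whose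
    pullback along \<open>w\<close> is a trigonometric polynomial.\<close>
  define P where "P p \<longleftrightarrow> (\<lambda>x. p (w x)) \<in> trig \<and> continuous_on S p" for p
  have e01: "e i = 0 \<or> e i \<bullet> e i = 1" for i
    using e unfolding onb_sequence_def by blast
  have wS: "w x \<in> S" for x
    unfolding S_def w_def by (auto intro!: exI[of _ "\<lambda>i. sin (c * (x \<bullet> e i))"])
  have Sb: "-1 \<le> x \<bullet> e i \<and> x \<bullet> e i \<le> 1" if x: "x \<in> S" for x i
  proof -
    obtain s where s: "\<forall>i. \<bar>s i\<bar> \<le> 1" "x = (\<Sum>i<m. s i *\<^sub>R e i)" using x by (auto simp: S_def)
    have "x \<bullet> e i = (if i < m then s i * (e i \<bullet> e i) else 0)"
      unfolding s(2) by (rule inner_sum_onb_sequence[OF e])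
    then have "\<bar>x \<bullet> e i\<bar> \<le> 1" using e01[of i] s(1) by auto
    then show ?thesis by (auto simp: abs_le_iff)
  qed
  have hS: "continuous_on S h"
    unfolding h_def using Sb
    by (intro continuous_on_compose2[OF f] continuous_intros) auto
  have sep: "\<exists>p. P p \<and> p x \<noteq> p y" if xy: "x \<in> S" "y \<in> S" "x \<noteq> y" for x y
  proof -
    obtain s where s: "x = (\<Sum>i<m. s i *\<^sub>R e i)" using xy by (auto simp: S_def)
    obtain s' where s': "y = (\<Sum>i<m. s' i *\<^sub>R e i)" using xy by (auto simp: S_def)
    have "(x - y) \<bullet> (x - y) = (x - y) \<bullet> (\<Sum>i<m. (s i - s' i) *\<^sub>R e i)"
      by (simp add: s s' scaleR_diff_left sum_subtractf)
    also have "\<dots> = (\<Sum>i<m. (s i - s' i) * ((x - y) \<bullet> e i))"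
      by (simp add: inner_sum_right)
    finally have "(x - y) \<bullet> (x - y) = (\<Sum>i<m. (s i - s' i) * ((x - y) \<bullet> e i))" .
    moreover have "(x - y) \<bullet> (x - y) \<noteq> 0" using xy(3) by simp
    ultimately have "(\<Sum>i<m. (s i - s' i) * ((x - y) \<bullet> e i)) \<noteq> 0" by simp
    then obtain i where i: "i < m" "(x - y) \<bullet> e i \<noteq> 0"
      by (metis (no_types, lifting) lessThan_iff mult_zero_right sum.neutral)
    \<comment> \<open>The coordinate functions separate the points of the cube, and their pullback
      along \<open>w\<close> is a multiple of a single sine.\<close>
    have "(\<lambda>x. w x \<bullet> e i) = (\<lambda>x. (e i \<bullet> e i) * sin ((c *\<^sub>R e i) \<bullet> x))"
      unfolding w_def inner_sum_onb_sequence[OF e] using i by (simp add: inner_commute mult.commute)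
    then have "P (\<lambda>x. x \<bullet> e i)"
      unfolding P_def by (simp only:) (intro conjI trig_cmult trig_sin continuous_intros)
    then show ?thesis using i(2) by (auto simp: inner_diff_left)
  qed
  have "\<exists>p. P p \<and> (\<forall>x\<in>S. \<bar>h x - p x\<bar> < \<epsilon>)"
  proof (rule Stone_Weierstrass_HOL[of S P, OF _ _ _ _ _ _ hS \<open>\<epsilon> > 0\<close>])
    show "compact S" unfolding S_def by (rule compact_onb_cube)
  qed (use sep in \<open>auto simp: P_def intro: trig_const trig_add trig_mult continuous_intros\<close>)
  then obtain p where p: "P p" "\<And>x. x \<in> S \<Longrightarrow> \<bar>h x - p x\<bar> < \<epsilon>" by blast
  have "h (w x) = f (\<Sum>i<m. triangle_wave R (x \<bullet> e i) *\<^sub>R e i)" for x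
    unfolding h_def
  proof (intro arg_cong[where f = f] sum.cong refl)
    fix i assume "i \<in> {..<m}"
    then show "(2 * R / pi * arcsin (w x \<bullet> e i)) *\<^sub>R e i = triangle_wave R (x \<bullet> e i) *\<^sub>R e i"
      unfolding w_def inner_sum_onb_sequence[OF e] using e01[of i] by (auto simp: triangle_wave_def c_def)
  qed
  then show thesis
    using that[of "\<lambda>x. p (w x)"] p wS unfolding P_def by metis
qed

section \<open>Weak convergence in a Hilbert space\<close>

text \<open>Everything random on the right is squared, so that only second moments are needed. The
  unsquared tail \<open>a\<close> is traded for \<open>\<delta> + a\<^sup>2 / \<delta>\<close>, and
  the cut-off error of the coordinates sums by Parseval to a bound independent of
  \<open>m\<close>.\<close>

lemma norm_diff_triangle_waves:
  assumes e: "onb_sequence e" and "R > 0" "\<delta> > 0"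
  shows "norm (x - (\<Sum>i<m. triangle_wave R (x \<bullet> e i) *\<^sub>R e i))
    \<le> \<delta> + (norm (x - proj_seq e m x))\<^sup>2 / \<delta> + 2 * (norm x)\<^sup>2 / R"
proof -
  have ne: "norm (e i) \<le> 1" for i
    using e unfolding onb_sequence_def by (metis norm_eq_sqrt_inner norm_zero order_refl real_sqrt_one zero_le_one)
  have "norm (proj_seq e m x - (\<Sum>i<m. triangle_wave R (x \<bullet> e i) *\<^sub>R e i))
      \<le> (\<Sum>i<m. norm ((x \<bullet> e i - triangle_wave R (x \<bullet> e i)) *\<^sub>R e i))"
    unfolding proj_seq_def sum_subtractf[symmetric] scaleR_diff_left[symmetric] by (rule norm_sum)
  also have "\<dots> \<le> (\<Sum>i<m. 2 * (x \<bullet> e i)\<^sup>2 / R)"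
    unfolding norm_scaleR real_norm_def
    using triangle_wave_error[OF \<open>R > 0\<close>] ne
    by (intro sum_mono order_trans[OF mult_left_le]) auto
  also have "\<dots> = 2 / R * (\<Sum>i<m. (x \<bullet> e i)\<^sup>2)"
    by (simp add: sum_distrib_left)
  also have "\<dots> \<le> 2 / R * (norm x)\<^sup>2"
    using sum_le_suminf[OF sums_summable[OF onb_sequence_parseval[OF e, of x]], of "{..<m}"]
      sums_unique[OF onb_sequence_parseval[OF e, of x]] \<open>R > 0\<close>
    by (intro mult_left_mono) auto
  finally have 1: "norm (proj_seq e m x - (\<Sum>i<m. triangle_wave R (x \<bullet> e i) *\<^sub>R e i)) \<le> 2 * (norm x)\<^sup>2 / R"
    by simp
  have 2: "a \<le> \<delta> + a\<^sup>2 / \<delta>" if "0 \<le> a" for a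
  proof (cases "a \<le> \<delta>")
    case False
    then have "a * \<delta> \<le> a * a" using that by (intro mult_left_mono) auto
    then show ?thesis using \<open>\<delta> > 0\<close> by (simp add: field_simps power2_eq_square add_increasing)
  qed (use \<open>\<delta> > 0\<close> in \<open>simp add: add_increasing2\<close>)
  have "norm (x - (\<Sum>i<m. triangle_wave R (x \<bullet> e i) *\<^sub>R e i))
      \<le> norm (x - proj_seq e m x) + norm (proj_seq e m x - (\<Sum>i<m. triangle_wave R (x \<bullet> e i) *\<^sub>R e i))"
    using norm_triangle_ineq[of "x - proj_seq e m x" "proj_seq e m x - (\<Sum>i<m. triangle_wave R (x \<bullet> e i) *\<^sub>R e i)"]
    by simp
  then show ?thesis
    using 1 2[of "norm (x - proj_seq e m x)"] by simp
qed

text \<open>The tail is measured against \<open>\<delta>\<^sup>2\<close> so that dividing it by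
  \<delta> leaves another \<delta>. As the term with \<open>R\<close> does not involve
  \<open>m\<close>, the cut-off level can be fixed before the dimension.\<close>

lemma (in prob_space) expectation_trig_error:
  fixes X :: "'a \<Rightarrow> 'b::real_inner"
  assumes e: "onb_sequence e" and R: "R > 0" and \<delta>: "\<delta> > 0"
    and X: "X \<in> borel_measurable M" "integrable M (\<lambda>\<omega>. (norm (X \<omega>))\<^sup>2)" "expectation (\<lambda>\<omega>. (norm (X \<omega>))\<^sup>2) \<le> V"
    and tail: "expectation (\<lambda>\<omega>. (norm (X \<omega> - proj_seq e m (X \<omega>)))\<^sup>2) \<le> \<delta>\<^sup>2"
    and f: "L-lipschitz_on UNIV f" "\<And>x. \<bar>f x\<bar> \<le> (K::real)"
    and q: "q \<in> trig" "\<And>x. \<bar>f (\<Sum>i<m. triangle_wave R (x \<bullet> e i) *\<^sub>R e i) - q x\<bar> < \<epsilon>"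
  shows "\<bar>expectation (\<lambda>\<omega>. f (X \<omega>)) - expectation (\<lambda>\<omega>. q (X \<omega>))\<bar> \<le> \<epsilon> + L * (2 * \<delta> + 2 * V / R)"
proof -
  let ?T = "\<lambda>x. \<Sum>i<m. triangle_wave R (x \<bullet> e i) *\<^sub>R e i"
  let ?D = "\<lambda>x. norm (x - proj_seq e m x)"
  have L: "L \<ge> 0" using f(1) by (rule lipschitz_on_nonneg)
  have mD: "(\<lambda>\<omega>. ?D (X \<omega>)) \<in> borel_measurable M"
    by (rule measurable_compose[OF X(1)], intro borel_measurable_continuous_onI continuous_intros
        linear_continuous_on bounded_linear_proj_seq)
  have iD: "integrable M (\<lambda>\<omega>. (?D (X \<omega>))\<^sup>2)"
    by (rule Bochner_Integration.integrable_bound[OF X(2)])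
      (use mD norm_diff_proj_seq_le[OF e] in \<open>auto intro!: power_mono\<close>)
  have pw: "\<bar>f x - q x\<bar> \<le> \<epsilon> + L * (\<delta> + (?D x)\<^sup>2 / \<delta> + 2 * (norm x)\<^sup>2 / R)" for x
  proof -
    have "\<bar>f x - f (?T x)\<bar> \<le> L * norm (x - ?T x)"
      using lipschitz_onD[OF f(1), of x "?T x"] by (simp add: dist_norm)
    also have "\<dots> \<le> L * (\<delta> + (?D x)\<^sup>2 / \<delta> + 2 * (norm x)\<^sup>2 / R)"
      by (intro mult_left_mono norm_diff_triangle_waves e R \<delta> L)
    finally show ?thesis using q(2)[of x] by linarith
  qed
  have "\<bar>expectation (\<lambda>\<omega>. f (X \<omega>)) - expectation (\<lambda>\<omega>. q (X \<omega>))\<bar> = \<bar>expectation (\<lambda>\<omega>. f (X \<omega>) - q (X \<omega>))\<bar>"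
    by (subst Bochner_Integration.integral_diff)
      (auto intro: trig_integrable q X integrable_bounded_continuous[OF lipschitz_on_continuous_on[OF f(1)] f(2) X(1)])
  also have "\<dots> \<le> expectation (\<lambda>\<omega>. \<bar>f (X \<omega>) - q (X \<omega>)\<bar>)"
    by (rule integral_abs_bound)
  also have "\<dots> \<le> expectation (\<lambda>\<omega>. \<epsilon> + L * (\<delta> + (?D (X \<omega>))\<^sup>2 / \<delta> + 2 * (norm (X \<omega>))\<^sup>2 / R))"
  proof (rule integral_mono')
    show "integrable M (\<lambda>\<omega>. \<epsilon> + L * (\<delta> + (?D (X \<omega>))\<^sup>2 / \<delta> + 2 * (norm (X \<omega>))\<^sup>2 / R))"
      by (intro Bochner_Integration.integrable_add integrable_const integrable_mult_right
          integrable_divide iD X(2))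
  qed (use pw order_trans[OF abs_ge_zero pw] in auto)
  also have "\<dots> = \<epsilon> + L * (\<delta> + expectation (\<lambda>\<omega>. (?D (X \<omega>))\<^sup>2) / \<delta> + 2 * expectation (\<lambda>\<omega>. (norm (X \<omega>))\<^sup>2) / R)"
    using iD X(2) by (simp add: prob_space)
  also have "\<dots> \<le> \<epsilon> + L * (\<delta> + \<delta>\<^sup>2 / \<delta> + 2 * V / R)"
    using L R \<delta> tail X(3) by (intro add_mono mult_left_mono divide_right_mono order_refl) auto
  also have "\<delta>\<^sup>2 / \<delta> = \<delta>" using \<delta> by (simp add: power2_eq_square)
  finally show ?thesis by simp
qed

text \<open>The order of choices avoids circularity: \<delta> and \<open>R\<close> depend on the
  test function and on \<open>V\<close> alone, then \<open>m\<close> is taken from the tail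
  condition, then the polynomial \<open>q\<close>, and n is sent to infinity last.\<close>

theorem conv_in_distr_hilbertI:
  fixes X :: "nat \<Rightarrow> 'w \<Rightarrow> 'a::real_inner"
  assumes M: "prob_space M" and N: "prob_space N" and e: "onb_sequence e"
    and X: "\<And>n. X n \<in> borel_measurable M" "\<And>n. integrable M (\<lambda>\<omega>. (norm (X n \<omega>))\<^sup>2)"
      "\<And>n. (\<integral>\<omega>. (norm (X n \<omega>))\<^sup>2 \<partial>M) \<le> V"
    and Y: "Y \<in> borel_measurable N" "integrable N (\<lambda>\<omega>. (norm (Y \<omega>))\<^sup>2)"
      "(\<integral>\<omega>. (norm (Y \<omega>))\<^sup>2 \<partial>N) \<le> V"
    and lim: "\<And>t b. (\<lambda>n. \<integral>\<omega>. cos (t \<bullet> X n \<omega> + b) \<partial>M) \<longlonglongrightarrow> (\<integral>\<omega>. cos (t \<bullet> Y \<omega> + b) \<partial>N)"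
    and tail: "\<And>\<delta>. \<delta> > 0 \<Longrightarrow> \<exists>m. (\<forall>n. (\<integral>\<omega>. (norm (X n \<omega> - proj_seq e m (X n \<omega>)))\<^sup>2 \<partial>M) \<le> \<delta>) \<and>
      (\<integral>\<omega>. (norm (Y \<omega> - proj_seq e m (Y \<omega>)))\<^sup>2 \<partial>N) \<le> \<delta>"
  shows "conv_in_distr euclidean M X N Y"
proof (rule conv_in_distr_euclideanI[OF M N X(1) Y(1)])
  fix f :: "'a \<Rightarrow> real" and L K
  assume f: "L-lipschitz_on UNIV f" "\<And>x. \<bar>f x\<bar> \<le> K"
  have L: "L \<ge> 0" using f(1) by (rule lipschitz_on_nonneg)
  have V: "V \<ge> 0" by (rule order_trans[OF _ Y(3)]) simp
  show "(\<lambda>n. \<integral>\<omega>. f (X n \<omega>) \<partial>M) \<longlonglongrightarrow> (\<integral>\<omega>. f (Y \<omega>) \<partial>N)"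
  proof (rule metric_LIMSEQ_I)
    fix r :: real assume r: "r > 0"
    \<comment> \<open>The contributions of \<epsilon>, \<delta> and \<open>R\<close> are at most r/8
      each. The errors for \<open>X n\<close> and for \<open>Y\<close> are thus at most 3r/8, and
      r/8 remains for the convergence of \<open>q\<close>: 7r/8 in total. Using L + 1 and V + 1
      keeps \<delta> and \<open>R\<close> positive when \<open>L\<close> or \<open>V\<close> is
      zero.\<close>
    define \<epsilon> where "\<epsilon> = r / 8"
    define \<delta> where "\<delta> = r / (16 * (L + 1))"
    define R where "R = 16 * (L + 1) * (V + 1) / r"
    have pos: "\<epsilon> > 0" "\<delta> > 0" "R > 0" using r L V by (auto simp: \<epsilon>_def \<delta>_def R_def)
    have "L * (2 * \<delta>) \<le> (L + 1) * (2 * \<delta>)" "L * (2 * V / R) \<le> (L + 1) * (2 * (V + 1) / R)"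
      using L V pos by (auto intro!: mult_mono divide_right_mono)
    moreover have scale: "a * (2 * (r / (16 * a))) = r / 8" "a * (2 * b / (16 * a * b / r)) = r / 8"
      if "a \<noteq> 0" "b \<noteq> 0" for a b
      using r that by (simp_all add: field_simps)
    have "(L + 1) * (2 * \<delta>) = r / 8" "(L + 1) * (2 * (V + 1) / R) = r / 8"
      unfolding \<delta>_def R_def by (rule scale(1)[of _ 1] scale(2); use L V in simp)+
    ultimately have small: "\<epsilon> + L * (2 * \<delta> + 2 * V / R) \<le> 3 * r / 8"
      unfolding distrib_left \<epsilon>_def by linarith
    obtain m where m: "\<And>n. (\<integral>\<omega>. (norm (X n \<omega> - proj_seq e m (X n \<omega>)))\<^sup>2 \<partial>M) \<le> \<delta>\<^sup>2"
      "(\<integral>\<omega>. (norm (Y \<omega> - proj_seq e m (Y \<omega>)))\<^sup>2 \<partial>N) \<le> \<delta>\<^sup>2"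
      using tail[of "\<delta>\<^sup>2"] pos by auto
    obtain q where q: "q \<in> trig" "\<And>x. \<bar>f (\<Sum>i<m. triangle_wave R (x \<bullet> e i) *\<^sub>R e i) - q x\<bar> < \<epsilon>"
      using trig_approximation[OF e lipschitz_on_continuous_on[OF f(1)] pos(3,1)] by metis
    have 1: "\<bar>(\<integral>\<omega>. f (X n \<omega>) \<partial>M) - (\<integral>\<omega>. q (X n \<omega>) \<partial>M)\<bar> \<le> 3 * r / 8" for n
      using prob_space.expectation_trig_error[OF M e pos(3,2) X m(1) f q] small by (rule order_trans)
    have 2: "\<bar>(\<integral>\<omega>. f (Y \<omega>) \<partial>N) - (\<integral>\<omega>. q (Y \<omega>) \<partial>N)\<bar> \<le> 3 * r / 8"
      using prob_space.expectation_trig_error[OF N e pos(3,2) Y m(2) f q] small by (rule order_trans)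
    obtain n0 where n0: "\<And>n. n \<ge> n0 \<Longrightarrow> dist (\<integral>\<omega>. q (X n \<omega>) \<partial>M) (\<integral>\<omega>. q (Y \<omega>) \<partial>N) < r / 8"
      using metric_LIMSEQ_D[OF trig_integral_tendsto[OF M N X(1) Y(1) lim q(1)], of "r / 8"] r by auto
    have "dist (\<integral>\<omega>. f (X n \<omega>) \<partial>M) (\<integral>\<omega>. f (Y \<omega>) \<partial>N) < r" if "n \<ge> n0" for n
      using 1[of n] 2 n0[OF that] r unfolding dist_real_def by linarith
    then show "\<exists>no. \<forall>n\<ge>no. dist (\<integral>\<omega>. f (X n \<omega>) \<partial>M) (\<integral>\<omega>. f (Y \<omega>) \<partial>N) < r" by blast
  qed
qed

section \<open>Sums of independent Hilbert space valued random variables\<close>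

lemma (in prob_space) integrable_of_square:
  fixes X :: "'a \<Rightarrow> 'b::{banach,second_countable_topology}"
  assumes "X \<in> borel_measurable M" "integrable M (\<lambda>\<omega>. (norm (X \<omega>))\<^sup>2)"
  shows "integrable M X"
proof -
  have "integrable M (\<lambda>\<omega>. norm (X \<omega>))"
    by (rule square_integrable_imp_integrable) (use assms in auto)
  then show ?thesis by (rule iffD1[OF integrable_norm_iff[OF assms(1)]])
qed

lemma (in prob_space) integrable_square_bounded_linear:
  fixes X :: "'a \<Rightarrow> 'b::{banach,second_countable_topology}" and A :: "'b \<Rightarrow> 'c::{banach,second_countable_topology}"
  assumes "X \<in> borel_measurable M" "integrable M (\<lambda>\<omega>. (norm (X \<omega>))\<^sup>2)" "bounded_linear A"
  shows "integrable M (\<lambda>\<omega>. (norm (A (X \<omega> - c)))\<^sup>2)"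
proof -
  interpret A: bounded_linear A by fact
  obtain K where K: "0 < K" "\<And>x. norm (A x) \<le> norm x * K" using A.pos_bounded by blast
  have b: "(norm (A (x - c)))\<^sup>2 \<le> (2 * (norm x)\<^sup>2 + 2 * (norm c)\<^sup>2) * K\<^sup>2" for x
  proof -
    have "(norm (A (x - c)))\<^sup>2 \<le> (norm (x - c) * K)\<^sup>2" by (intro power_mono K) auto
    also have "\<dots> \<le> ((norm x + norm c) * K)\<^sup>2"
      using K by (intro power_mono mult_right_mono norm_triangle_ineq4) auto
    also have "\<dots> \<le> (2 * (norm x)\<^sup>2 + 2 * (norm c)\<^sup>2) * K\<^sup>2"
      unfolding power_mult_distrib using sum_squares_bound[of "norm x" "norm c"]
      by (intro mult_right_mono) (auto simp: power2_sum)
    finally show ?thesis .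
  qed
  have m: "(\<lambda>\<omega>. A (X \<omega> - c)) \<in> borel_measurable M"
    using assms by (intro measurable_compose[OF _ borel_measurable_continuous_onI[OF linear_continuous_on[OF assms(3)]]]) auto
  show ?thesis
    by (rule Bochner_Integration.integrable_bound[of _ "\<lambda>\<omega>. (2 * (norm (X \<omega>))\<^sup>2 + 2 * (norm c)\<^sup>2) * K\<^sup>2"])
      (use assms(2) m b in \<open>auto intro!: order_trans[OF _ abs_ge_self]\<close>)
qed

locale iid_square_integrable = prob_space M
  for M :: "'w measure" and X :: "nat \<Rightarrow> 'w \<Rightarrow> 'a::{real_inner,banach,second_countable_topology}"
    and \<mu> :: "'a measure" +
  assumes indep: "indep_vars (\<lambda>_. borel) X UNIV" and law: "\<And>i. distr M borel (X i) = \<mu>"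
    and square_integrable: "integrable \<mu> (\<lambda>x. (norm x)\<^sup>2)"
begin

lemma X_measurable [measurable]: "X i \<in> borel_measurable M"
  using indep by (simp add: indep_vars_def2)

lemma sets_law [measurable_cong]: "sets \<mu> = sets borel"
  by (simp flip: law[of 0])

lemma prob_space_law: "prob_space \<mu>"
  unfolding law[of 0, symmetric] by (rule prob_space_distr) simp

lemma expectation_law:
  fixes g :: "'a \<Rightarrow> 'b::{banach,second_countable_topology}"
  assumes "g \<in> borel_measurable borel"
  shows "expectation (\<lambda>\<omega>. g (X i \<omega>)) = (\<integral>x. g x \<partial>\<mu>)"
  unfolding law[of i, symmetric] using assms by (simp add: integral_distr)

lemma integrable_law:
  fixes g :: "'a \<Rightarrow> 'b::{banach,second_countable_topology}"
  assumes "g \<in> borel_measurable borel"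
  shows "integrable M (\<lambda>\<omega>. g (X i \<omega>)) \<longleftrightarrow> integrable \<mu> g"
  unfolding law[of i, symmetric] using assms by (simp add: integrable_distr_eq)

definition mean :: 'a where "mean = (\<integral>x. x \<partial>\<mu>)"

lemma integrable_id: "integrable \<mu> (\<lambda>x. x)"
  by (rule prob_space.integrable_of_square[OF prob_space_law measurable_ident_sets[OF sets_law] square_integrable])

lemma integrable_square_linear:
  fixes A :: "'a \<Rightarrow> 'b::{banach,second_countable_topology}"
  assumes "bounded_linear A"
  shows "integrable \<mu> (\<lambda>x. (norm (A (x - c)))\<^sup>2)"
  by (rule prob_space.integrable_square_bounded_linear[OF prob_space_law measurable_ident_sets[OF sets_law]
        square_integrable assms])

lemma indep_pair: "i \<noteq> j \<Longrightarrow> indep_var borel (X i) borel (X j)"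
proof -
  assume "i \<noteq> j"
  then have "indep_var (PiM {i} (\<lambda>_. borel)) (\<lambda>\<omega>. restrict (\<lambda>i. X i \<omega>) {i})
      (PiM {j} (\<lambda>_. borel)) (\<lambda>\<omega>. restrict (\<lambda>i. X i \<omega>) {j})"
    by (intro indep_var_restrict[OF indep]) auto
  then have "indep_var borel ((\<lambda>f. f i) \<circ> (\<lambda>\<omega>. restrict (\<lambda>i. X i \<omega>) {i}))
      borel ((\<lambda>f. f j) \<circ> (\<lambda>\<omega>. restrict (\<lambda>i. X i \<omega>) {j}))"
    by (rule indep_var_compose) (rule measurable_component_singleton, simp)+
  then show ?thesis by (simp add: comp_def)
qed

text \<open>By independence the joint law is a product, and by Fubini the inner integral is the
  inner product of a fixed vector with the mean of \<open>g\<close>, which is zero.\<close>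

lemma expectation_inner_eq_0:
  assumes A: "bounded_linear A" and ij: "i \<noteq> j"
  shows "integrable M (\<lambda>\<omega>. A (X i \<omega> - mean) \<bullet> A (X j \<omega> - mean))"
    and "expectation (\<lambda>\<omega>. A (X i \<omega> - mean) \<bullet> (A (X j \<omega> - mean) :: 'a)) = 0"
proof -
  interpret A: bounded_linear A by fact
  interpret \<mu>: prob_space \<mu> by (rule prob_space_law)
  interpret pair_sigma_finite \<mu> \<mu> ..
  define g where "g x = A (x - mean)" for x
  have [measurable]: "A \<in> borel_measurable borel"
    using A by (intro borel_measurable_continuous_onI linear_continuous_on)
  have [measurable]: "g \<in> borel_measurable borel"
    unfolding g_def[abs_def] by measurable
  have sq: "integrable M (\<lambda>\<omega>. (norm (g (X i \<omega>)))\<^sup>2)" for i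
    using integrable_square_linear[OF A, of mean] by (subst integrable_law) (auto simp: g_def)
  show int: "integrable M (\<lambda>\<omega>. A (X i \<omega> - mean) \<bullet> A (X j \<omega> - mean))"
    unfolding g_def[symmetric]
    by (rule Bochner_Integration.integrable_bound[OF Bochner_Integration.integrable_add[OF sq[of i] sq[of j]]])
      (auto intro: order_trans[OF inner_le_norm_squares])
  have joint: "\<mu> \<Otimes>\<^sub>M \<mu> = distr M (borel \<Otimes>\<^sub>M borel) (\<lambda>\<omega>. (X i \<omega>, X j \<omega>))"
    using indep_pair[OF ij] unfolding indep_var_distribution_eq by (simp add: law)
  have g0: "(\<integral>x. g x \<partial>\<mu>) = 0"
  proof -
    have "(\<integral>x. g x \<partial>\<mu>) = A (\<integral>x. x - mean \<partial>\<mu>)"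
      unfolding g_def using integrable_id by (intro integral_bounded_linear[OF A]) auto
    also have "(\<integral>x. x - mean \<partial>\<mu>) = 0"
      using integrable_id by (simp add: mean_def \<mu>.prob_space)
    finally show ?thesis by (simp add: A.zero)
  qed
  have "integrable \<mu> g"
    using integrable_id unfolding g_def by (intro integrable_bounded_linear[OF A]) auto
  then have inner0: "(\<integral>y. g x \<bullet> g y \<partial>\<mu>) = 0" for x
    using g0 by simp
  have "integrable (\<mu> \<Otimes>\<^sub>M \<mu>) (\<lambda>(x, y). g x \<bullet> g y)"
    unfolding joint using int by (subst integrable_distr_eq) (auto simp: g_def)
  from integral_fst'[OF this]
  have "(\<integral>z. (case z of (x, y) \<Rightarrow> g x \<bullet> g y) \<partial>(\<mu> \<Otimes>\<^sub>M \<mu>)) = 0"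
    by (simp add: inner0)
  then show "expectation (\<lambda>\<omega>. A (X i \<omega> - mean) \<bullet> A (X j \<omega> - mean)) = 0"
    unfolding joint by (subst (asm) integral_distr) (auto simp: g_def)
qed

text \<open>Pythagoras for orthogonal summands. The operator \<open>A\<close> is the identity in the
  strong law and the residual of a finite projection in the tail bound.\<close>

lemma expectation_norm_sum:
  assumes A: "bounded_linear (A :: 'a \<Rightarrow> 'a)" and I: "finite I"
  shows "integrable M (\<lambda>\<omega>. (norm (\<Sum>i\<in>I. A (X i \<omega> - mean)))\<^sup>2)"
    and "expectation (\<lambda>\<omega>. (norm (\<Sum>i\<in>I. A (X i \<omega> - mean)))\<^sup>2) = card I * (\<integral>x. (norm (A (x - mean)))\<^sup>2 \<partial>\<mu>)"
proof -
  have [measurable]: "A \<in> borel_measurable borel"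
    using A by (intro borel_measurable_continuous_onI linear_continuous_on)
  have expand: "(norm (\<Sum>i\<in>I. A (X i \<omega> - mean)))\<^sup>2 = (\<Sum>i\<in>I. \<Sum>j\<in>I. A (X i \<omega> - mean) \<bullet> A (X j \<omega> - mean))" for \<omega>
    by (simp only: power2_norm_eq_inner inner_sum_left) (simp only: inner_sum_right)
  have sq: "integrable M (\<lambda>\<omega>. A (X i \<omega> - mean) \<bullet> A (X i \<omega> - mean))"
    "expectation (\<lambda>\<omega>. A (X i \<omega> - mean) \<bullet> A (X i \<omega> - mean)) = (\<integral>x. (norm (A (x - mean)))\<^sup>2 \<partial>\<mu>)" for i
    using integrable_square_linear[OF A, of mean] unfolding power2_norm_eq_inner
    by (subst integrable_law expectation_law; simp)+
  have int: "integrable M (\<lambda>\<omega>. A (X i \<omega> - mean) \<bullet> A (X j \<omega> - mean))" for i j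
    using sq(1) expectation_inner_eq_0(1)[OF A] by (cases "i = j") auto
  show "integrable M (\<lambda>\<omega>. (norm (\<Sum>i\<in>I. A (X i \<omega> - mean)))\<^sup>2)"
    unfolding expand by (intro Bochner_Integration.integrable_sum int)
  have "expectation (\<lambda>\<omega>. (norm (\<Sum>i\<in>I. A (X i \<omega> - mean)))\<^sup>2)
      = (\<Sum>i\<in>I. \<Sum>j\<in>I. expectation (\<lambda>\<omega>. A (X i \<omega> - mean) \<bullet> A (X j \<omega> - mean)))"
    unfolding expand using int by (simp add: Bochner_Integration.integral_sum Bochner_Integration.integrable_sum)
  also have "\<dots> = (\<Sum>i\<in>I. \<Sum>j\<in>I. if i = j then (\<integral>x. (norm (A (x - mean)))\<^sup>2 \<partial>\<mu>) else 0)"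
    using sq(2) expectation_inner_eq_0(2)[OF A] by (intro sum.cong refl) auto
  also have "\<dots> = card I * (\<integral>x. (norm (A (x - mean)))\<^sup>2 \<partial>\<mu>)"
    using I by simp
  finally show "expectation (\<lambda>\<omega>. (norm (\<Sum>i\<in>I. A (X i \<omega> - mean)))\<^sup>2) = card I * (\<integral>x. (norm (A (x - mean)))\<^sup>2 \<partial>\<mu>)" .
qed

end

section \<open>The strong law of large numbers\<close>

text \<open>By monotone convergence the sum of all \<open>f n\<close> has finite integral, so it is
  finite almost everywhere and its terms vanish in the limit.\<close>

lemma AE_tendsto_0_if_summable_integral:
  fixes f :: "nat \<Rightarrow> 'w \<Rightarrow> real"
  assumes f: "\<And>n. integrable M (f n)" "\<And>n \<omega>. 0 \<le> f n \<omega>" and s: "summable (\<lambda>n. \<integral>\<omega>. f n \<omega> \<partial>M)"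
  shows "AE \<omega> in M. (\<lambda>n. f n \<omega>) \<longlonglongrightarrow> 0"
proof -
  have [measurable]: "f n \<in> borel_measurable M" for n using f(1) by simp
  have "(\<integral>\<^sup>+\<omega>. (\<Sum>n. ennreal (f n \<omega>)) \<partial>M) = (\<Sum>n. ennreal (\<integral>\<omega>. f n \<omega> \<partial>M))"
    by (subst nn_integral_suminf) (auto simp: nn_integral_eq_integral f)
  also have "\<dots> \<noteq> \<infinity>"
    by (subst suminf_ennreal2[OF _ s]) (simp_all add: f)
  finally have "AE \<omega> in M. (\<Sum>n. ennreal (f n \<omega>)) \<noteq> \<infinity>"
    by (intro nn_integral_PInf_AE) auto
  then show ?thesis
    by eventually_elim (auto intro!: summable_LIMSEQ_zero summable_suminf_not_top f(2))
qed

text \<open>Every n lies at distance at most 2r beyond the square of r = \<open>r n\<close>, the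
  integer part of its square root. The increment over that block is bounded by the sum of all
  increments in it, and the fourth power of r is at most the square of n.\<close>

lemma tendsto_0_along_squares:
  fixes a :: "nat \<Rightarrow> 'a::real_inner"
  assumes 1: "(\<lambda>n. (norm (a (n\<^sup>2)))\<^sup>2 / real n ^ 4) \<longlonglongrightarrow> 0"
    and 2: "(\<lambda>n. (\<Sum>k\<le>2 * n. (norm (a (n\<^sup>2 + k) - a (n\<^sup>2)))\<^sup>2) / real n ^ 4) \<longlonglongrightarrow> 0"
  shows "(\<lambda>n. (1 / real n) *\<^sub>R a n) \<longlonglongrightarrow> 0"
proof -
  define r where "r n = nat \<lfloor>sqrt (real n)\<rfloor>" for n
  have r: "(r n)\<^sup>2 \<le> n" "n \<le> (r n)\<^sup>2 + 2 * r n" for n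
  proof -
    have r1: "real (r n) \<le> sqrt (real n)" "sqrt (real n) < real (r n) + 1"
      unfolding r_def by (auto simp: of_nat_nat)
    have "(real (r n))\<^sup>2 \<le> (sqrt (real n))\<^sup>2" using r1 by (intro power_mono) auto
    then have "real ((r n)\<^sup>2) \<le> real n" by simp
    then show "(r n)\<^sup>2 \<le> n" by (simp only: of_nat_le_iff)
    have "(sqrt (real n))\<^sup>2 < (real (r n) + 1)\<^sup>2" using r1 by (intro power_strict_mono) auto
    then have "real n < real ((r n + 1)\<^sup>2)" by (simp add: add.commute)
    then have "n < (r n + 1)\<^sup>2" by (simp only: of_nat_less_iff)
    then show "n \<le> (r n)\<^sup>2 + 2 * r n" by (simp add: power2_eq_square)
  qed
  have lim_r: "filterlim r at_top at_top"
    unfolding r_def by (rule filterlim_compose[OF filterlim_nat_sequentially])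
      (intro filterlim_compose[OF filterlim_floor_sequentially] filterlim_compose[OF sqrt_at_top] filterlim_real_sequentially)
  define u where "u n = (norm (a (n\<^sup>2)))\<^sup>2 / real n ^ 4" for n
  define v where "v n = (\<Sum>k\<le>2 * n. (norm (a (n\<^sup>2 + k) - a (n\<^sup>2)))\<^sup>2) / real n ^ 4" for n
  have "(norm ((1 / real n) *\<^sub>R a n))\<^sup>2 \<le> 2 * v (r n) + 2 * u (r n)" if "n > 0" for n
  proof -
    have r0: "r n > 0" using r[of n] that by (cases "r n") auto
    obtain k where k: "n = (r n)\<^sup>2 + k" "k \<le> 2 * r n"
      using r[of n] by (metis le_Suc_ex nat_add_left_cancel_le)
    have "(norm (a n - a ((r n)\<^sup>2)))\<^sup>2 \<le> (\<Sum>k\<le>2 * r n. (norm (a ((r n)\<^sup>2 + k) - a ((r n)\<^sup>2)))\<^sup>2)"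
      using member_le_sum[of k "{..2 * r n}" "\<lambda>k. (norm (a ((r n)\<^sup>2 + k) - a ((r n)\<^sup>2)))\<^sup>2"] k by simp
    then have "(norm (a n))\<^sup>2 \<le> 2 * (\<Sum>k\<le>2 * r n. (norm (a ((r n)\<^sup>2 + k) - a ((r n)\<^sup>2)))\<^sup>2) + 2 * (norm (a ((r n)\<^sup>2)))\<^sup>2"
      using norm_add_squares[of "a n - a ((r n)\<^sup>2)" "a ((r n)\<^sup>2)"] by simp
    moreover have "real (r n) ^ 4 \<le> (real n)\<^sup>2"
    proof -
      have "(real ((r n)\<^sup>2))\<^sup>2 \<le> (real n)\<^sup>2" using r(1)[of n] by (intro power_mono) auto
      then show ?thesis by (simp flip: power_mult)
    qed
    ultimately have "(norm (a n))\<^sup>2 / (real n)\<^sup>2 \<le> (2 * (\<Sum>k\<le>2 * r n. (norm (a ((r n)\<^sup>2 + k) - a ((r n)\<^sup>2)))\<^sup>2)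
        + 2 * (norm (a ((r n)\<^sup>2)))\<^sup>2) / real (r n) ^ 4"
      using r0 by (intro frac_le) (auto intro!: add_nonneg_nonneg sum_nonneg)
    then show ?thesis by (simp add: u_def v_def add_divide_distrib power_divide)
  qed
  then have le: "\<forall>\<^sub>F n in sequentially. norm ((norm ((1 / real n) *\<^sub>R a n))\<^sup>2) \<le> 2 * v (r n) + 2 * u (r n)"
    by (intro eventually_sequentiallyI[of 1]) auto
  have "(\<lambda>n. u (r n)) \<longlonglongrightarrow> 0" "(\<lambda>n. v (r n)) \<longlonglongrightarrow> 0"
    using filterlim_compose[OF 1 lim_r] filterlim_compose[OF 2 lim_r] by (simp_all only: u_def v_def)
  then have "(\<lambda>n. 2 * v (r n) + 2 * u (r n)) \<longlonglongrightarrow> 0"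
    by (intro tendsto_add_zero tendsto_mult_right_zero)
  then have "(\<lambda>n. (norm ((1 / real n) *\<^sub>R a n))\<^sup>2) \<longlonglongrightarrow> 0"
    by (rule Lim_null_comparison[OF le])
  then have "(\<lambda>n. sqrt ((norm ((1 / real n) *\<^sub>R a n))\<^sup>2)) \<longlonglongrightarrow> sqrt 0"
    by (rule tendsto_real_sqrt)
  then have "(\<lambda>n. norm ((1 / real n) *\<^sub>R a n)) \<longlonglongrightarrow> 0"
    by (simp only: real_sqrt_abs abs_norm_cancel real_sqrt_zero)
  then show ?thesis by (rule tendsto_norm_zero_cancel)
qed

context iid_square_integrable
begin

text \<open>At the squares the normalized second moment is V/n^2. In the block after n^2 the
  increments have at most 2n terms and number 2n + 1, so their total second moment is of order n^2
  V. Division by n^4 makes both series summable.\<close>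

theorem strong_law: "AE \<omega> in M. (\<lambda>n. (1 / real n) *\<^sub>R (\<Sum>i<n. X i \<omega>)) \<longlonglongrightarrow> mean"
proof -
  define S where "S n \<omega> = (\<Sum>i<n. X i \<omega> - mean)" for n \<omega>
  define V where "V = (\<integral>x. (norm (x - mean))\<^sup>2 \<partial>\<mu>)"
  have V: "0 \<le> V" by (simp add: V_def)
  have E: "integrable M (\<lambda>\<omega>. (norm (\<Sum>i\<in>I. X i \<omega> - mean))\<^sup>2)"
    "expectation (\<lambda>\<omega>. (norm (\<Sum>i\<in>I. X i \<omega> - mean))\<^sup>2) = card I * V" if "finite I" for I
    using expectation_norm_sum[OF bounded_linear_ident that] by (simp_all add: V_def)
  have diff: "S (m + k) \<omega> - S m \<omega> = (\<Sum>i\<in>{m..<m + k}. X i \<omega> - mean)" for m k \<omega>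
    unfolding S_def lessThan_atLeast0 by (simp add: sum_diff_nat_ivl)
  have sum2: "summable (\<lambda>n. 9 * V * (1 / (real n)\<^sup>2))"
    using inverse_power_summable[of 2, where 'a = real] by (intro summable_mult) (simp add: divide_inverse)
  have "AE \<omega> in M. (\<lambda>n. (norm (S (n\<^sup>2) \<omega>))\<^sup>2 / real n ^ 4) \<longlonglongrightarrow> 0"
  proof (rule AE_tendsto_0_if_summable_integral)
    show "summable (\<lambda>n. expectation (\<lambda>\<omega>. (norm (S (n\<^sup>2) \<omega>))\<^sup>2 / real n ^ 4))"
    proof (rule summable_comparison_test'[OF sum2])
      fix n
      have "real n ^ 2 * V / real n ^ 4 = V * (1 / (real n)\<^sup>2)"
        by (cases "n = 0") (simp_all add: field_simps flip: power_add)
      also have "\<dots> \<le> 9 * V * (1 / (real n)\<^sup>2)"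
        using V by (intro mult_right_mono) auto
      finally show "norm (expectation (\<lambda>\<omega>. (norm (S (n\<^sup>2) \<omega>))\<^sup>2 / real n ^ 4)) \<le> 9 * V * (1 / (real n)\<^sup>2)"
        using E[of "{..<n\<^sup>2}"] V by (simp add: S_def)
    qed
    show "integrable M (\<lambda>\<omega>. (norm (S (n\<^sup>2) \<omega>))\<^sup>2 / real n ^ 4)" for n
      unfolding S_def by (intro integrable_divide E) simp
  qed simp
  moreover have "AE \<omega> in M. (\<lambda>n. (\<Sum>k\<le>2 * n. (norm (S (n\<^sup>2 + k) \<omega> - S (n\<^sup>2) \<omega>))\<^sup>2) / real n ^ 4) \<longlonglongrightarrow> 0"
  proof (rule AE_tendsto_0_if_summable_integral)
    show "summable (\<lambda>n. expectation (\<lambda>\<omega>. (\<Sum>k\<le>2 * n. (norm (S (n\<^sup>2 + k) \<omega> - S (n\<^sup>2) \<omega>))\<^sup>2) / real n ^ 4))"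
    proof (rule summable_comparison_test'[OF sum2])
      fix n
      have "(\<Sum>k\<le>2 * n. real k * V) \<le> (\<Sum>k\<le>2 * n. (3 * real n) * V)"
        using V by (intro sum_mono mult_right_mono) auto
      also have "\<dots> = (2 * real n + 1) * (3 * real n * V)"
        by simp
      \<comment> \<open>The bound 2n + 1 \<le> 3n fails at n = 0, where the other factor vanishes
        instead.\<close>
      also have "\<dots> \<le> (if n = 0 then 0 else (3 * real n) * (3 * real n * V))"
        using V mult_right_mono[of "2 * real n + 1" "3 * real n" "3 * real n * V"] by simp
      also have "\<dots> = 9 * V * (real n)\<^sup>2"
        by (simp add: power2_eq_square)
      finally have "(\<Sum>k\<le>2 * n. real k * V) / real n ^ 4 \<le> 9 * V * (real n)\<^sup>2 / real n ^ 4"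
        by (rule divide_right_mono) simp
      also have "\<dots> = 9 * V * (1 / (real n)\<^sup>2)"
        by (cases "n = 0") (simp_all add: field_simps flip: power_add)
      finally show "norm (expectation (\<lambda>\<omega>. (\<Sum>k\<le>2 * n. (norm (S (n\<^sup>2 + k) \<omega> - S (n\<^sup>2) \<omega>))\<^sup>2) / real n ^ 4))
          \<le> 9 * V * (1 / (real n)\<^sup>2)"
        using E V by (simp add: diff sum_nonneg)
    qed
    show "integrable M (\<lambda>\<omega>. (\<Sum>k\<le>2 * n. (norm (S (n\<^sup>2 + k) \<omega> - S (n\<^sup>2) \<omega>))\<^sup>2) / real n ^ 4)" for n
      unfolding diff by (intro integrable_divide Bochner_Integration.integrable_sum E) simp
  qed (simp add: sum_nonneg)
  ultimately show ?thesis
  proof eventually_elim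
    case (elim \<omega>)
    then have "(\<lambda>n. (1 / real n) *\<^sub>R S n \<omega>) \<longlonglongrightarrow> 0"
      by (rule tendsto_0_along_squares)
    then have "(\<lambda>n. (1 / real n) *\<^sub>R S n \<omega> + mean) \<longlonglongrightarrow> 0 + mean"
      by (intro tendsto_add tendsto_const)
    moreover have "\<forall>\<^sub>F n in sequentially. (1 / real n) *\<^sub>R S n \<omega> + mean = (1 / real n) *\<^sub>R (\<Sum>i<n. X i \<omega>)"
      by (rule eventually_sequentiallyI[of 1]) (simp add: S_def sum_subtractf scaleR_diff_right sum_constant_scaleR)
    ultimately show ?case by (simp add: filterlim_cong)
  qed
qed

end

section \<open>Covariance operators and Gaussian random elements\<close>

lemma hs_eqI: "(\<And>x. hs_apply A x = hs_apply B x) \<Longrightarrow> A = B"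
  by (rule hs_op_inject[THEN iffD1], rule blinfun_eqI)

lemma bounded_bilinear_tensor: "bounded_bilinear (tensor :: 'a::{real_inner,banach} \<Rightarrow> 'a \<Rightarrow> 'a hs)"
proof
  fix u u' v v' :: 'a and r :: real
  show "tensor (u + u') v = tensor u v + tensor u' v" "tensor u (v + v') = tensor u v + tensor u v'"
    "tensor (r *\<^sub>R u) v = r *\<^sub>R tensor u v" "tensor u (r *\<^sub>R v) = r *\<^sub>R tensor u v"
    by (rule hs_eqI; simp add: plus_hs.rep_eq scaleR_hs.rep_eq blinfun.bilinear_simps algebra_simps)+
  show "\<exists>K. \<forall>u v :: 'a. norm (tensor u v) \<le> norm u * norm v * K"
    by (intro exI[of _ 1]) (simp add: norm_tensor)
qed

lemma continuous_on_tensor [continuous_intros]: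
  "continuous_on S f \<Longrightarrow> continuous_on S g \<Longrightarrow> continuous_on S (\<lambda>x. tensor (f x) (g x))"
  by (rule bounded_bilinear.continuous_on[OF bounded_bilinear_tensor])

text \<open>Pairing with \<open>tensor s t\<close> is a bounded functional on Hilbert-Schmidt
  operators and passes through the Bochner integral. This translates between the covariance operator
  and scalar covariances.\<close>

lemma (in prob_space) inner_cov_op:
  fixes X :: "'a \<Rightarrow> 'b::{real_inner,banach,second_countable_topology}"
  assumes X: "X \<in> borel_measurable M" "integrable M (\<lambda>\<omega>. (norm (X \<omega>))\<^sup>2)"
  shows "hs_apply (cov_op M X) s \<bullet> t = expectation (\<lambda>\<omega>. (s \<bullet> (X \<omega> - expectation X)) * (t \<bullet> (X \<omega> - expectation X)))"
    and "integrable M (\<lambda>\<omega>. (s \<bullet> (X \<omega> - expectation X)) * (t \<bullet> (X \<omega> - expectation X)))"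
proof -
  let ?Y = "\<lambda>\<omega>. X \<omega> - expectation X"
  have [measurable]: "(\<lambda>x. tensor x x) \<in> borel_measurable borel"
    by (intro borel_measurable_continuous_onI continuous_intros)
  have "integrable M (\<lambda>\<omega>. (norm (?Y \<omega>))\<^sup>2)"
    by (rule integrable_square_bounded_linear[OF X bounded_linear_ident])
  moreover have "(\<lambda>\<omega>. tensor (?Y \<omega>) (?Y \<omega>)) \<in> borel_measurable M"
    using X(1) by (intro measurable_compose[of ?Y M borel "\<lambda>x. tensor x x"]) auto
  ultimately have int: "integrable M (\<lambda>\<omega>. tensor (?Y \<omega>) (?Y \<omega>))"
    by (rule Bochner_Integration.integrable_bound) (simp add: norm_tensor power2_eq_square)
  have inner: "tensor y y \<bullet> tensor s t = (s \<bullet> y) * (t \<bullet> y)" for y :: 'b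
    by (simp add: inner_tensor inner_commute)
  show "integrable M (\<lambda>\<omega>. (s \<bullet> ?Y \<omega>) * (t \<bullet> ?Y \<omega>))"
    unfolding inner[symmetric] by (intro integrable_inner_left int)
  have "hs_apply (cov_op M X) s \<bullet> t = cov_op M X \<bullet> tensor s t"
    by (simp add: inner_tensor)
  also have "\<dots> = expectation (\<lambda>\<omega>. tensor (?Y \<omega>) (?Y \<omega>) \<bullet> tensor s t)"
    unfolding cov_op_def by (rule integral_inner_left[symmetric]) (rule int)
  finally show "hs_apply (cov_op M X) s \<bullet> t = expectation (\<lambda>\<omega>. (s \<bullet> ?Y \<omega>) * (t \<bullet> ?Y \<omega>))"
    by (simp only: inner)
qed

lemma same_covariance_variance:
  assumes "same_covariance M X N Y" "prob_space M" "prob_space N"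
  shows "(\<integral>\<omega>. (t \<bullet> (X \<omega> - (\<integral>\<omega>. X \<omega> \<partial>M)))\<^sup>2 \<partial>M) = (\<integral>\<omega>. (t \<bullet> (Y \<omega> - (\<integral>\<omega>. Y \<omega> \<partial>N)))\<^sup>2 \<partial>N)"
  using assms prob_space.inner_cov_op(1)[of M X t t] prob_space.inner_cov_op(1)[of N Y t t]
  by (simp add: same_covariance_def power2_eq_square)

text \<open>Polarization: the variances in all directions determine the covariances, and these
  determine the operator.\<close>

lemma same_covarianceI:
  fixes X :: "'w \<Rightarrow> 'a::{real_inner,banach,second_countable_topology}" and Y :: "'v \<Rightarrow> 'a"
  assumes M: "prob_space M" and N: "prob_space N"
    and X: "X \<in> borel_measurable M" "integrable M (\<lambda>\<omega>. (norm (X \<omega>))\<^sup>2)"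
    and Y: "Y \<in> borel_measurable N" "integrable N (\<lambda>\<omega>. (norm (Y \<omega>))\<^sup>2)"
    and var: "\<And>t. (\<integral>\<omega>. (t \<bullet> (X \<omega> - (\<integral>\<omega>. X \<omega> \<partial>M)))\<^sup>2 \<partial>M) = (\<integral>\<omega>. (t \<bullet> (Y \<omega> - (\<integral>\<omega>. Y \<omega> \<partial>N)))\<^sup>2 \<partial>N)"
  shows "same_covariance M X N Y"
proof -
  have polar: "hs_apply (cov_op M X) s \<bullet> t =
      ((\<integral>\<omega>. ((s + t) \<bullet> (X \<omega> - (\<integral>\<omega>. X \<omega> \<partial>M)))\<^sup>2 \<partial>M) - (\<integral>\<omega>. (s \<bullet> (X \<omega> - (\<integral>\<omega>. X \<omega> \<partial>M)))\<^sup>2 \<partial>M)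
        - (\<integral>\<omega>. (t \<bullet> (X \<omega> - (\<integral>\<omega>. X \<omega> \<partial>M)))\<^sup>2 \<partial>M)) / 2"
    if "prob_space M" "X \<in> borel_measurable M" "integrable M (\<lambda>\<omega>. (norm (X \<omega>))\<^sup>2)"
    for M :: "'u measure" and X :: "'u \<Rightarrow> 'a" and s t
  proof -
    note c = prob_space.inner_cov_op[OF that]
    have "(s + t) \<bullet> y * ((s + t) \<bullet> y) = s \<bullet> y * (s \<bullet> y) + 2 * (s \<bullet> y * (t \<bullet> y)) + t \<bullet> y * (t \<bullet> y)" for y
      by (simp add: inner_add_left algebra_simps)
    then show ?thesis
      using c(2) by (simp add: c(1) power2_eq_square)
  qed
  have "hs_apply (cov_op M X) s \<bullet> t = hs_apply (cov_op N Y) s \<bullet> t" for s t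
    unfolding polar[OF M X] polar[OF N Y] var by (rule refl)
  then have "cov_op M X = cov_op N Y"
    by (intro hs_eqI) (metis vector_eq_rdot)
  then show ?thesis
    using X Y by (simp add: same_covariance_def)
qed

text \<open>Writing the law as the standard deviation times a standard normal covers the degenerate
  case, where the factor is 0. The right-hand side has the same form as the limit in
  \<open>cos_normalized_tendsto\<close>.\<close>

lemma (in prob_space) centered_gaussian_real_moments:
  assumes "centered_gaussian_real M Z"
  shows "expectation Z = 0"
    and "expectation (\<lambda>\<omega>. cos (Z \<omega> + b)) = (\<integral>u. cos (sqrt (expectation (\<lambda>\<omega>. (Z \<omega>)\<^sup>2)) * u + b) \<partial>std_normal_distribution)"
proof -
  have [measurable]: "Z \<in> borel_measurable M"
    using assms by (simp add: centered_gaussian_real_def)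
  consider "AE \<omega> in M. Z \<omega> = 0" | \<sigma> where "\<sigma> > 0" "distributed M lborel Z (normal_density 0 \<sigma>)"
    using assms unfolding centered_gaussian_real_def by blast
  then have "expectation Z = 0 \<and>
    expectation (\<lambda>\<omega>. cos (Z \<omega> + b)) = (\<integral>u. cos (sqrt (expectation (\<lambda>\<omega>. (Z \<omega>)\<^sup>2)) * u + b) \<partial>std_normal_distribution)"
  proof cases
    case 1
    have "expectation Z = expectation (\<lambda>_. 0)" "expectation (\<lambda>\<omega>. (Z \<omega>)\<^sup>2) = expectation (\<lambda>_. 0)"
      "expectation (\<lambda>\<omega>. cos (Z \<omega> + b)) = expectation (\<lambda>_. cos b)"
      by (rule integral_cong_AE; use 1 in \<open>auto elim: eventually_mono\<close>)+
    moreover have "(\<integral>u. cos b \<partial>std_normal_distribution) = cos b"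
      using prob_space.prob_space[OF prob_space_normal_density[of 1 0]] by simp
    ultimately show ?thesis by (simp add: prob_space)
  next
    case 2
    have m: "expectation Z = 0" and v: "expectation (\<lambda>\<omega>. (Z \<omega>)\<^sup>2) = \<sigma>\<^sup>2"
      using normal_distributed_expectation[OF 2] normal_distributed_variance[OF 2] by simp_all
    have "distributed M lborel (\<lambda>\<omega>. Z \<omega> / \<sigma>) std_normal_density"
      using 2 normal_standard_normal_convert[of \<sigma> Z 0] by simp
    then have "distr M lborel (\<lambda>\<omega>. Z \<omega> / \<sigma>) = std_normal_distribution"
      by (simp add: distributed_def)
    then have "(\<integral>u. cos (\<sigma> * u + b) \<partial>std_normal_distribution) = (\<integral>u. cos (\<sigma> * u + b) \<partial>distr M lborel (\<lambda>\<omega>. Z \<omega> / \<sigma>))"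
      by simp
    also have "\<dots> = expectation (\<lambda>\<omega>. cos (\<sigma> * (Z \<omega> / \<sigma>) + b))"
      by (subst integral_distr) auto
    finally show ?thesis using 2(1) m v by simp
  qed
  then show "expectation Z = 0"
    "expectation (\<lambda>\<omega>. cos (Z \<omega> + b)) = (\<integral>u. cos (sqrt (expectation (\<lambda>\<omega>. (Z \<omega>)\<^sup>2)) * u + b) \<partial>std_normal_distribution)"
    by simp_all
qed

text \<open>The mean is itself taken as the test direction, so its squared norm is the expectation
  of a centered real Gaussian variable.\<close>

lemma (in prob_space) centered_gaussian_mean:
  fixes X :: "'a \<Rightarrow> 'b::{real_inner,banach,second_countable_topology}"
  assumes "centered_gaussian M X" "integrable M X"
  shows "expectation X = 0"
proof -
  have "expectation X \<bullet> expectation X = expectation (\<lambda>\<omega>. expectation X \<bullet> X \<omega>)"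
    using assms(2) by (simp add: integral_inner_right)
  also have "\<dots> = 0"
    using assms(1) by (intro centered_gaussian_real_moments(1)) (simp add: centered_gaussian_def)
  finally show ?thesis by simp
qed

section \<open>The central limit theorem\<close>

lemma proj_seq_moment_tendsto_0:
  fixes f :: "'v \<Rightarrow> 'b::{real_inner,banach,second_countable_topology}"
  assumes e: "onb_sequence e" and f: "f \<in> borel_measurable N" "integrable N (\<lambda>\<omega>. (norm (f \<omega>))\<^sup>2)"
  shows "(\<lambda>m. \<integral>\<omega>. (norm (f \<omega> - proj_seq e m (f \<omega>)))\<^sup>2 \<partial>N) \<longlonglongrightarrow> 0"
proof -
  have m: "(\<lambda>\<omega>. (norm (f \<omega> - proj_seq e m (f \<omega>)))\<^sup>2) \<in> borel_measurable N" for m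
    by (rule measurable_compose[OF f(1)], intro borel_measurable_continuous_onI continuous_intros
        linear_continuous_on bounded_linear_proj_seq)
  have "(\<lambda>m. \<integral>\<omega>. (norm (f \<omega> - proj_seq e m (f \<omega>)))\<^sup>2 \<partial>N) \<longlonglongrightarrow> (\<integral>\<omega>. 0 \<partial>N)"
  proof (rule integral_dominated_convergence[OF _ m f(2)])
    show "AE \<omega> in N. (\<lambda>m. (norm (f \<omega> - proj_seq e m (f \<omega>)))\<^sup>2) \<longlonglongrightarrow> 0"
    proof (rule AE_I2)
      fix \<omega>
      have "(\<lambda>m. (norm (f \<omega> - proj_seq e m (f \<omega>)))\<^sup>2) \<longlonglongrightarrow> (norm (f \<omega> - f \<omega>))\<^sup>2"
        by (intro tendsto_intros proj_seq_tendsto[OF e])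
      then show "(\<lambda>m. (norm (f \<omega> - proj_seq e m (f \<omega>)))\<^sup>2) \<longlonglongrightarrow> 0" by simp
    qed
    show "AE \<omega> in N. norm ((norm (f \<omega> - proj_seq e m (f \<omega>)))\<^sup>2) \<le> (norm (f \<omega>))\<^sup>2" for m
      by (auto intro!: power_mono norm_diff_proj_seq_le[OF e])
  qed simp
  then show ?thesis by simp
qed

context iid_square_integrable
begin

definition normalized :: "nat \<Rightarrow> 'w \<Rightarrow> 'a" where
  "normalized n \<omega> = sqrt (real n) *\<^sub>R ((1 / real n) *\<^sub>R (\<Sum>i<n. X i \<omega>) - mean)"

lemma normalized_eq: "normalized n \<omega> = (1 / sqrt (real n)) *\<^sub>R (\<Sum>i<n. X i \<omega> - mean)"
proof (cases "n = 0")
  case False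
  have "(\<Sum>i<n. X i \<omega> - mean) = (\<Sum>i<n. X i \<omega>) - real n *\<^sub>R mean"
    by (simp add: sum_subtractf sum_constant_scaleR)
  moreover have "sqrt (real n) * (1 / real n) = 1 / sqrt (real n)" "1 / sqrt (real n) * real n = sqrt (real n)"
    using False by (simp_all add: field_simps)
  ultimately show ?thesis
    by (simp only: normalized_def scaleR_diff_right scaleR_scaleR)
qed (simp add: normalized_def)

lemma normalized_measurable [measurable]: "normalized n \<in> borel_measurable M"
  unfolding normalized_def[abs_def] by measurable

text \<open>The factor 1/n cancels the number of orthogonal summands, which makes the bound uniform
  in n. It is an equality except possibly at n = 0, where the sum is empty.\<close>

lemma normalized_moment:
  assumes A: "bounded_linear (A :: 'a \<Rightarrow> 'a)"
  shows "integrable M (\<lambda>\<omega>. (norm (A (normalized n \<omega>)))\<^sup>2)"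
    and "expectation (\<lambda>\<omega>. (norm (A (normalized n \<omega>)))\<^sup>2) \<le> (\<integral>x. (norm (A (x - mean)))\<^sup>2 \<partial>\<mu>)"
proof -
  interpret A: bounded_linear A by fact
  have eq: "(norm (A (normalized n \<omega>)))\<^sup>2 = (1 / real n) * (norm (\<Sum>i<n. A (X i \<omega> - mean)))\<^sup>2" for \<omega>
    by (simp add: normalized_eq A.scaleR A.sum power_mult_distrib power_divide)
  show "integrable M (\<lambda>\<omega>. (norm (A (normalized n \<omega>)))\<^sup>2)"
    unfolding eq by (intro integrable_mult_right expectation_norm_sum A) simp
  have "0 \<le> (\<integral>x. (norm (A (x - mean)))\<^sup>2 \<partial>\<mu>)" by simp
  then show "expectation (\<lambda>\<omega>. (norm (A (normalized n \<omega>)))\<^sup>2) \<le> (\<integral>x. (norm (A (x - mean)))\<^sup>2 \<partial>\<mu>)"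
    unfolding eq using expectation_norm_sum(2)[OF A, of "{..<n}"] by simp
qed

text \<open>The one-dimensional central limit theorem requires positive variance. In a direction of
  variance zero all projected sums vanish almost surely and both sides equal cos b.\<close>

lemma cos_normalized_tendsto:
  "(\<lambda>n. expectation (\<lambda>\<omega>. cos (t \<bullet> normalized n \<omega> + b)))
    \<longlonglongrightarrow> (\<integral>u. cos (sqrt (\<integral>x. (t \<bullet> (x - mean))\<^sup>2 \<partial>\<mu>) * u + b) \<partial>std_normal_distribution)"
proof -
  define v where "v = (\<integral>x. (t \<bullet> (x - mean))\<^sup>2 \<partial>\<mu>)"
  have int: "integrable \<mu> (\<lambda>x. (t \<bullet> (x - mean))\<^sup>2)"
    using integrable_square_linear[OF bounded_linear_inner_right[of t], of mean] by simp
  have v: "0 \<le> v" by (simp add: v_def)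
  interpret std: prob_space std_normal_distribution
    using prob_space_normal_density[of 1 0] by simp
  show ?thesis
  proof (cases "v = 0")
    case True
    have "AE x in \<mu>. (t \<bullet> (x - mean))\<^sup>2 = 0"
      using integral_nonneg_eq_0_iff_AE[OF int] True by (simp add: v_def)
    then have "AE \<omega> in M. t \<bullet> (X i \<omega> - mean) = 0" for i
      unfolding law[of i, symmetric] by (subst (asm) AE_distr_iff) auto
    then have "AE \<omega> in M. \<forall>i. t \<bullet> (X i \<omega> - mean) = 0"
      by (simp add: AE_all_countable)
    then have "AE \<omega> in M. cos (t \<bullet> normalized n \<omega> + b) = cos b" for n
      by eventually_elim (simp add: normalized_eq inner_sum_right)
    then have "expectation (\<lambda>\<omega>. cos (t \<bullet> normalized n \<omega> + b)) = expectation (\<lambda>\<omega>. cos b)" for n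
      by (intro integral_cong_AE) auto
    then show ?thesis
      using True std.prob_space by (simp add: v_def[symmetric] prob_space)
  next
    case False
    define \<sigma> where "\<sigma> = sqrt v"
    have \<sigma>: "\<sigma> > 0" "\<sigma>\<^sup>2 = v" using False v by (simp_all add: \<sigma>_def)
    have mean_t: "expectation (\<lambda>\<omega>. t \<bullet> X i \<omega>) = t \<bullet> mean" for i
    proof -
      have "expectation (\<lambda>\<omega>. t \<bullet> X i \<omega>) = (\<integral>x. t \<bullet> x \<partial>\<mu>)"
        by (rule expectation_law) simp
      also have "\<dots> = t \<bullet> mean"
        unfolding mean_def by (rule integral_inner_right) (rule integrable_id)
      finally show ?thesis .
    qed
    have "weak_conv_m (\<lambda>n. distr M borel (\<lambda>\<omega>. (\<Sum>i<n. t \<bullet> X i \<omega> - t \<bullet> mean) / sqrt (real n * \<sigma>\<^sup>2))) std_normal_distribution"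
    proof (rule central_limit_theorem)
      show "indep_vars (\<lambda>i. borel) (\<lambda>i \<omega>. t \<bullet> X i \<omega>) UNIV"
        by (rule indep_vars_compose2[OF indep]) auto
      show "expectation (\<lambda>\<omega>. t \<bullet> X i \<omega>) = t \<bullet> mean" for i by (rule mean_t)
      show "0 < \<sigma>" by (rule \<sigma>)
      show "integrable M (\<lambda>\<omega>. (t \<bullet> X i \<omega>)\<^sup>2)" for i
        using integrable_square_linear[OF bounded_linear_inner_right[of t], of 0]
        by (subst integrable_law) auto
      show "variance (\<lambda>\<omega>. t \<bullet> X i \<omega>) = \<sigma>\<^sup>2" for i
        using expectation_law[of "\<lambda>x. (t \<bullet> (x - mean))\<^sup>2" i]
        by (simp add: mean_t \<sigma>(2) v_def inner_diff_right)
      show "distr M borel (\<lambda>\<omega>. t \<bullet> X i \<omega>) = distr \<mu> borel (\<lambda>x. t \<bullet> x)" for i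
        unfolding law[of i, symmetric] by (subst distr_distr) (auto simp: comp_def)
    qed
    then have "(\<lambda>n. \<integral>u. cos (\<sigma> * u + b) \<partial>distr M borel (\<lambda>\<omega>. (\<Sum>i<n. t \<bullet> X i \<omega> - t \<bullet> mean) / sqrt (real n * \<sigma>\<^sup>2)))
        \<longlonglongrightarrow> (\<integral>u. cos (\<sigma> * u + b) \<partial>std_normal_distribution)"
      by (rule weak_conv_imp_integral_bdd_continuous_conv[rotated 2, where B = 1])
        (auto intro!: real_distribution_distr real_dist_normal_dist)
    moreover have "(\<integral>u. cos (\<sigma> * u + b) \<partial>distr M borel (\<lambda>\<omega>. (\<Sum>i<n. t \<bullet> X i \<omega> - t \<bullet> mean) / sqrt (real n * \<sigma>\<^sup>2)))
        = expectation (\<lambda>\<omega>. cos (t \<bullet> normalized n \<omega> + b))" for n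
    proof -
      have "\<sigma> * ((\<Sum>i<n. t \<bullet> X i \<omega> - t \<bullet> mean) / sqrt (real n * \<sigma>\<^sup>2)) = t \<bullet> normalized n \<omega>" for \<omega>
        using \<sigma>(1) by (simp add: real_sqrt_mult normalized_eq inner_sum_right inner_diff_right)
      then show ?thesis by (subst integral_distr) auto
    qed
    ultimately show ?thesis by (simp add: \<sigma>_def v_def)
  qed
qed

theorem hilbert_central_limit_theorem:
  assumes N: "prob_space N" and G: "centered_gaussian N G" "integrable N (\<lambda>\<omega>. (norm (G \<omega>))\<^sup>2)"
    and cov: "\<And>t. (\<integral>\<omega>. (t \<bullet> G \<omega>)\<^sup>2 \<partial>N) = (\<integral>x. (t \<bullet> (x - mean))\<^sup>2 \<partial>\<mu>)"
  shows "conv_in_distr euclidean M normalized N G"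
proof -
  obtain e :: "nat \<Rightarrow> 'a" where e: "onb_sequence e" using onb_sequence_exists by blast
  have Gm: "G \<in> borel_measurable N" using G(1) by (simp add: centered_gaussian_def)
  have \<mu>m: "(\<lambda>x. x - mean) \<in> borel_measurable \<mu>" by measurable
  have \<mu>i: "integrable \<mu> (\<lambda>x. (norm (x - mean))\<^sup>2)"
    using integrable_square_linear[OF bounded_linear_ident] .
  define V where "V = (\<integral>x. (norm (x - mean))\<^sup>2 \<partial>\<mu>) + (\<integral>\<omega>. (norm (G \<omega>))\<^sup>2 \<partial>N)"
  show ?thesis
  proof (rule conv_in_distr_hilbertI[OF prob_space_axioms N e, where V = V])
    show "integrable M (\<lambda>\<omega>. (norm (normalized n \<omega>))\<^sup>2)" for n
      by (rule normalized_moment(1)[OF bounded_linear_ident])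
    show "expectation (\<lambda>\<omega>. (norm (normalized n \<omega>))\<^sup>2) \<le> V" for n
      using normalized_moment(2)[OF bounded_linear_ident, of n] unfolding V_def by (simp add: add_increasing2)
    show "(\<integral>\<omega>. (norm (G \<omega>))\<^sup>2 \<partial>N) \<le> V" by (simp add: V_def)
    show "(\<lambda>n. expectation (\<lambda>\<omega>. cos (t \<bullet> normalized n \<omega> + b))) \<longlonglongrightarrow> (\<integral>\<omega>. cos (t \<bullet> G \<omega> + b) \<partial>N)" for t b
      using cos_normalized_tendsto[of t b] G(1)
        prob_space.centered_gaussian_real_moments(2)[OF N, of "\<lambda>\<omega>. t \<bullet> G \<omega>" b]
      by (simp add: centered_gaussian_def cov)
    fix \<delta> :: real assume \<delta>: "\<delta> > 0"
    have "\<forall>\<^sub>F m in sequentially. (\<integral>x. (norm ((x - mean) - proj_seq e m (x - mean)))\<^sup>2 \<partial>\<mu>) < \<delta>"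
      "\<forall>\<^sub>F m in sequentially. (\<integral>\<omega>. (norm (G \<omega> - proj_seq e m (G \<omega>)))\<^sup>2 \<partial>N) < \<delta>"
      by (rule order_tendstoD(2)[OF proj_seq_moment_tendsto_0[OF e] \<delta>]; fact)+
    then have "\<forall>\<^sub>F m in sequentially. (\<integral>x. (norm ((x - mean) - proj_seq e m (x - mean)))\<^sup>2 \<partial>\<mu>) < \<delta> \<and>
        (\<integral>\<omega>. (norm (G \<omega> - proj_seq e m (G \<omega>)))\<^sup>2 \<partial>N) < \<delta>"
      by (rule eventually_conj)
    then obtain m where m: "(\<integral>x. (norm ((x - mean) - proj_seq e m (x - mean)))\<^sup>2 \<partial>\<mu>) < \<delta>"
      "(\<integral>\<omega>. (norm (G \<omega> - proj_seq e m (G \<omega>)))\<^sup>2 \<partial>N) < \<delta>"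
      using eventually_happens'[OF sequentially_bot] by blast
    \<comment> \<open>The residual map is bounded and linear, so one dimension \<open>m\<close>,
      chosen for a single centered observation, works for every n.\<close>
    have "expectation (\<lambda>\<omega>. (norm (normalized n \<omega> - proj_seq e m (normalized n \<omega>)))\<^sup>2) \<le> \<delta>" for n
      using normalized_moment(2)[of "\<lambda>x. x - proj_seq e m x" n] m(1)
      by (simp add: bounded_linear_sub bounded_linear_ident bounded_linear_proj_seq)
    then show "\<exists>m. (\<forall>n. expectation (\<lambda>\<omega>. (norm (normalized n \<omega> - proj_seq e m (normalized n \<omega>)))\<^sup>2) \<le> \<delta>) \<and>
        (\<integral>\<omega>. (norm (G \<omega> - proj_seq e m (G \<omega>)))\<^sup>2 \<partial>N) \<le> \<delta>"
      using m(2) by (intro exI[of _ m]) auto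
  qed (use Gm G(2) in auto)
qed

end

section \<open>Existence of Gaussian random elements\<close>

lemma (in prob_space) char_distr:
  "Z \<in> borel_measurable M \<Longrightarrow> char (distr M borel Z) t = expectation (\<lambda>\<omega>. iexp (t * Z \<omega>))"
  unfolding char_def by (subst integral_distr) auto

text \<open>Levy uniqueness identifies the law: a point mass at 0 if \<open>v\<close> is zero,
  otherwise a scaled standard normal. Gaussian limits can thus be recognized without computing
  densities.\<close>

lemma (in prob_space) centered_gaussian_real_charI:
  assumes Z: "Z \<in> borel_measurable M" and v: "0 \<le> v"
    and char: "\<And>t. char (distr M borel Z) t = complex_of_real (exp (- (v * t\<^sup>2) / 2))"
  shows "centered_gaussian_real M Z" "expectation (\<lambda>\<omega>. (Z \<omega>)\<^sup>2) = v" "integrable M (\<lambda>\<omega>. (Z \<omega>)\<^sup>2)"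
proof -
  note [measurable] = Z
  have dist: "real_distribution (distr M borel Z')" if "Z' \<in> borel_measurable M" for Z'
    using that by (rule real_distribution_distr)
  have "centered_gaussian_real M Z \<and> expectation (\<lambda>\<omega>. (Z \<omega>)\<^sup>2) = v \<and> integrable M (\<lambda>\<omega>. (Z \<omega>)\<^sup>2)"
  proof (cases "v = 0")
    case True
    have "char (distr M borel Z) = char (distr M borel (\<lambda>_. 0))"
      by (rule ext) (simp add: char char_distr True prob_space del: distr_const)
    then have "distr M borel Z = distr M borel (\<lambda>_. 0)"
      by (intro Levy_uniqueness dist) auto
    moreover have "AE x in distr M borel (\<lambda>_. 0). x = (0::real)"
      by (subst AE_distr_iff) auto
    ultimately have "AE x in distr M borel Z. x = 0" by (simp only:)
    then have AE: "AE \<omega> in M. Z \<omega> = 0" by (subst (asm) AE_distr_iff) auto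
    then have "AE \<omega> in M. (Z \<omega>)\<^sup>2 = 0" by eventually_elim simp
    then have "expectation (\<lambda>\<omega>. (Z \<omega>)\<^sup>2) = expectation (\<lambda>_. 0)"
      "integrable M (\<lambda>\<omega>. (Z \<omega>)\<^sup>2) \<longleftrightarrow> integrable M (\<lambda>_. 0 :: real)"
      by (intro integral_cong_AE integrable_cong_AE; simp)+
    then show ?thesis using AE True Z by (simp add: centered_gaussian_real_def)
  next
    case False
    define \<sigma> where "\<sigma> = sqrt v"
    have \<sigma>: "\<sigma> > 0" "\<sigma>\<^sup>2 = v" using v False by (simp_all add: \<sigma>_def)
    have "char (distr M borel (\<lambda>\<omega>. Z \<omega> / \<sigma>)) t = char std_normal_distribution t" for t
    proof -
      have "char (distr M borel (\<lambda>\<omega>. Z \<omega> / \<sigma>)) t = char (distr M borel Z) (t / \<sigma>)"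
        by (simp add: char_distr)
      also have "v * (t / \<sigma>)\<^sup>2 = t\<^sup>2" using \<sigma> by (auto simp: power_divide)
      then have "char (distr M borel Z) (t / \<sigma>) = char std_normal_distribution t"
        by (simp add: char char_std_normal_distribution)
      finally show ?thesis .
    qed
    then have "distr M borel (\<lambda>\<omega>. Z \<omega> / \<sigma>) = std_normal_distribution"
      by (intro Levy_uniqueness dist real_dist_normal_dist ext) auto
    then have "distributed M lborel (\<lambda>\<omega>. Z \<omega> / \<sigma>) std_normal_density"
      unfolding distributed_def by (auto cong: distr_cong)
    then have D: "distributed M lborel Z (normal_density 0 \<sigma>)"
      using normal_standard_normal_convert[of \<sigma> Z 0] \<sigma> by simp
    have "expectation (\<lambda>\<omega>. (Z \<omega>)\<^sup>2) = v"
      using normal_distributed_variance[OF \<sigma>(1) D] normal_distributed_expectation[OF \<sigma>(1) D] \<sigma>(2) by simp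
    \<comment> \<open>A function that is not integrable has integral 0 by convention, so a nonzero
      second moment forces integrability.\<close>
    moreover from this have "integrable M (\<lambda>\<omega>. (Z \<omega>)\<^sup>2)"
      using False not_integrable_integral_eq by fastforce
    ultimately show ?thesis
      using D \<sigma>(1) Z by (auto simp: centered_gaussian_real_def)
  qed
  then show "centered_gaussian_real M Z" "expectation (\<lambda>\<omega>. (Z \<omega>)\<^sup>2) = v" "integrable M (\<lambda>\<omega>. (Z \<omega>)\<^sup>2)"
    by simp_all
qed

text \<open>Centered Gaussian laws are closed under almost sure limits with convergent variances;
  this transfers Gaussianity from partial sums to the random series.\<close>

lemma (in prob_space) char_distr_limit:
  assumes Z: "\<And>n. Z n \<in> borel_measurable M" "Z' \<in> borel_measurable M"
    and lim: "AE \<omega> in M. (\<lambda>n. Z n \<omega>) \<longlonglongrightarrow> Z' \<omega>"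
    and c: "\<And>n. char (distr M borel (Z n)) t = complex_of_real (exp (- (v n * t\<^sup>2) / 2))" and v: "v \<longlonglongrightarrow> v'"
  shows "char (distr M borel Z') t = complex_of_real (exp (- (v' * t\<^sup>2) / 2))"
proof (rule LIMSEQ_unique)
  show "(\<lambda>n. char (distr M borel (Z n)) t) \<longlonglongrightarrow> char (distr M borel Z') t"
    unfolding char_distr[OF Z(1)] char_distr[OF Z(2)]
  proof (rule integral_dominated_convergence[where w = "\<lambda>_. 1"])
    show "AE \<omega> in M. (\<lambda>n. iexp (t * Z n \<omega>)) \<longlonglongrightarrow> iexp (t * Z' \<omega>)"
      using lim by eventually_elim (intro tendsto_intros)
  qed (use Z in auto)
  show "(\<lambda>n. char (distr M borel (Z n)) t) \<longlonglongrightarrow> complex_of_real (exp (- (v' * t\<^sup>2) / 2))"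
    unfolding c by (intro tendsto_intros v) simp
qed

section \<open>Sequences of independent standard normal variables\<close>

definition gaussian_seq :: "(nat \<Rightarrow> real) measure" where
  "gaussian_seq = (\<Pi>\<^sub>M i\<in>UNIV. std_normal_distribution)"

lemma prob_space_gaussian_seq: "prob_space gaussian_seq"
  unfolding gaussian_seq_def by (intro prob_space_PiM real_dist_normal_dist[THEN real_distribution.axioms(1)])

lemma gaussian_seq_measurable: "(\<lambda>\<omega>. \<omega> i) \<in> borel_measurable gaussian_seq"
proof -
  have "(\<lambda>\<omega>. \<omega> i) \<in> measurable gaussian_seq std_normal_distribution"
    unfolding gaussian_seq_def by (rule measurable_component_singleton) simp
  then show ?thesis by (simp cong: measurable_cong_sets)
qed

lemma gaussian_seq_component: "distr gaussian_seq borel (\<lambda>\<omega>. \<omega> i) = std_normal_distribution"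
proof -
  interpret product_prob_space "\<lambda>_::nat. std_normal_distribution" UNIV
    using real_dist_normal_dist[THEN real_distribution.axioms(1)]
    by (intro product_prob_spaceI)
  have "distr gaussian_seq std_normal_distribution (\<lambda>\<omega>. \<omega> i) = std_normal_distribution"
    unfolding gaussian_seq_def by (rule PiM_component) simp
  moreover have "distr gaussian_seq borel (\<lambda>\<omega>. \<omega> i) = distr gaussian_seq std_normal_distribution (\<lambda>\<omega>. \<omega> i)"
    by (rule distr_cong) auto
  ultimately show ?thesis by simp
qed

lemma gaussian_seq_indep: "prob_space.indep_vars gaussian_seq (\<lambda>_. borel) (\<lambda>i \<omega>. \<omega> i) UNIV"
proof -
  interpret prob_space gaussian_seq by (rule prob_space_gaussian_seq)
  have "indep_vars (\<lambda>_. borel) (\<lambda>i \<omega>. \<omega> i) UNIV \<longleftrightarrow>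
      distr gaussian_seq (\<Pi>\<^sub>M i\<in>UNIV. borel) (\<lambda>\<omega>. \<lambda>i\<in>UNIV. \<omega> i) = (\<Pi>\<^sub>M i\<in>UNIV. distr gaussian_seq borel (\<lambda>\<omega>. \<omega> i))"
    by (rule indep_vars_iff_distr_eq_PiM) (simp_all add: gaussian_seq_measurable)
  also have "(\<Pi>\<^sub>M i\<in>UNIV. distr gaussian_seq borel (\<lambda>\<omega>. \<omega> i)) = gaussian_seq"
    unfolding gaussian_seq_component by (simp only: gaussian_seq_def)
  also have "distr gaussian_seq (\<Pi>\<^sub>M i\<in>UNIV. borel) (\<lambda>\<omega>. \<lambda>i\<in>UNIV. \<omega> i) = distr gaussian_seq gaussian_seq (\<lambda>\<omega>. \<omega>)"
    by (rule distr_cong) (auto simp: gaussian_seq_def intro!: sets_PiM_cong)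
  finally show ?thesis by simp
qed

lemma gaussian_seq_char_sum:
  "char (distr gaussian_seq borel (\<lambda>\<omega>. \<Sum>j<n. c j * \<omega> j)) t = complex_of_real (exp (- ((\<Sum>j<n. (c j)\<^sup>2) * t\<^sup>2) / 2))"
proof -
  interpret prob_space gaussian_seq by (rule prob_space_gaussian_seq)
  have "char (distr gaussian_seq borel (\<lambda>\<omega>. c j * \<omega> j)) t = complex_of_real (exp (- ((c j)\<^sup>2 * t\<^sup>2) / 2))" for j
  proof -
    have "char (distr gaussian_seq borel (\<lambda>\<omega>. c j * \<omega> j)) t = char (distr gaussian_seq borel (\<lambda>\<omega>. \<omega> j)) (t * c j)"
      unfolding char_distr[OF gaussian_seq_measurable]
        char_distr[OF borel_measurable_times[OF borel_measurable_const gaussian_seq_measurable]]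
      by (simp add: mult.assoc)
    then show ?thesis
      by (simp add: gaussian_seq_component char_std_normal_distribution power_mult_distrib mult.commute)
  qed
  moreover have "char (distr gaussian_seq borel (\<lambda>\<omega>. \<Sum>j<n. c j * \<omega> j)) t
      = (\<Prod>j<n. char (distr gaussian_seq borel (\<lambda>\<omega>. c j * \<omega> j)) t)"
    by (rule char_distr_sum, rule indep_vars_compose2[OF indep_vars_subset[OF gaussian_seq_indep]]) auto
  ultimately show ?thesis
    by (simp add: exp_sum[symmetric] sum_distrib_right sum_negf sum_divide_distrib flip: of_real_prod)
qed

section \<open>Cholesky factorization of a second moment matrix\<close>

definition square_int :: "'p measure \<Rightarrow> ('p \<Rightarrow> real) \<Rightarrow> bool" where
  "square_int P f \<longleftrightarrow> f \<in> borel_measurable P \<and> integrable P (\<lambda>\<omega>. (f \<omega>)\<^sup>2)"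

lemma square_int_mult:
  assumes "square_int P f" "square_int P g"
  shows "integrable P (\<lambda>\<omega>. f \<omega> * g \<omega>)"
proof (rule Bochner_Integration.integrable_bound)
  show "integrable P (\<lambda>\<omega>. (f \<omega>)\<^sup>2 + (g \<omega>)\<^sup>2)"
    using assms by (simp add: square_int_def)
  show "AE \<omega> in P. norm (f \<omega> * g \<omega>) \<le> norm ((f \<omega>)\<^sup>2 + (g \<omega>)\<^sup>2)"
    using inner_le_norm_squares[of "f _" "g _"] by simp
qed (use assms in \<open>auto simp: square_int_def intro: borel_measurable_times\<close>)

lemma square_int_diff:
  assumes "square_int P f" "square_int P g"
  shows "square_int P (\<lambda>\<omega>. f \<omega> - c * g \<omega>)"
proof -
  have "(f \<omega> - c * g \<omega>)\<^sup>2 = f \<omega> * f \<omega> - 2 * c * (f \<omega> * g \<omega>) + c\<^sup>2 * (g \<omega> * g \<omega>)" for \<omega>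
    by (simp add: power2_eq_square algebra_simps)
  then show ?thesis
    using assms square_int_mult[OF assms(1,1)] square_int_mult[OF assms] square_int_mult[OF assms(2,2)]
    by (auto simp: square_int_def intro: borel_measurable_diff borel_measurable_times)
qed

text \<open>Gram--Schmidt: in step \<open>n\<close> the component along the \<open>n\<close>-th residual is removed from all functions.
  If that residual vanishes, division by zero makes the step void.\<close>

primrec gs_residual :: "'p measure \<Rightarrow> (nat \<Rightarrow> 'p \<Rightarrow> real) \<Rightarrow> nat \<Rightarrow> nat \<Rightarrow> 'p \<Rightarrow> real" where
  "gs_residual P x 0 = x"
| "gs_residual P x (Suc n) = (\<lambda>i \<omega>. gs_residual P x n i \<omega> -
    (\<integral>\<omega>. gs_residual P x n i \<omega> * gs_residual P x n n \<omega> \<partial>P) /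
    (\<integral>\<omega>. gs_residual P x n n \<omega> * gs_residual P x n n \<omega> \<partial>P) * gs_residual P x n n \<omega>)"

text \<open>Each step subtracts the rank-one term \<open>L i n * L k n\<close> from the matrix
  \<open>K n\<close> of residual second moments, a Schur complement. After n steps the first n rows
  are zero, so the subtracted terms account for the whole entry. Realizing \<open>K n\<close> by
  functions makes its diagonal nonnegative and forces the row of a zero diagonal entry to
  vanish.\<close>

lemma cholesky_factorization:
  assumes x: "\<And>i. square_int P (x i)"
  obtains L :: "nat \<Rightarrow> nat \<Rightarrow> real" where "\<And>i j. i < j \<Longrightarrow> L i j = 0"
    "\<And>i k n. i < n \<Longrightarrow> (\<integral>\<omega>. x i \<omega> * x k \<omega> \<partial>P) = (\<Sum>j<n. L i j * L k j)"
proof -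
  define r where "r = gs_residual P x"
  define K where "K n i k = (\<integral>\<omega>. r n i \<omega> * r n k \<omega> \<partial>P)" for n i k
  have r: "square_int P (r n i)" for n i
    unfolding r_def by (induction n arbitrary: i) (simp_all add: x square_int_diff del: times_divide_eq_left)
  have sym: "K n i k = K n k i" for n i k
    by (simp add: K_def mult.commute)
  have pos: "0 \<le> K n i i" for n i
    by (simp add: K_def)
  have step: "K (Suc n) i k = K n i k - K n i n * K n k n / K n n n" for n i k
  proof -
    define a where "a = K n i n / K n n n"
    define b where "b = K n k n / K n n n"
    have "K (Suc n) i k = (\<integral>\<omega>. r n i \<omega> * r n k \<omega> - b * (r n i \<omega> * r n n \<omega>) - a * (r n k \<omega> * r n n \<omega>)
        + a * b * (r n n \<omega> * r n n \<omega>) \<partial>P)"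
      unfolding K_def[of "Suc n"] by (simp add: r_def a_def b_def K_def algebra_simps)
    also have "\<dots> = K n i k - b * K n i n - a * K n k n + a * b * K n n n"
      using square_int_mult[OF r r] by (simp add: K_def)
    also have "\<dots> = K n i k - K n i n * K n k n / K n n n"
      by (cases "K n n n = 0") (simp_all add: a_def b_def)
    finally show ?thesis .
  qed
  have deg: "K n n k = 0" if "K n n n = 0" for n k
  proof -
    have "AE \<omega> in P. r n n \<omega> * r n n \<omega> = 0"
      using integral_nonneg_eq_0_iff_AE[OF square_int_mult[OF r[of n n] r[of n n]]] that by (simp add: K_def)
    then have "AE \<omega> in P. r n n \<omega> * r n k \<omega> = 0" by eventually_elim simp
    then have "K n n k = (\<integral>\<omega>. 0 \<partial>P)"
      unfolding K_def using square_int_mult[OF r[of n n] r[of n k]] by (intro integral_cong_AE) auto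
    then show ?thesis by simp
  qed
  have zero: "K n i k = 0" if "i < n" for n i k
    using that
  proof (induction n arbitrary: k)
    case (Suc n)
    show ?case
    proof (cases "i = n")
      case True
      then show ?thesis
        using deg[of n k] by (cases "K n n n = 0") (simp_all add: step sym[of n k n])
    next
      case False
      then show ?thesis using Suc by (simp add: step)
    qed
  qed simp
  define L where "L i n = K n i n / sqrt (K n n n)" for i n
  have L: "L i n * L k n = K n i n * K n k n / K n n n" for i k n
    using pos[of n n] by (simp add: L_def)
  have sum: "K 0 i k = (\<Sum>j<n. L i j * L k j) + K n i k" for n i k
    by (induction n) (simp_all add: L step)
  show thesis
  proof
    show "L i j = 0" if "i < j" for i j
      using zero[OF that] by (simp add: L_def)
    show "(\<integral>\<omega>. x i \<omega> * x k \<omega> \<partial>P) = (\<Sum>j<n. L i j * L k j)" if "i < n" for i k n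
      using sum[of i k n] zero[OF that] by (simp add: K_def r_def)
  qed
qed

lemma onb_sequence_summable:
  fixes e :: "nat \<Rightarrow> 'a::{real_inner,banach}"
  assumes e: "onb_sequence e" and c: "summable (\<lambda>i. (c i)\<^sup>2)"
  shows "summable (\<lambda>i. c i *\<^sub>R e i)"
  unfolding summable_Cauchy
proof (intro allI impI)
  fix r :: real assume r: "r > 0"
  then obtain N where N: "\<And>m n. m \<ge> N \<Longrightarrow> norm (\<Sum>i=m..<n. (c i)\<^sup>2) < r\<^sup>2"
    using c unfolding summable_Cauchy by (meson zero_less_power)
  have "norm (\<Sum>i=m..<n. c i *\<^sub>R e i) < r" if "m \<ge> N" for m n
  proof -
    have e1: "e i \<bullet> e i \<le> 1" for i
      using e unfolding onb_sequence_def by (metis inner_zero_left order_refl zero_le_one)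
    have "(\<Sum>i=m..<n. c i *\<^sub>R e i) = (\<Sum>i<n. (if m \<le> i then c i else 0) *\<^sub>R e i)"
      by (rule sum.mono_neutral_cong_left) auto
    then have "(norm (\<Sum>i=m..<n. c i *\<^sub>R e i))\<^sup>2 = (\<Sum>i<n. (if m \<le> i then c i else 0)\<^sup>2 * (e i \<bullet> e i))"
      by (simp only: norm_sum_onb_sequence[OF e])
    also have "\<dots> \<le> (\<Sum>i<n. (if m \<le> i then c i else 0)\<^sup>2)"
      by (intro sum_mono mult_left_le e1) simp
    also have "\<dots> = (\<Sum>i=m..<n. (c i)\<^sup>2)"
      by (rule sum.mono_neutral_cong_right) auto
    also have "\<dots> < r\<^sup>2" using N[OF that, of n] by simp
    finally show ?thesis using r by (simp add: power2_less_imp_less)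
  qed
  then show "\<exists>N. \<forall>m\<ge>N. \<forall>n. norm (\<Sum>i=m..<n. c i *\<^sub>R e i) < r" by blast
qed

text \<open>Nonnegative integrals allow this to establish square integrability of the Gaussian limit
  instead of presupposing it.\<close>

lemma nn_integral_parseval:
  fixes f :: "'v \<Rightarrow> 'a::{real_inner,second_countable_topology}"
  assumes e: "onb_sequence e" and f: "f \<in> borel_measurable N"
  shows "(\<integral>\<^sup>+\<omega>. ennreal ((norm (f \<omega>))\<^sup>2) \<partial>N) = (\<Sum>i. \<integral>\<^sup>+\<omega>. ennreal ((e i \<bullet> f \<omega>)\<^sup>2) \<partial>N)"
proof -
  have "ennreal ((norm x)\<^sup>2) = (\<Sum>i. ennreal ((e i \<bullet> x)\<^sup>2))" for x
    using onb_sequence_parseval[OF e, of x] by (subst suminf_ennreal_eq) (auto simp: inner_commute)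
  then have "(\<integral>\<^sup>+\<omega>. ennreal ((norm (f \<omega>))\<^sup>2) \<partial>N) = (\<integral>\<^sup>+\<omega>. (\<Sum>i. ennreal ((e i \<bullet> f \<omega>)\<^sup>2)) \<partial>N)"
    by simp
  also have "\<dots> = (\<Sum>i. \<integral>\<^sup>+\<omega>. ennreal ((e i \<bullet> f \<omega>)\<^sup>2) \<partial>N)"
    using f by (intro nn_integral_suminf) measurable
  finally show ?thesis .
qed

text \<open>The coefficients \<open>g i\<close> receive the covariances of
  \<open>e i \<bullet> Y \<omega>\<close>. Their variances sum to the second moment of
  \<open>Y\<close>, so almost surely their squares are summable and the random series converges.
  Once each projection \<open>h \<bullet> G \<omega>\<close> is known to be Gaussian with variance
  \<open>v h\<close>, polarization gives the covariance operator.\<close>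

theorem gaussian_exists:
  fixes \<psi> :: "'p \<Rightarrow> 'a::{real_inner,banach,second_countable_topology}"
  assumes P: "prob_space P" and \<psi>: "\<psi> \<in> borel_measurable P" "integrable P (\<lambda>\<omega>. (norm (\<psi> \<omega>))\<^sup>2)"
  shows "\<exists>\<nu> :: 'a measure. prob_space \<nu> \<and> sets \<nu> = sets borel \<and> centered_gaussian \<nu> (\<lambda>z. z) \<and>
    same_covariance \<nu> (\<lambda>z. z) P \<psi>"
proof -
  interpret P: prob_space P by fact
  interpret \<Omega>: prob_space gaussian_seq by (rule prob_space_gaussian_seq)
  obtain e :: "nat \<Rightarrow> 'a" where e: "onb_sequence e" using onb_sequence_exists by blast
  define Y where "Y \<omega> = \<psi> \<omega> - P.expectation \<psi>" for \<omega>
  have Y: "Y \<in> borel_measurable P" "integrable P (\<lambda>\<omega>. (norm (Y \<omega>))\<^sup>2)"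
    using \<psi> P.integrable_square_bounded_linear[OF \<psi> bounded_linear_ident] by (simp_all add: Y_def[abs_def])
  define v where "v h = P.expectation (\<lambda>\<omega>. (h \<bullet> Y \<omega>)\<^sup>2)" for h
  have Yh: "square_int P (\<lambda>\<omega>. h \<bullet> Y \<omega>)" for h
    using P.integrable_square_bounded_linear[OF Y bounded_linear_inner_right[of h], of 0] Y(1)
    by (simp add: square_int_def)
  have v0: "0 \<le> v h" for h by (simp add: v_def)
  have sum_v: "(\<Sum>i. ennreal (v (e i))) < \<infinity>"
  proof -
    have "(\<Sum>i. ennreal (v (e i))) = (\<Sum>i. \<integral>\<^sup>+\<omega>. ennreal ((e i \<bullet> Y \<omega>)\<^sup>2) \<partial>P)"
      unfolding v_def using Yh by (subst nn_integral_eq_integral) (auto simp: square_int_def)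
    also have "\<dots> = (\<integral>\<^sup>+\<omega>. ennreal ((norm (Y \<omega>))\<^sup>2) \<partial>P)"
      by (rule nn_integral_parseval[OF e Y(1), symmetric])
    also have "\<dots> < \<infinity>"
      using Y(2) by (subst nn_integral_eq_integral) auto
    finally show ?thesis .
  qed
  obtain L where L: "\<And>i j. i < j \<Longrightarrow> L i j = 0"
    "\<And>i k n. i < n \<Longrightarrow> P.expectation (\<lambda>\<omega>. (e i \<bullet> Y \<omega>) * (e k \<bullet> Y \<omega>)) = (\<Sum>j<n. L i j * L k j)"
    using cholesky_factorization[of P "\<lambda>i \<omega>. e i \<bullet> Y \<omega>", OF Yh] by metis
  define g where "g i \<omega> = (\<Sum>j<Suc i. L i j * \<omega> j)" for i and \<omega> :: "nat \<Rightarrow> real"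
  \<comment> \<open>Since \<open>L\<close> is triangular, the coefficients of a partial sum of
    length n are combinations of the same n normal variables.\<close>
  have g_eq: "g i \<omega> = (\<Sum>j<n. L i j * \<omega> j)" if "i < n" for i n \<omega>
    unfolding g_def using that L(1) by (intro sum.mono_neutral_left) auto
  have gm [measurable]: "g i \<in> borel_measurable gaussian_seq" for i
    unfolding g_def[abs_def]
    by (intro borel_measurable_sum borel_measurable_times borel_measurable_const gaussian_seq_measurable)
  have g2: "(\<integral>\<^sup>+\<omega>. ennreal ((g i \<omega>)\<^sup>2) \<partial>gaussian_seq) = ennreal (v (e i))" for i
  proof -
    have "v (e i) = (\<Sum>j<Suc i. (L i j)\<^sup>2)"
      using L(2)[of i "Suc i" i] by (simp add: v_def power2_eq_square)
    then have "char (distr gaussian_seq borel (g i)) t = complex_of_real (exp (- (v (e i) * t\<^sup>2) / 2))" for t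
      using gaussian_seq_char_sum[of "L i" "Suc i" t] by (simp only: g_def[abs_def])
    from \<Omega>.centered_gaussian_real_charI(2,3)[OF gm v0 this]
    show ?thesis by (subst nn_integral_eq_integral) auto
  qed
  have "(\<integral>\<^sup>+\<omega>. (\<Sum>i. ennreal ((g i \<omega>)\<^sup>2)) \<partial>gaussian_seq) = (\<Sum>i. ennreal (v (e i)))"
    by (subst nn_integral_suminf) (simp_all add: g2)
  then have "AE \<omega> in gaussian_seq. (\<Sum>i. ennreal ((g i \<omega>)\<^sup>2)) \<noteq> \<infinity>"
    using sum_v by (intro nn_integral_PInf_AE) auto
  then have AE_sum: "AE \<omega> in gaussian_seq. summable (\<lambda>i. g i \<omega> *\<^sub>R e i)"
    by eventually_elim (auto intro!: onb_sequence_summable[OF e] summable_suminf_not_top)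
  define G where "G \<omega> = (\<Sum>i. g i \<omega> *\<^sub>R e i)" for \<omega>
  have Gm [measurable]: "G \<in> borel_measurable gaussian_seq"
    unfolding G_def[abs_def] by measurable
  have char_G: "char (distr gaussian_seq borel (\<lambda>\<omega>. h \<bullet> G \<omega>)) t = complex_of_real (exp (- (v h * t\<^sup>2) / 2))" for h t
  proof (rule \<Omega>.char_distr_limit)
    define c where "c n j = (\<Sum>i<n. (h \<bullet> e i) * L i j)" for n j
    have S: "h \<bullet> (\<Sum>i<n. g i \<omega> *\<^sub>R e i) = (\<Sum>j<n. c n j * \<omega> j)" for n \<omega>
    proof -
      have "h \<bullet> (\<Sum>i<n. g i \<omega> *\<^sub>R e i) = (\<Sum>i<n. \<Sum>j<n. (h \<bullet> e i) * L i j * \<omega> j)"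
        by (simp add: inner_sum_right g_eq sum_distrib_left sum_distrib_right mult_ac)
      also have "\<dots> = (\<Sum>j<n. c n j * \<omega> j)"
        by (subst sum.swap) (simp add: c_def sum_distrib_right)
      finally show ?thesis .
    qed
    show "(\<lambda>\<omega>. h \<bullet> (\<Sum>i<n. g i \<omega> *\<^sub>R e i)) \<in> borel_measurable gaussian_seq" for n
      by measurable
    show "AE \<omega> in gaussian_seq. (\<lambda>n. h \<bullet> (\<Sum>i<n. g i \<omega> *\<^sub>R e i)) \<longlonglongrightarrow> h \<bullet> G \<omega>"
      using AE_sum by eventually_elim (auto simp: G_def intro!: tendsto_inner summable_LIMSEQ)
    show "char (distr gaussian_seq borel (\<lambda>\<omega>. h \<bullet> (\<Sum>i<n. g i \<omega> *\<^sub>R e i))) t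
        = complex_of_real (exp (- ((\<Sum>j<n. (c n j)\<^sup>2) * t\<^sup>2) / 2))" for n
      unfolding S by (rule gaussian_seq_char_sum)
    \<comment> \<open>The Cholesky identity turns the squared coefficients into the variance of a
      finite projection of \<open>Y\<close>, which tends to \<open>v h\<close> by dominated
      convergence.\<close>
    have "(\<Sum>j<n. (c n j)\<^sup>2) = P.expectation (\<lambda>\<omega>. (h \<bullet> proj_seq e n (Y \<omega>))\<^sup>2)" for n
    proof -
      have "(\<Sum>j<n. (c n j)\<^sup>2) = (\<Sum>j<n. \<Sum>i<n. \<Sum>k<n. (h \<bullet> e i) * (h \<bullet> e k) * (L i j * L k j))"
        by (simp add: c_def power2_eq_square sum_product mult_ac)
      also have "\<dots> = (\<Sum>i<n. \<Sum>j<n. \<Sum>k<n. (h \<bullet> e i) * (h \<bullet> e k) * (L i j * L k j))"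
        by (rule sum.swap)
      also have "\<dots> = (\<Sum>i<n. \<Sum>k<n. \<Sum>j<n. (h \<bullet> e i) * (h \<bullet> e k) * (L i j * L k j))"
        by (intro sum.cong refl sum.swap)
      also have "\<dots> = (\<Sum>i<n. \<Sum>k<n. (h \<bullet> e i) * (h \<bullet> e k) * P.expectation (\<lambda>\<omega>. (e i \<bullet> Y \<omega>) * (e k \<bullet> Y \<omega>)))"
        by (intro sum.cong refl) (simp add: L(2) sum_distrib_left)
      also have "\<dots> = P.expectation (\<lambda>\<omega>. \<Sum>i<n. \<Sum>k<n. (h \<bullet> e i) * (h \<bullet> e k) * ((e i \<bullet> Y \<omega>) * (e k \<bullet> Y \<omega>)))"
        using square_int_mult[OF Yh Yh] by (simp add: Bochner_Integration.integral_sum Bochner_Integration.integrable_sum)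
      also have "(\<lambda>\<omega>. \<Sum>i<n. \<Sum>k<n. (h \<bullet> e i) * (h \<bullet> e k) * ((e i \<bullet> Y \<omega>) * (e k \<bullet> Y \<omega>)))
          = (\<lambda>\<omega>. (h \<bullet> proj_seq e n (Y \<omega>))\<^sup>2)"
        by (simp add: proj_seq_def inner_sum_right power2_eq_square sum_product inner_commute[of _ "e _"] mult_ac)
      finally show ?thesis .
    qed
    moreover have "(\<lambda>n. P.expectation (\<lambda>\<omega>. (h \<bullet> proj_seq e n (Y \<omega>))\<^sup>2)) \<longlonglongrightarrow> v h"
      unfolding v_def
    proof (rule integral_dominated_convergence[where w = "\<lambda>\<omega>. (2 * norm h)\<^sup>2 * (norm (Y \<omega>))\<^sup>2"])
      show "(\<lambda>\<omega>. (h \<bullet> proj_seq e n (Y \<omega>))\<^sup>2) \<in> borel_measurable P" for n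
        by (rule measurable_compose[OF Y(1)], intro borel_measurable_continuous_onI continuous_intros
            linear_continuous_on bounded_linear_proj_seq)
      show "AE \<omega> in P. (\<lambda>n. (h \<bullet> proj_seq e n (Y \<omega>))\<^sup>2) \<longlonglongrightarrow> (h \<bullet> Y \<omega>)\<^sup>2"
        by (intro AE_I2 tendsto_intros proj_seq_tendsto[OF e])
      show "AE \<omega> in P. norm ((h \<bullet> proj_seq e n (Y \<omega>))\<^sup>2) \<le> (2 * norm h)\<^sup>2 * (norm (Y \<omega>))\<^sup>2" for n
      proof (rule AE_I2)
        fix \<omega>
        have "norm (proj_seq e n (Y \<omega>)) \<le> 2 * norm (Y \<omega>)"
          using norm_diff_proj_seq_le[OF e, of "Y \<omega>" n] norm_triangle_ineq2[of "proj_seq e n (Y \<omega>)" "Y \<omega>"]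
          by (simp add: norm_minus_commute)
        then have "norm h * norm (proj_seq e n (Y \<omega>)) \<le> norm h * (2 * norm (Y \<omega>))"
          by (rule mult_left_mono) simp
        with Cauchy_Schwarz_ineq2[of h "proj_seq e n (Y \<omega>)"]
        have "\<bar>h \<bullet> proj_seq e n (Y \<omega>)\<bar>\<^sup>2 \<le> (norm h * (2 * norm (Y \<omega>)))\<^sup>2"
          by (intro power_mono) auto
        then show "norm ((h \<bullet> proj_seq e n (Y \<omega>))\<^sup>2) \<le> (2 * norm h)\<^sup>2 * (norm (Y \<omega>))\<^sup>2"
          by (simp add: power_mult_distrib mult_ac)
      qed
    qed (use Y Yh in \<open>auto simp: square_int_def\<close>)
    ultimately show "(\<lambda>n. \<Sum>j<n. (c n j)\<^sup>2) \<longlonglongrightarrow> v h" by simp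
  qed measurable
  define \<nu> where "\<nu> = distr gaussian_seq borel G"
  interpret \<nu>: prob_space \<nu> unfolding \<nu>_def by (rule \<Omega>.prob_space_distr) simp
  have sets: "sets \<nu> = sets borel" by (simp add: \<nu>_def)
  have idm: "(\<lambda>z. z) \<in> borel_measurable \<nu>" by (simp add: measurable_ident_sets sets)
  have hm: "(\<lambda>z. h \<bullet> z) \<in> borel_measurable \<nu>" for h using idm by measurable
  have "char (distr \<nu> borel (\<lambda>z. h \<bullet> z)) t = complex_of_real (exp (- (v h * t\<^sup>2) / 2))" for h t
    unfolding \<nu>_def char_G[symmetric] by (subst distr_distr) (auto simp: comp_def)
  note gauss = \<nu>.centered_gaussian_real_charI[OF hm v0 this]
  have gaussian: "centered_gaussian \<nu> (\<lambda>z. z)"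
    using idm gauss(1) by (simp add: centered_gaussian_def)
  have "(\<integral>\<^sup>+z. ennreal ((norm z)\<^sup>2) \<partial>\<nu>) = (\<Sum>i. \<integral>\<^sup>+z. ennreal ((e i \<bullet> z)\<^sup>2) \<partial>\<nu>)"
    by (rule nn_integral_parseval[OF e idm])
  also have "\<dots> = (\<Sum>i. ennreal (v (e i)))"
    using gauss(2,3) by (simp add: nn_integral_eq_integral)
  finally have sq: "integrable \<nu> (\<lambda>z. (norm z)\<^sup>2)"
    using sum_v idm by (intro integrableI_bounded) auto
  have mean: "\<nu>.expectation (\<lambda>z. z) = 0"
    by (rule \<nu>.centered_gaussian_mean[OF gaussian \<nu>.integrable_of_square[OF idm sq]])
  have "same_covariance \<nu> (\<lambda>z. z) P \<psi>"
  proof (rule same_covarianceI[OF \<nu>.prob_space_axioms P idm sq \<psi>])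
    show "\<nu>.expectation (\<lambda>z. (t \<bullet> (z - \<nu>.expectation (\<lambda>z. z)))\<^sup>2) = P.expectation (\<lambda>\<omega>. (t \<bullet> (\<psi> \<omega> - P.expectation \<psi>))\<^sup>2)" for t
      using gauss(2)[of t] by (simp add: mean v_def Y_def)
  qed
  then show ?thesis
    using \<nu>.prob_space_axioms sets gaussian by blast
qed

section \<open>Linear differential equations\<close>

definition blinfun_pow :: "('a::real_normed_vector \<Rightarrow>\<^sub>L 'a) \<Rightarrow> nat \<Rightarrow> 'a \<Rightarrow>\<^sub>L 'a" where
  "blinfun_pow A n = ((\<lambda>X. A o\<^sub>L X) ^^ n) id_blinfun"

lemma blinfun_pow_0 [simp]: "blinfun_pow A 0 = id_blinfun"
  and blinfun_pow_Suc: "blinfun_pow A (Suc n) = A o\<^sub>L blinfun_pow A n"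
  by (simp_all add: blinfun_pow_def)

lemmas blinfun_compose_scaleR =
  bounded_bilinear.scaleR_left[OF bounded_bilinear_blinfun_compose]
  bounded_bilinear.scaleR_right[OF bounded_bilinear_blinfun_compose]

lemmas bounded_linear_blinfun_compose =
  bounded_bilinear.bounded_linear_left[OF bounded_bilinear_blinfun_compose]
  bounded_bilinear.bounded_linear_right[OF bounded_bilinear_blinfun_compose]

lemma blinfun_compose_assoc: "(A o\<^sub>L B) o\<^sub>L C = A o\<^sub>L (B o\<^sub>L C)"
  by (rule blinfun_eqI) simp

lemma norm_blinfun_pow: "norm (blinfun_pow A n) \<le> norm A ^ n"
proof (induction n)
  case 0
  show ?case by (simp add: norm_blinfun_bound)
next
  case (Suc n)
  have "norm (blinfun_pow A (Suc n)) \<le> norm A * norm (blinfun_pow A n)"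
    by (simp add: blinfun_pow_Suc norm_blinfun_compose)
  also have "\<dots> \<le> norm A ^ Suc n"
    using Suc by (simp add: mult_left_mono)
  finally show ?case .
qed

lemma blinfun_pow_scaleR: "blinfun_pow (c *\<^sub>R A) n = c ^ n *\<^sub>R blinfun_pow A n"
  by (induction n) (simp_all add: blinfun_pow_Suc blinfun_compose_scaleR)

lemma op_exp_summable_norm:
  "summable (\<lambda>n. norm ((1 / fact n) *\<^sub>R blinfun_pow A n))"
proof (rule summable_comparison_test')
  show "summable (\<lambda>n. norm A ^ n / fact n)"
    using summable_exp[of "norm A"] by (simp add: divide_inverse mult.commute)
  show "norm (norm ((1 / fact n) *\<^sub>R blinfun_pow A n)) \<le> norm A ^ n / fact n" for n
    using norm_blinfun_pow[of A n] by (simp add: divide_right_mono)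
qed

lemma op_exp_sums: "(\<lambda>n. (1 / fact n) *\<^sub>R blinfun_pow A n) sums op_exp (A :: 'a::banach \<Rightarrow>\<^sub>L 'a)"
  unfolding op_exp_def blinfun_pow_def[symmetric]
  by (rule summable_sums[OF summable_norm_cancel[OF op_exp_summable_norm]])

lemma norm_op_exp: "norm (op_exp (A :: 'a::banach \<Rightarrow>\<^sub>L 'a)) \<le> exp (norm A)"
proof -
  have "norm (op_exp A) \<le> (\<Sum>n. norm ((1 / fact n) *\<^sub>R blinfun_pow A n))"
    using summable_norm[OF op_exp_summable_norm, of A] op_exp_sums[of A] by (simp add: sums_iff)
  also have "\<dots> \<le> (\<Sum>n. norm A ^ n /\<^sub>R fact n)"
  proof (rule suminf_le[OF _ op_exp_summable_norm])
    show "norm ((1 / fact n) *\<^sub>R blinfun_pow A n) \<le> norm A ^ n /\<^sub>R fact n" for n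
      using norm_blinfun_pow[of A n] by (simp add: divide_inverse mult_left_mono mult.commute)
    show "summable (\<lambda>n. norm A ^ n /\<^sub>R fact n)"
      by (rule summable_exp_generic)
  qed
  finally show ?thesis by (simp add: exp_def)
qed

lemma op_exp_0 [simp]: "op_exp (0 :: 'a::banach \<Rightarrow>\<^sub>L 'a) = id_blinfun"
proof -
  have "blinfun_pow (0 :: 'a \<Rightarrow>\<^sub>L 'a) n = (if n = 0 then id_blinfun else 0)" for n
    by (cases n) (simp_all add: blinfun_pow_Suc)
  then have "(\<lambda>n. (1 / fact n) *\<^sub>R blinfun_pow (0 :: 'a \<Rightarrow>\<^sub>L 'a) n) = (\<lambda>n. if n = 0 then id_blinfun else 0)"
    by auto
  then have "(\<lambda>n::nat. if n = 0 then id_blinfun else 0) sums op_exp (0 :: 'a \<Rightarrow>\<^sub>L 'a)"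
    using op_exp_sums[of "0 :: 'a \<Rightarrow>\<^sub>L 'a"] by simp
  then show ?thesis
    using sums_single[of 0 "\<lambda>_. id_blinfun :: 'a \<Rightarrow>\<^sub>L 'a"] sums_unique2 by (metis (mono_tags, lifting) sums_cong)
qed

lemma op_exp_commute: "A o\<^sub>L op_exp (t *\<^sub>R A) = op_exp (t *\<^sub>R A) o\<^sub>L (A :: 'a::banach \<Rightarrow>\<^sub>L 'a)"
proof -
  have c: "A o\<^sub>L blinfun_pow A n = blinfun_pow A n o\<^sub>L A" for n
  proof (induction n)
    case 0
    show ?case by (rule blinfun_eqI) simp
  next
    case (Suc n)
    then show ?case by (metis blinfun_compose_assoc blinfun_pow_Suc)
  qed
  have "(\<lambda>n. A o\<^sub>L ((1 / fact n) *\<^sub>R blinfun_pow (t *\<^sub>R A) n)) sums (A o\<^sub>L op_exp (t *\<^sub>R A))"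
    by (intro bounded_linear.sums[OF bounded_linear_blinfun_compose(2)] op_exp_sums)
  moreover have "(\<lambda>n. ((1 / fact n) *\<^sub>R blinfun_pow (t *\<^sub>R A) n) o\<^sub>L A) sums (op_exp (t *\<^sub>R A) o\<^sub>L A)"
    by (intro bounded_linear.sums[OF bounded_linear_blinfun_compose(1)] op_exp_sums)
  ultimately show ?thesis
    by (simp add: blinfun_pow_scaleR blinfun_compose_scaleR c sums_iff)
qed

text \<open>The power series is differentiated term by term: the derivative of the n-th term is
  \<open>A\<close> composed with the preceding one, so the series of derivatives is a shifted
  exponential series.\<close>

lemma op_exp_has_vector_derivative:
  fixes A :: "'a::banach \<Rightarrow>\<^sub>L 'a"
  shows "((\<lambda>t. op_exp (t *\<^sub>R A)) has_vector_derivative (A o\<^sub>L op_exp (t *\<^sub>R A))) (at t)"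
proof -
  \<comment> \<open>A bounded open interval around \<open>t\<close>, on which the terms are
    dominated uniformly by the exponential series of \<open>R\<close>.\<close>
  define S where "S = {-(\<bar>t\<bar> + 1)<..<\<bar>t\<bar> + 1}"
  have tS: "t \<in> S" unfolding S_def greaterThanLessThan_iff by linarith
  define R where "R = norm A * (\<bar>t\<bar> + 1)"
  define f where "f n s = (1 / fact n) *\<^sub>R blinfun_pow (s *\<^sub>R A) n" for n s
  define f' where "f' n s = (case n of 0 \<Rightarrow> 0 | Suc m \<Rightarrow> A o\<^sub>L f m s)" for n s
  have f_eq: "f n s = (s ^ n / fact n) *\<^sub>R blinfun_pow A n" for n s
    by (simp add: f_def blinfun_pow_scaleR)
  have sums_f: "(\<lambda>n. f n s) sums op_exp (s *\<^sub>R A)" for s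
    unfolding f_def by (rule op_exp_sums)
  have sums_f': "(\<lambda>n. f' n s) sums (A o\<^sub>L op_exp (s *\<^sub>R A))" for s
  proof -
    have "(\<lambda>n. f' (Suc n) s) sums (A o\<^sub>L op_exp (s *\<^sub>R A))"
      unfolding f'_def nat.case by (intro bounded_linear.sums[OF bounded_linear_blinfun_compose(2)] sums_f)
    then show ?thesis by (subst (asm) sums_Suc_iff) (simp add: f'_def)
  qed
  have der: "(f n has_vector_derivative f' n s) (at s within S)" for n s
  proof (cases n)
    case 0
    then have "f n = (\<lambda>_. id_blinfun)" by (simp add: f_eq fun_eq_iff)
    then show ?thesis using 0 by (simp add: f'_def)
  next
    case (Suc m)
    have "((\<lambda>s. s ^ Suc m / fact (Suc m)) has_real_derivative s ^ m / fact m) (at s within S)"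
      by (rule derivative_eq_intros refl)+ (simp_all add: fact_Suc field_simps del: of_nat_Suc)
    then have "((\<lambda>s. (s ^ Suc m / fact (Suc m)) *\<^sub>R blinfun_pow A (Suc m)) has_vector_derivative
        (s ^ m / fact m) *\<^sub>R blinfun_pow A (Suc m)) (at s within S)"
      using bounded_linear.has_vector_derivative[OF bounded_linear_scaleR_left]
      by (simp add: has_real_derivative_iff_has_vector_derivative)
    then show ?thesis
      unfolding f_eq[abs_def] using Suc by (simp only: f'_def f_eq nat.case blinfun_pow_Suc blinfun_compose_scaleR)
  qed
  have R: "norm (f' n s) \<le> norm A * (case n of 0 \<Rightarrow> 0 | Suc m \<Rightarrow> R ^ m / fact m)" if "s \<in> S" for n s
  proof (cases n)
    case (Suc m)
    have "norm (s *\<^sub>R A) \<le> R"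
      using that by (auto simp: S_def R_def mult.commute[of "norm A"] intro!: mult_right_mono)
    then have "norm (blinfun_pow (s *\<^sub>R A) m) \<le> R ^ m"
      by (intro order_trans[OF norm_blinfun_pow] power_mono) auto
    then have "norm (f m s) \<le> R ^ m / fact m"
      by (simp add: f_def divide_right_mono)
    from order_trans[OF norm_blinfun_compose mult_left_mono[OF this norm_ge_zero[of A]]]
    show ?thesis using Suc by (simp add: f'_def)
  qed (simp add: f'_def)
  have "summable (\<lambda>n. case n of 0 \<Rightarrow> 0 | Suc m \<Rightarrow> R ^ m / fact m)"
    using summable_exp[of R] by (subst summable_Suc_iff[symmetric]) (simp add: divide_inverse mult.commute)
  then have R': "summable (\<lambda>n. norm A * (case n of 0 \<Rightarrow> 0 | Suc m \<Rightarrow> R ^ m / fact m))"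
    by (rule summable_mult)
  have unif: "uniform_limit S (\<lambda>n s. \<Sum>i<n. f' i s) (\<lambda>s. \<Sum>i. f' i s) sequentially"
    by (rule Weierstrass_m_test[OF _ R']) (rule R)
  have "\<exists>g. \<forall>s\<in>S. (\<lambda>n. f n s) sums g s \<and> (g has_derivative (\<lambda>h. h *\<^sub>R (A o\<^sub>L op_exp (s *\<^sub>R A)))) (at s within S)"
  proof (rule has_derivative_series)
    show "convex S" unfolding S_def by (rule convex_real_interval)
    show "(f n has_derivative (\<lambda>h. h *\<^sub>R f' n s)) (at s within S)" if "s \<in> S" for n s
      using der by (simp add: has_vector_derivative_def)
    show "t \<in> S" by (rule tS)
    show "(\<lambda>n. f n t) sums op_exp (t *\<^sub>R A)" by (rule sums_f)
    show "\<forall>\<^sub>F n in sequentially. \<forall>s\<in>S. \<forall>h.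
        norm ((\<Sum>i<n. h *\<^sub>R f' i s) - h *\<^sub>R (A o\<^sub>L op_exp (s *\<^sub>R A))) \<le> e * norm h" if "e > 0" for e
    proof -
      have "\<forall>\<^sub>F n in sequentially. \<forall>s\<in>S. dist (\<Sum>i<n. f' i s) (A o\<^sub>L op_exp (s *\<^sub>R A)) < e"
        using unif that sums_f' unfolding uniform_limit_iff by (simp add: sums_iff)
      then show ?thesis
      proof (rule eventually_mono, intro ballI allI)
        fix n s h assume "\<forall>s\<in>S. dist (\<Sum>i<n. f' i s) (A o\<^sub>L op_exp (s *\<^sub>R A)) < e" "s \<in> S"
        then have "norm ((\<Sum>i<n. f' i s) - (A o\<^sub>L op_exp (s *\<^sub>R A))) \<le> e"
          by (auto simp: dist_norm less_imp_le)
        then have "\<bar>h\<bar> * norm ((\<Sum>i<n. f' i s) - (A o\<^sub>L op_exp (s *\<^sub>R A))) \<le> \<bar>h\<bar> * e"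
          by (rule mult_left_mono) simp
        then show "norm ((\<Sum>i<n. h *\<^sub>R f' i s) - h *\<^sub>R (A o\<^sub>L op_exp (s *\<^sub>R A))) \<le> e * norm h"
          by (simp flip: scaleR_sum_right scaleR_diff_right add: mult.commute)
      qed
    qed
  qed
  then obtain g where g: "\<And>s. s \<in> S \<Longrightarrow> (\<lambda>n. f n s) sums g s"
    "\<And>s. s \<in> S \<Longrightarrow> (g has_vector_derivative (A o\<^sub>L op_exp (s *\<^sub>R A))) (at s within S)"
    unfolding has_vector_derivative_def by blast
  have g_eq: "g s = op_exp (s *\<^sub>R A)" if "s \<in> S" for s
    using g(1)[OF that] sums_f by (rule sums_unique2)
  have S: "open S" "t \<in> S" using tS by (auto simp: S_def)
  have "(g has_vector_derivative (A o\<^sub>L op_exp (t *\<^sub>R A))) (at t)"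
    using g(2)[OF S(2)] at_within_open[OF S(2,1)] by simp
  then show ?thesis
    by (rule has_vector_derivative_transform_within_open[OF _ S g_eq])
qed

lemma op_exp_has_vector_derivative_minus:
  fixes A :: "'a::banach \<Rightarrow>\<^sub>L 'a"
  shows "((\<lambda>t. op_exp ((- t) *\<^sub>R A)) has_vector_derivative - (A o\<^sub>L op_exp ((- t) *\<^sub>R A))) (at t)"
  using vector_diff_chain_at[OF has_vector_derivative_minus[OF has_vector_derivative_id]
    op_exp_has_vector_derivative[of A "- t"]]
  by (simp add: comp_def)

text \<open>The product has zero derivative in \<open>t\<close> because \<open>A\<close> commutes
  with its exponential, so it keeps its value at 0.\<close>

lemma op_exp_minus: "op_exp (t *\<^sub>R A) o\<^sub>L op_exp ((- t) *\<^sub>R A) = (id_blinfun :: 'a::banach \<Rightarrow>\<^sub>L 'a)"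
proof -
  have "((\<lambda>t. op_exp (t *\<^sub>R A) o\<^sub>L op_exp ((- t) *\<^sub>R A)) has_vector_derivative 0) (at t)" for t
    using bounded_bilinear.has_vector_derivative[OF bounded_bilinear_blinfun_compose op_exp_has_vector_derivative[of A t] op_exp_has_vector_derivative_minus[of A t]]
    by (simp add: op_exp_commute bounded_bilinear.minus_right[OF bounded_bilinear_blinfun_compose] blinfun_compose_assoc del: scaleR_minus_left)
  then obtain c where "op_exp (t *\<^sub>R A) o\<^sub>L op_exp ((- t) *\<^sub>R A) = c" for t
    using has_vector_derivative_zero_constant[of UNIV "\<lambda>t. op_exp (t *\<^sub>R A) o\<^sub>L op_exp ((- t) *\<^sub>R A)"]
    by auto
  from this[of t] this[of 0] show ?thesis
    by (metis blinfun_apply_blinfun_compose blinfun_apply_id_blinfun blinfun_eqI op_exp_0 scaleR_zero_left minus_zero)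
qed

section \<open>Derivatives on the closed half-line\<close>

lemma at_within_halfline: "0 \<le> t \<Longrightarrow> t < T \<Longrightarrow> at t within {0..} = at t within {0..T::real}"
  by (rule at_within_nhd[where S = "{..<T}"]) auto

lemma deriv_halfline_eq:
  assumes "(f has_vector_derivative f') (at t within {0..})" "0 \<le> t"
  shows "deriv_halfline f t = f'"
proof (rule vector_derivative_within[OF _ assms(1)])
  show "at t within {0..} \<noteq> bot"
    using at_within_halfline[of t "t + 1"] assms(2) by (simp add: trivial_limit_within islimpt_Icc)
qed

lemma C1_halflineI:
  assumes "f \<in> extensional {0..}" "continuous_on {0..} g"
    "\<And>t. 0 \<le> t \<Longrightarrow> (f has_vector_derivative g t) (at t within {0..})"
  shows "f \<in> C1_halfline"
proof -
  have "continuous_on {0..} (deriv_halfline f) \<longleftrightarrow> continuous_on {0..} g"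
    by (rule continuous_on_cong) (auto intro: deriv_halfline_eq assms)
  then show ?thesis
    using assms by (auto simp: C1_halfline_def differentiable_def has_vector_derivative_def)
qed

lemma C1_halfline_continuous_on: "f \<in> C1_halfline \<Longrightarrow> continuous_on {0..} f"
  unfolding C1_halfline_def
  by (auto simp: continuous_on_eq_continuous_within intro: differentiable_imp_continuous_within)

section \<open>Variation of constants for linear equations\<close>

lemma continuous_on_op_exp: "continuous_on S (\<lambda>t. op_exp (t *\<^sub>R A))" for A :: "'a::banach \<Rightarrow>\<^sub>L 'a"
  by (intro continuous_at_imp_continuous_on ballI has_vector_derivative_continuous[OF op_exp_has_vector_derivative])

text \<open>Integrate \<open>s \<mapsto> op_exp (- (t - s) A) (u s)\<close>, whose derivative is \<open>op_exp (- (t - s) A) (r s)\<close>.\<close>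

lemma duhamel_has_integral:
  fixes A :: "'a::banach \<Rightarrow>\<^sub>L 'a"
  assumes u: "u 0 = 0"
    "\<And>t. 0 \<le> t \<Longrightarrow> (u has_vector_derivative - blinfun_apply A (u t) + r t) (at t within {0..})"
    and t: "0 \<le> t"
  shows "((\<lambda>s. blinfun_apply (op_exp (- ((t - s) *\<^sub>R A))) (r s)) has_integral u t) {0..t}"
proof -
  define E where "E s = op_exp ((s - t) *\<^sub>R A)" for s
  have E: "op_exp (- ((t - s) *\<^sub>R A)) = E s" for s
    by (simp add: E_def scaleR_left_diff_distrib)
  have dE: "(E has_vector_derivative (A o\<^sub>L E s)) (at s)" for s
  proof -
    have "((\<lambda>s. s - t) has_vector_derivative 1) (at s)"
      by (auto intro!: derivative_eq_intros)
    from vector_diff_chain_at[of "\<lambda>s. s - t" 1 s "\<lambda>s. op_exp (s *\<^sub>R A)", OF this op_exp_has_vector_derivative]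
    show ?thesis by (simp add: E_def[abs_def] comp_def)
  qed
  have "((\<lambda>s. blinfun_apply (E s) (u s)) has_vector_derivative blinfun_apply (E s) (r s)) (at s within {0..t})"
    if "s \<in> {0..t}" for s
  proof -
    have "(u has_vector_derivative - blinfun_apply A (u s) + r s) (at s within {0..t})"
      using u(2)[of s] that by (auto intro: has_vector_derivative_within_subset)
    from bounded_bilinear.has_vector_derivative[OF bounded_bilinear_blinfun_apply
        has_vector_derivative_at_within[OF dE] this]
    show ?thesis
      using op_exp_commute[of A "s - t"]
      by (simp add: blinfun.bilinear_simps E_def)
  qed
  from fundamental_theorem_of_calculus[OF t this]
  show ?thesis by (simp add: E u(1) E_def)
qed

text \<open>The exponential in \<open>t\<close> is pulled out of the convolution integral, so that
  \<open>t\<close> enters only through a factor and an upper limit, each of which can be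
  differentiated. The convolution form is recovered in \<open>lin_flow_has_integral\<close>.
  Restriction to the half-line gives the extensional representative that \<open>C1_halfline\<close>
  requires.\<close>

definition lin_flow :: "('a::banach \<Rightarrow>\<^sub>L 'a) \<Rightarrow> (real \<Rightarrow> 'a) \<Rightarrow> real \<Rightarrow> 'a" where
  "lin_flow A r = (\<lambda>t\<in>{0..}. blinfun_apply (op_exp ((- t) *\<^sub>R A))
    (integral {0..t} (\<lambda>s. blinfun_apply (op_exp (s *\<^sub>R A)) (r s))))"

lemma lin_flow_0 [simp]: "lin_flow A r 0 = 0"
  by (simp add: lin_flow_def blinfun.bilinear_simps)

lemma lin_flow_has_vector_derivative:
  fixes A :: "'a::banach \<Rightarrow>\<^sub>L 'a"
  assumes r: "continuous_on {0..} r" and t: "0 \<le> t"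
  shows "(lin_flow A r has_vector_derivative - blinfun_apply A (lin_flow A r t) + r t) (at t within {0..})"
proof -
  define v where "v t = integral {0..t} (\<lambda>s. blinfun_apply (op_exp (s *\<^sub>R A)) (r s))" for t
  \<comment> \<open>Integrating up to \<open>t + 1\<close> keeps \<open>t\<close> away from the
    right endpoint, so the derivative within this interval is the one within the half-line.\<close>
  have "continuous_on {0..t + 1} (\<lambda>s. blinfun_apply (op_exp (s *\<^sub>R A)) (r s))"
    by (intro continuous_intros continuous_on_op_exp continuous_on_subset[OF r]) auto
  then have "(v has_vector_derivative blinfun_apply (op_exp (t *\<^sub>R A)) (r t)) (at t within {0..t + 1})"
    unfolding v_def[abs_def] using t by (intro integral_has_vector_derivative) auto
  then have dv: "(v has_vector_derivative blinfun_apply (op_exp (t *\<^sub>R A)) (r t)) (at t within {0..})"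
    using at_within_halfline[of t "t + 1"] t by simp
  have dE: "((\<lambda>t. op_exp ((- t) *\<^sub>R A)) has_vector_derivative - (A o\<^sub>L op_exp ((- t) *\<^sub>R A))) (at t within {0..})"
    using op_exp_has_vector_derivative_minus by (rule has_vector_derivative_at_within)
  have 1: "blinfun_apply (op_exp ((- t) *\<^sub>R A)) (blinfun_apply (op_exp (t *\<^sub>R A)) x) = x" for x
    using op_exp_minus[of "- t" A] by (simp flip: blinfun_apply_blinfun_compose)
  have "((\<lambda>t. blinfun_apply (op_exp ((- t) *\<^sub>R A)) (v t)) has_vector_derivative
      - blinfun_apply A (lin_flow A r t) + r t) (at t within {0..})"
    using bounded_bilinear.has_vector_derivative[OF bounded_bilinear_blinfun_apply dE dv] t
    by (simp add: 1 blinfun.bilinear_simps lin_flow_def v_def del: scaleR_minus_left)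
  then show ?thesis
    by (rule has_vector_derivative_transform[rotated 2]) (use t in \<open>auto simp: lin_flow_def v_def\<close>)
qed

lemma lin_flow_C1: "continuous_on {0..} r \<Longrightarrow> lin_flow A r \<in> C1_halfline"
proof (rule C1_halflineI)
  assume r: "continuous_on {0..} r"
  have "continuous_on {0..} (lin_flow A r)"
    using lin_flow_has_vector_derivative[OF r]
    by (auto simp: continuous_on_eq_continuous_within intro: has_vector_derivative_continuous)
  then show "continuous_on {0..} (\<lambda>t. - blinfun_apply A (lin_flow A r t) + r t)"
    by (intro continuous_intros r)
  show "(lin_flow A r has_vector_derivative - blinfun_apply A (lin_flow A r t) + r t) (at t within {0..})"
    if "0 \<le> t" for t
    using r that by (rule lin_flow_has_vector_derivative)
qed (simp add: lin_flow_def)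

lemma lin_flow_has_integral:
  fixes A :: "'a::banach \<Rightarrow>\<^sub>L 'a"
  assumes "continuous_on {0..} r" "0 \<le> t"
  shows "((\<lambda>s. blinfun_apply (op_exp (- ((t - s) *\<^sub>R A))) (r s)) has_integral lin_flow A r t) {0..t}"
  by (intro duhamel_has_integral lin_flow_0 lin_flow_has_vector_derivative assms)

text \<open>Every solution has the same Duhamel integral, hence the same value at each time; the
  values outside the half-line agree by extensionality.\<close>

lemma lin_flow_unique:
  fixes A :: "'a::banach \<Rightarrow>\<^sub>L 'a"
  assumes "continuous_on {0..} r" "u 0 = 0" "u \<in> extensional {0..}"
    "\<And>t. 0 \<le> t \<Longrightarrow> (u has_vector_derivative - blinfun_apply A (u t) + r t) (at t within {0..})"
  shows "u = lin_flow A r"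
proof (rule extensionalityI[OF assms(3)])
  show "lin_flow A r \<in> extensional {0..}" by (simp add: lin_flow_def)
  show "u t = lin_flow A r t" if "t \<in> {0..}" for t
    using duhamel_has_integral[OF assms(2,4), of t] lin_flow_has_integral[OF assms(1), of t A] that
    by (auto intro: has_integral_unique)
qed

lemma solves_ivp_iff_lin_flow:
  fixes A :: "'a::banach \<Rightarrow>\<^sub>L 'a"
  assumes "continuous_on {0..} r"
  shows "solves_ivp (\<lambda>t u. - blinfun_apply A u + r t) f \<longleftrightarrow> f = lin_flow A r"
proof
  assume "solves_ivp (\<lambda>t u. - blinfun_apply A u + r t) f"
  then show "f = lin_flow A r"
    by (intro lin_flow_unique assms) (auto simp: solves_ivp_def C1_halfline_def)
next
  assume f: "f = lin_flow A r"
  show "solves_ivp (\<lambda>t u. - blinfun_apply A u + r t) f"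
    unfolding solves_ivp_def f
    by (intro conjI allI impI lin_flow_C1 lin_flow_0 lin_flow_has_vector_derivative assms)
qed

section \<open>Bounds on the flow and its dependence on operator and forcing\<close>

lemma norm_lin_flow_le:
  fixes A :: "'a::banach \<Rightarrow>\<^sub>L 'a"
  assumes r: "continuous_on {0..} r" and t: "0 \<le> t" "t \<le> T" and K: "\<And>s. s \<in> {0..T} \<Longrightarrow> norm (r s) \<le> K"
  shows "norm (lin_flow A r t) \<le> T * exp (T * norm A) * K"
proof -
  have "norm (r 0) \<le> K" using K[of 0] t by simp
  then have K0: "0 \<le> K" by (rule order_trans[OF norm_ge_zero])
  have b: "norm (blinfun_apply (op_exp (- ((t - s) *\<^sub>R A))) (r s)) \<le> exp (T * norm A) * K" if "s \<in> {0..t}" for s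
  proof -
    have "norm (op_exp (- ((t - s) *\<^sub>R A))) \<le> exp (norm (- ((t - s) *\<^sub>R A)))"
      by (rule norm_op_exp)
    also have "\<dots> \<le> exp (T * norm A)"
      using that t by (auto intro!: mult_right_mono)
    finally show ?thesis
      using K[of s] that t by (intro order_trans[OF norm_blinfun] mult_mono) auto
  qed
  have "norm (lin_flow A r t) \<le> exp (T * norm A) * K * measure lborel {0..t}"
    using lin_flow_has_integral[OF r t(1)] b K0 by (intro has_integral_bound_real[where S = "{}"]) auto
  also have "\<dots> \<le> exp (T * norm A) * K * T"
    using t K0 by (intro mult_left_mono) auto
  finally show ?thesis by (simp add: mult_ac)
qed

lemma lin_flow_uniform_limit_0:
  fixes A :: "'i \<Rightarrow> 'a::banach \<Rightarrow>\<^sub>L 'a"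
  assumes a: "\<forall>\<^sub>F i in G. norm (A i) \<le> a" and c: "\<And>i. continuous_on {0..} (r i)"
    and r: "uniform_limit {0..T} r (\<lambda>_. 0) G"
  shows "uniform_limit {0..T} (\<lambda>i. lin_flow (A i) (r i)) (\<lambda>_. 0) G"
  unfolding uniform_limit_iff
proof (intro allI impI)
  fix e :: real assume e: "e > 0"
  \<comment> \<open>The absolute value admits negative \<open>T\<close>, where the interval is
    empty; the summand 1 makes \<open>D\<close> positive and the final inequality strict.\<close>
  define D where "D = \<bar>T\<bar> * exp (\<bar>T\<bar> * a) + 1"
  have D: "D > 0" by (simp add: D_def add_nonneg_pos)
  have "\<forall>\<^sub>F i in G. \<forall>s\<in>{0..T}. dist (r i s) 0 < e / D"
    using r e D unfolding uniform_limit_iff by simp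
  with a show "\<forall>\<^sub>F i in G. \<forall>t\<in>{0..T}. dist (lin_flow (A i) (r i) t) 0 < e"
  proof eventually_elim
    fix i assume i: "norm (A i) \<le> a" "\<forall>s\<in>{0..T}. dist (r i s) 0 < e / D"
    show "\<forall>t\<in>{0..T}. dist (lin_flow (A i) (r i) t) 0 < e"
    proof
      fix t assume t: "t \<in> {0..T}"
      have "norm (lin_flow (A i) (r i) t) \<le> T * exp (T * norm (A i)) * (e / D)"
        using i t by (intro norm_lin_flow_le c) (auto simp: less_imp_le)
      also have "\<dots> \<le> \<bar>T\<bar> * exp (\<bar>T\<bar> * a) * (e / D)"
        using i t e D by (intro mult_right_mono mult_mono) (auto intro!: mult_mono)
      also have "\<dots> < D * (e / D)"
        unfolding D_def[symmetric] using e D by (intro mult_strict_right_mono) (auto simp: D_def)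
      finally show "dist (lin_flow (A i) (r i) t) 0 < e" using D by simp
    qed
  qed
qed

lemma uniform_limit_blinfun_0:
  fixes A :: "'i \<Rightarrow> 'a::real_normed_vector \<Rightarrow>\<^sub>L 'b::real_normed_vector"
  assumes a: "\<forall>\<^sub>F i in G. norm (A i) \<le> a" and f: "uniform_limit S f (\<lambda>_. 0) G"
  shows "uniform_limit S (\<lambda>i x. blinfun_apply (A i) (f i x)) (\<lambda>_. 0) G"
  unfolding uniform_limit_iff
proof (intro allI impI)
  fix e :: real assume e: "e > 0"
  have "\<forall>\<^sub>F i in G. \<forall>x\<in>S. dist (f i x) 0 < e / (\<bar>a\<bar> + 1)"
    using f e unfolding uniform_limit_iff by simp
  with a show "\<forall>\<^sub>F i in G. \<forall>x\<in>S. dist (blinfun_apply (A i) (f i x)) 0 < e"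
  proof eventually_elim
    fix i assume i: "norm (A i) \<le> a" "\<forall>x\<in>S. dist (f i x) 0 < e / (\<bar>a\<bar> + 1)"
    have "norm (blinfun_apply (A i) (f i x)) < e" if "x \<in> S" for x
    proof -
      have "norm (blinfun_apply (A i) (f i x)) \<le> (\<bar>a\<bar> + 1) * norm (f i x)"
        using i(1) by (intro order_trans[OF norm_blinfun] mult_right_mono) auto
      also have "\<dots> < (\<bar>a\<bar> + 1) * (e / (\<bar>a\<bar> + 1))"
        using i(2) that by (intro mult_strict_left_mono) auto
      finally show ?thesis by simp
    qed
    then show "\<forall>x\<in>S. dist (blinfun_apply (A i) (f i x)) 0 < e" by simp
  qed
qed

lemma uniform_limit_blinfun_apply:
  fixes A :: "'i \<Rightarrow> 'a::real_normed_vector \<Rightarrow>\<^sub>L 'b::real_normed_vector"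
  assumes A: "(A \<longlongrightarrow> A0) G" and u: "bounded (u ` S)"
  shows "uniform_limit S (\<lambda>i x. blinfun_apply (A i) (u x)) (\<lambda>x. blinfun_apply A0 (u x)) G"
proof (rule uniform_limitI)
  fix e :: real assume e: "e > 0"
  obtain U where U: "U > 0" "\<And>x. x \<in> S \<Longrightarrow> norm (u x) \<le> U"
    using u by (auto simp: bounded_pos)
  have "\<forall>\<^sub>F i in G. dist (A i) A0 < e / U"
    using A e U(1) by (intro tendstoD) auto
  then show "\<forall>\<^sub>F i in G. \<forall>x\<in>S. dist (blinfun_apply (A i) (u x)) (blinfun_apply A0 (u x)) < e"
  proof eventually_elim
    case (elim i)
    have "norm (blinfun_apply (A i - A0) (u x)) < e" if "x \<in> S" for x
    proof -
      have "norm (blinfun_apply (A i - A0) (u x)) \<le> norm (A i - A0) * U"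
        by (intro order_trans[OF norm_blinfun] mult_left_mono U(2) that) simp
      also have "\<dots> < e / U * U"
        using elim U(1) by (intro mult_strict_right_mono) (simp_all add: dist_norm)
      finally show ?thesis using U(1) by simp
    qed
    then show ?case by (simp add: dist_norm blinfun.diff_left)
  qed
qed

lemma uniform_limit_diff_0:
  fixes f :: "'i \<Rightarrow> 'b \<Rightarrow> 'a::real_normed_vector"
  shows "uniform_limit S f l G \<longleftrightarrow> uniform_limit S (\<lambda>i x. f i x - l x) (\<lambda>_. 0) G"
  by (simp add: uniform_limit_iff dist_norm)

text \<open>The difference from the limit flow \<open>u\<close> solves the equation with operator
  \<open>A i\<close> and forcing \<open>\<rho> i\<close>, which collects all deviations and tends to
  zero uniformly on bounded time sets. The operators \<open>A i\<close> are eventually bounded, so a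
  vanishing forcing yields a vanishing difference.\<close>

lemma lin_flow_limitin:
  fixes A :: "'i \<Rightarrow> 'a::banach \<Rightarrow>\<^sub>L 'a"
  assumes A: "(A \<longlongrightarrow> A0) G"
    and c: "\<And>i. continuous_on {0..} (r i)" "continuous_on {0..} r0"
    and r: "\<And>T. uniform_limit {0..T} r r0 G"
  shows "limitin C1_topology (\<lambda>i. lin_flow (A i) (r i)) (lin_flow A0 r0) G"
proof -
  define u where "u = lin_flow A0 r0"
  define \<rho> where "\<rho> i t = r i t - r0 t - blinfun_apply (A i - A0) (u t)" for i t
  have u: "continuous_on {0..} u" "\<And>t. 0 \<le> t \<Longrightarrow> (u has_vector_derivative - blinfun_apply A0 (u t) + r0 t) (at t within {0..})"
    unfolding u_def using C1_halfline_continuous_on[OF lin_flow_C1[OF c(2)]] lin_flow_has_vector_derivative[OF c(2)]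
    by blast+
  have c\<rho>: "continuous_on {0..} (\<rho> i)" for i
    unfolding \<rho>_def by (intro continuous_intros c u)
  have d: "lin_flow (A i) (r i) t - u t = lin_flow (A i) (\<rho> i) t" if "0 \<le> t" for i t
  proof -
    have "(\<lambda>t\<in>{0..}. lin_flow (A i) (r i) t - u t) = lin_flow (A i) (\<rho> i)"
    proof (rule lin_flow_unique[OF c\<rho>])
      fix t :: real assume t: "0 \<le> t"
      have "((\<lambda>t. lin_flow (A i) (r i) t - u t) has_vector_derivative
          - blinfun_apply (A i) (lin_flow (A i) (r i) t - u t) + \<rho> i t) (at t within {0..})"
        using has_vector_derivative_diff[OF lin_flow_has_vector_derivative[OF c(1)[of i] t] u(2)[OF t], of "A i"]
        by (simp add: \<rho>_def blinfun.bilinear_simps algebra_simps)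
      then show "((\<lambda>t\<in>{0..}. lin_flow (A i) (r i) t - u t) has_vector_derivative
          - blinfun_apply (A i) ((\<lambda>t\<in>{0..}. lin_flow (A i) (r i) t - u t) t) + \<rho> i t) (at t within {0..})"
        using t by (auto intro: has_vector_derivative_transform[rotated 2])
    qed (auto simp: u_def)
    then show ?thesis using that by (metis (no_types, lifting) atLeast_iff restrict_apply')
  qed
  have "\<forall>\<^sub>F i in G. norm (A i) < norm A0 + 1"
    using tendsto_norm[OF A] by (rule order_tendstoD(2)) simp
  then have a: "\<forall>\<^sub>F i in G. norm (A i) \<le> norm A0 + 1"
    by (rule eventually_mono) simp
  have \<rho>0: "uniform_limit {0..T} \<rho> (\<lambda>_. 0) G" for T
  proof -
    have "compact (u ` {0..T})"
      by (intro compact_continuous_image continuous_on_subset[OF u(1)]) auto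
    moreover have "((\<lambda>i. A i - A0) \<longlongrightarrow> 0) G"
      using A by (rule LIM_zero)
    ultimately have "uniform_limit {0..T} (\<lambda>i t. blinfun_apply (A i - A0) (u t)) (\<lambda>t. blinfun_apply 0 (u t)) G"
      by (intro uniform_limit_blinfun_apply compact_imp_bounded)
    from uniform_limit_minus[OF iffD1[OF uniform_limit_diff_0 r] this]
    show ?thesis unfolding \<rho>_def[abs_def] by (simp only: blinfun.zero_left diff_zero)
  qed
  have U: "uniform_limit {0..T} (\<lambda>i. lin_flow (A i) (\<rho> i)) (\<lambda>_. 0) G" for T
    by (rule lin_flow_uniform_limit_0[OF a c\<rho> \<rho>0])
  have V: "uniform_limit {0..T} (\<lambda>i t. - blinfun_apply (A i) (lin_flow (A i) (\<rho> i) t) + \<rho> i t) (\<lambda>_. 0) G" for T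
    using uniform_limit_add[OF uniform_limit_uminus[OF uniform_limit_blinfun_0[OF a U]] \<rho>0, of T] by simp
  \<comment> \<open>The equation expresses the derivative of the difference through the difference
    and the forcing, so uniform convergence of derivatives follows from that of values.\<close>
  have dd: "deriv_halfline (lin_flow (A i) (r i)) t - deriv_halfline u t
      = - blinfun_apply (A i) (lin_flow (A i) (\<rho> i) t) + \<rho> i t" if "0 \<le> t" for i t
    unfolding deriv_halfline_eq[OF u(2)[OF that] that]
      deriv_halfline_eq[OF lin_flow_has_vector_derivative[OF c(1) that] that] d[OF that, symmetric]
    by (simp add: \<rho>_def blinfun.bilinear_simps algebra_simps)
  show ?thesis
    unfolding limitin_C1_topology u_def[symmetric]
  proof (intro conjI allI)
    show "u \<in> C1_halfline" unfolding u_def by (rule lin_flow_C1[OF c(2)])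
    show "\<forall>\<^sub>F i in G. lin_flow (A i) (r i) \<in> C1_halfline"
      by (intro always_eventually allI lin_flow_C1 c)
    fix T
    show "uniform_limit {0..T} (\<lambda>i. lin_flow (A i) (r i)) u G"
      using U[of T] unfolding uniform_limit_diff_0[of _ _ u]
      by (rule uniform_limit_cong[THEN iffD1, rotated 2]) (auto simp: d)
    show "uniform_limit {0..T} (\<lambda>i. deriv_halfline (lin_flow (A i) (r i))) (deriv_halfline u) G"
      using V[of T] unfolding uniform_limit_diff_0[of _ _ "deriv_halfline u"]
      by (rule uniform_limit_cong[THEN iffD1, rotated 2]) (auto simp: dd)
  qed
qed

text \<open>Linearity in the parameter of the forcing is what later makes the values of the limit
  process Gaussian.\<close>

lemma bounded_linear_lin_flow:
  fixes A :: "'a::banach \<Rightarrow>\<^sub>L 'a" and r :: "'b::real_normed_vector \<Rightarrow> real \<Rightarrow> 'a"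
  assumes c: "\<And>z. continuous_on {0..} (r z)" and t: "0 \<le> t"
    and add: "\<And>y z s. r (y + z) s = r y s + r z s" and scale: "\<And>q z s. r (q *\<^sub>R z) s = q *\<^sub>R r z s"
    and b: "\<And>z s. s \<in> {0..t} \<Longrightarrow> norm (r z s) \<le> norm z * K"
  shows "bounded_linear (\<lambda>z. lin_flow A (r z) t)"
proof (rule bounded_linear_intro)
  note I = lin_flow_has_integral[OF c t]
  show "lin_flow A (r (y + z)) t = lin_flow A (r y) t + lin_flow A (r z) t" for y z
    by (rule has_integral_unique[OF I]) (use has_integral_add[OF I I, of A y A z] in \<open>simp add: add blinfun.add_right\<close>)
  show "lin_flow A (r (q *\<^sub>R z)) t = q *\<^sub>R lin_flow A (r z) t" for q z
    by (rule has_integral_unique[OF I]) (use has_integral_cmul[OF I, of q A z] in \<open>simp add: scale blinfun.scaleR_right\<close>)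
  show "norm (lin_flow A (r z) t) \<le> norm z * (t * exp (t * norm A) * K)" for z
    using norm_lin_flow_le[OF c[of z] t order_refl b] by (simp add: mult_ac)
qed

section \<open>Operations on convergence in distribution\<close>

lemma borel_of_euclidean: "borel_of euclidean = borel"
  by (simp add: borel_of_def borel_def)

lemma openin_subset_Pow: "{U. openin T U} \<subseteq> Pow (topspace T)"
  using openin_subset by blast

lemma space_borel_of [simp]: "space (borel_of T) = topspace T"
  unfolding borel_of_def by (rule space_measure_of[OF openin_subset_Pow])

lemma sets_borel_of: "sets (borel_of T) = sigma_sets (topspace T) {U. openin T U}"
  unfolding borel_of_def by (rule sets_measure_of[OF openin_subset_Pow])

lemma continuous_map_measurable_borel_of:
  assumes "continuous_map S T \<phi>"
  shows "\<phi> \<in> measurable (borel_of S) (borel_of T)"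
  unfolding borel_of_def[of T]
proof (rule measurable_measure_of)
  show "{U. openin T U} \<subseteq> Pow (topspace T)" by (rule openin_subset_Pow)
  show "\<phi> \<in> space (borel_of S) \<rightarrow> topspace T"
    using assms by (auto simp: continuous_map_def)
  fix U assume "U \<in> {U. openin T U}"
  then have "openin S {x \<in> topspace S. \<phi> x \<in> U}"
    using assms by (auto simp: continuous_map_def)
  moreover have "\<phi> -` U \<inter> space (borel_of S) = {x \<in> topspace S. \<phi> x \<in> U}" by auto
  ultimately show "\<phi> -` U \<inter> space (borel_of S) \<in> sets (borel_of S)"
    by (simp add: sets_borel_of sigma_sets.Basic)
qed

lemma conv_in_distr_continuous_map:
  assumes "conv_in_distr S M X N Y" and \<phi>: "continuous_map S T \<phi>"
  shows "conv_in_distr T M (\<lambda>n \<omega>. \<phi> (X n \<omega>)) N (\<lambda>\<omega>. \<phi> (Y \<omega>))"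
  unfolding conv_in_distr_def
proof (intro conjI allI impI)
  have X: "X n \<in> measurable M (borel_of S)" and Y: "Y \<in> measurable N (borel_of S)" for n
    using assms(1) by (auto simp: conv_in_distr_def)
  show "(\<lambda>\<omega>. \<phi> (X n \<omega>)) \<in> measurable M (borel_of T)" for n
    by (rule measurable_compose[OF X continuous_map_measurable_borel_of[OF \<phi>]])
  show "(\<lambda>\<omega>. \<phi> (Y \<omega>)) \<in> measurable N (borel_of T)"
    by (rule measurable_compose[OF Y continuous_map_measurable_borel_of[OF \<phi>]])
  fix f assume f: "continuous_map T euclideanreal f \<and> bounded (f ` topspace T)"
  have "continuous_map S euclideanreal (\<lambda>x. f (\<phi> x))"
    using continuous_map_compose[OF \<phi>, of euclideanreal f] f by (simp add: comp_def)
  moreover have "bounded ((\<lambda>x. f (\<phi> x)) ` topspace S)"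
    by (rule bounded_subset[OF conjunct2[OF f]]) (use \<phi> in \<open>auto simp: continuous_map_def\<close>)
  ultimately show "(\<lambda>n. \<integral>\<omega>. f (\<phi> (X n \<omega>)) \<partial>M) \<longlonglongrightarrow> (\<integral>\<omega>. f (\<phi> (Y \<omega>)) \<partial>N)"
    using assms(1) unfolding conv_in_distr_def by blast
qed

text \<open>Equality on \<open>space M\<close> is all that is available in the application, since
  \<open>Fn n \<omega>\<close> is known to solve its equation only there.\<close>

lemma conv_in_distr_cong:
  assumes "conv_in_distr T M X N Y" and eq: "\<And>n \<omega>. \<omega> \<in> space M \<Longrightarrow> X' n \<omega> = X n \<omega>"
  shows "conv_in_distr T M X' N Y"
proof -
  have "X' n \<in> measurable M (borel_of T) \<longleftrightarrow> X n \<in> measurable M (borel_of T)" for n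
    by (rule measurable_cong) (rule eq)
  moreover have "(\<integral>\<omega>. f (X' n \<omega>) \<partial>M) = (\<integral>\<omega>. f (X n \<omega>) \<partial>M)" for n and f :: "_ \<Rightarrow> real"
    by (rule Bochner_Integration.integral_cong) (simp_all add: eq)
  ultimately show ?thesis using assms(1) by (simp add: conv_in_distr_def)
qed

text \<open>For a Lipschitz test function, replacing \<open>W n\<close> by its constant limit
  changes the value by at most \<open>L * dist (W n \<omega>) w\<close>, which vanishes almost
  surely, and the change is bounded. What remains is a test function of \<open>X n\<close> alone.
  Second countability makes the pair Borel measurable.\<close>

lemma conv_in_distr_Pair_const:
  fixes W :: "nat \<Rightarrow> 'w \<Rightarrow> 'a::{metric_space,second_countable_topology}"
    and X :: "nat \<Rightarrow> 'w \<Rightarrow> 'b::{metric_space,second_countable_topology}"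
  assumes M: "prob_space M" and N: "prob_space N"
    and X: "conv_in_distr euclidean M X N Y"
    and W: "\<And>n. W n \<in> borel_measurable M" and lim: "AE \<omega> in M. (\<lambda>n. W n \<omega>) \<longlonglongrightarrow> w"
  shows "conv_in_distr euclidean M (\<lambda>n \<omega>. (W n \<omega>, X n \<omega>)) N (\<lambda>\<omega>. (w, Y \<omega>))"
proof -
  interpret M: prob_space M by fact
  have Xm [measurable]: "X n \<in> borel_measurable M" and Ym [measurable]: "Y \<in> borel_measurable N" for n
    using X by (auto simp: conv_in_distr_def borel_of_euclidean)
  note [measurable] = W
  show ?thesis
  proof (rule conv_in_distr_euclideanI[OF M N])
    fix g :: "'a \<times> 'b \<Rightarrow> real" and L K
    assume g: "L-lipschitz_on UNIV g" "\<And>x. \<bar>g x\<bar> \<le> K"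
    have gc: "continuous_on UNIV g" using g(1) by (rule lipschitz_on_continuous_on)
    have gm [measurable]: "g \<in> borel_measurable borel" by (rule borel_measurable_continuous_onI[OF gc])
    have gwc: "continuous_on UNIV (\<lambda>x. g (w, x))"
      by (intro continuous_on_compose2[OF gc] continuous_intros) auto
    have L: "0 \<le> L" using g(1) by (rule lipschitz_on_nonneg)
    have "(\<lambda>n. M.expectation (\<lambda>\<omega>. g (W n \<omega>, X n \<omega>) - g (w, X n \<omega>))) \<longlonglongrightarrow> M.expectation (\<lambda>_. 0)"
    proof (rule integral_dominated_convergence[where w = "\<lambda>_. 2 * K"])
      show "AE \<omega> in M. (\<lambda>n. g (W n \<omega>, X n \<omega>) - g (w, X n \<omega>)) \<longlonglongrightarrow> 0"
        using lim
      proof eventually_elim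
        case (elim \<omega>)
        have "(\<lambda>n. L * dist (W n \<omega>) w) \<longlonglongrightarrow> L * dist w w"
          by (intro tendsto_intros elim)
        then have 1: "(\<lambda>n. L * dist (W n \<omega>) w) \<longlonglongrightarrow> 0" by simp
        have 2: "norm (g (W n \<omega>, X n \<omega>) - g (w, X n \<omega>)) \<le> L * dist (W n \<omega>) w" for n
          using lipschitz_onD[OF g(1), of "(W n \<omega>, X n \<omega>)" "(w, X n \<omega>)"]
          by (simp add: dist_real_def dist_Pair_Pair)
        show ?case
          by (rule Lim_null_comparison[OF always_eventually[OF allI[OF 2]] 1])
      qed
      show "AE \<omega> in M. norm (g (W n \<omega>, X n \<omega>) - g (w, X n \<omega>)) \<le> 2 * K" for n
      proof (rule AE_I2)
        fix \<omega>
        show "norm (g (W n \<omega>, X n \<omega>) - g (w, X n \<omega>)) \<le> 2 * K"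
          using g(2)[of "(W n \<omega>, X n \<omega>)"] g(2)[of "(w, X n \<omega>)"]
            abs_triangle_ineq4[of "g (W n \<omega>, X n \<omega>)" "g (w, X n \<omega>)"]
          by simp
      qed
    qed auto
    moreover have "(\<lambda>n. M.expectation (\<lambda>\<omega>. g (w, X n \<omega>))) \<longlonglongrightarrow> (\<integral>\<omega>. g (w, Y \<omega>) \<partial>N)"
    proof -
      have "bounded (range (\<lambda>x. g (w, x)))"
        unfolding bounded_iff using g(2) by auto
      with gwc show ?thesis
        using X[unfolded conv_in_distr_def, THEN conjunct2, THEN conjunct2, rule_format, of "\<lambda>x. g (w, x)"]
        by simp
    qed
    ultimately have "(\<lambda>n. M.expectation (\<lambda>\<omega>. g (W n \<omega>, X n \<omega>) - g (w, X n \<omega>)) + M.expectation (\<lambda>\<omega>. g (w, X n \<omega>)))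
        \<longlonglongrightarrow> M.expectation (\<lambda>_. 0) + (\<integral>\<omega>. g (w, Y \<omega>) \<partial>N)"
      by (rule tendsto_add)
    moreover have "M.expectation (\<lambda>\<omega>. g (W n \<omega>, X n \<omega>) - g (w, X n \<omega>)) + M.expectation (\<lambda>\<omega>. g (w, X n \<omega>))
        = M.expectation (\<lambda>\<omega>. g (W n \<omega>, X n \<omega>))" for n
      using M.integrable_bounded_continuous[OF gc g(2), of "\<lambda>\<omega>. (W n \<omega>, X n \<omega>)"]
        M.integrable_bounded_continuous[OF gwc g(2), of "X n"]
      by simp
    ultimately show "(\<lambda>n. M.expectation (\<lambda>\<omega>. g (W n \<omega>, X n \<omega>))) \<longlonglongrightarrow> (\<integral>\<omega>. g (w, Y \<omega>) \<partial>N)"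
      by simp
  qed auto
qed

section \<open>The kernel gradient flow\<close>

text \<open>The squared distance between two features expands into four kernel values, which cancel
  in the limit.\<close>

lemma rkhs_feature_continuous:
  fixes \<Phi> :: "'x::topological_space \<Rightarrow> 'h::{real_inner,banach}"
  assumes H: "rkhs fun_of k \<Phi>" and k: "continuous_on UNIV (\<lambda>(x, y). k x y)"
  shows "continuous_on UNIV \<Phi>"
proof -
  have kip: "k x y = \<Phi> x \<bullet> \<Phi> y" for x y
    using H unfolding rkhs_def by metis
  have "(\<Phi> \<longlongrightarrow> \<Phi> x) (at x)" for x
  proof -
    have kc: "((\<lambda>y. k (f y) (g y)) \<longlongrightarrow> k a b) (at x)" if "(f \<longlongrightarrow> a) (at x)" "(g \<longlongrightarrow> b) (at x)" for f g a b
      using continuous_on_tendsto_compose[OF k tendsto_Pair[OF that]] by simp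
    have "((\<lambda>y. (norm (\<Phi> y - \<Phi> x))\<^sup>2) \<longlongrightarrow> k x x - k x x - (k x x - k x x)) (at x)"
      unfolding power2_norm_eq_inner inner_diff_left inner_diff_right kip[symmetric]
      by (intro tendsto_diff kc tendsto_const tendsto_ident_at)
    then have "((\<lambda>y. sqrt ((norm (\<Phi> y - \<Phi> x))\<^sup>2)) \<longlongrightarrow> sqrt 0) (at x)"
      by (intro tendsto_real_sqrt) simp
    then show ?thesis
      by (subst LIM_zero_iff[symmetric], subst tendsto_norm_zero_iff[symmetric]) simp
  qed
  then show ?thesis by (simp add: continuous_on_def)
qed

lemma norm_hs_apply_le: "norm (hs_apply A x) \<le> norm A * norm x"
  by (intro order_trans[OF norm_blinfun] mult_right_mono norm_hs_op_le) simp

text \<open>The operator \<beta> that drives the equation is separate from the perturbation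
  \<open>b\<close> that multiplies the fixed path \<open>F\<close>: the rescaled error has \<beta> =
  \<open>Bn n \<omega>\<close>, the limit process has \<beta> = \<open>B\<close>.\<close>

definition flow_map :: "(real \<Rightarrow> 'h::{real_inner,banach}) \<Rightarrow> 'h hs \<times> 'h hs \<times> 'h \<Rightarrow> real \<Rightarrow> 'h" where
  "flow_map F = (\<lambda>(\<beta>, b, c). lin_flow (hs_op \<beta>) (\<lambda>t. - hs_apply b (F t) + c))"

lemma flow_map_continuous:
  fixes F :: "real \<Rightarrow> 'h::{real_inner,banach}"
  assumes F: "continuous_on {0..} F"
  shows "continuous_map euclidean C1_topology (flow_map F)"
  unfolding continuous_map_atin
proof
  fix z0 :: "'h::{real_inner,banach} hs \<times> 'h hs \<times> 'h"
  let ?G = "atin euclidean z0"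
  have "limitin euclidean (\<lambda>z. z) z0 ?G"
    using continuous_map_id[of euclidean] unfolding continuous_map_atin by (auto simp: id_def)
  then have id: "((\<lambda>z. z) \<longlongrightarrow> z0) ?G" by simp
  have b: "((\<lambda>z. hs_op (fst (snd z))) \<longlongrightarrow> hs_op (fst (snd z0))) ?G"
    by (intro bounded_linear.tendsto[OF bounded_linear_hs_op] tendsto_fst tendsto_snd id)
  have "limitin C1_topology (\<lambda>z. lin_flow (hs_op (fst z)) (\<lambda>t. - hs_apply (fst (snd z)) (F t) + snd (snd z)))
      (lin_flow (hs_op (fst z0)) (\<lambda>t. - hs_apply (fst (snd z0)) (F t) + snd (snd z0))) ?G"
  proof (rule lin_flow_limitin)
    show "((\<lambda>z. hs_op (fst z)) \<longlongrightarrow> hs_op (fst z0)) ?G"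
      by (intro bounded_linear.tendsto[OF bounded_linear_hs_op] tendsto_fst id)
    fix T
    have "compact (F ` {0..T})"
      by (intro compact_continuous_image continuous_on_subset[OF F]) auto
    moreover have "uniform_limit {0..T} (\<lambda>z t. snd (snd z)) (\<lambda>t. snd (snd z0)) ?G"
      by (intro uniform_limitI) (use tendstoD[OF tendsto_snd[OF tendsto_snd[OF id]]] in \<open>auto elim: eventually_mono\<close>)
    ultimately show "uniform_limit {0..T} (\<lambda>z t. - hs_apply (fst (snd z)) (F t) + snd (snd z))
        (\<lambda>t. - hs_apply (fst (snd z0)) (F t) + snd (snd z0)) ?G"
      by (intro uniform_limit_add uniform_limit_uminus uniform_limit_blinfun_apply[OF b] compact_imp_bounded)
  qed (intro continuous_intros F)+
  then show "limitin C1_topology (flow_map F) (flow_map F z0) ?G"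
    by (simp add: flow_map_def case_prod_beta')
qed

lemma flow_map_bounded_linear:
  fixes F :: "real \<Rightarrow> 'h::{real_inner,banach}"
  assumes F: "continuous_on {0..} F" and t: "0 \<le> t"
  shows "bounded_linear (\<lambda>z. flow_map F (\<beta>, z) t)"
proof -
  have "bounded (F ` {0..t})"
    by (intro compact_imp_bounded compact_continuous_image continuous_on_subset[OF F]) auto
  then obtain U where U: "\<forall>x\<in>F ` {0..t}. norm x \<le> U" "U > 0"
    unfolding bounded_pos by blast
  have FU: "norm (F s) \<le> U" if "s \<in> {0..t}" for s
    using U(1) that by blast
  have "bounded_linear (\<lambda>z. lin_flow (hs_op \<beta>) (\<lambda>s. - hs_apply (fst z) (F s) + snd z) t)"
  proof (rule bounded_linear_lin_flow[OF _ t])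
    show "continuous_on {0..} (\<lambda>s. - hs_apply (fst z) (F s) + snd z)" for z :: "'h hs \<times> 'h"
      by (intro continuous_intros F)
    fix z :: "'h hs \<times> 'h" and s assume s: "s \<in> {0..t}"
    have "norm (- hs_apply (fst z) (F s) + snd z) \<le> norm (hs_apply (fst z) (F s)) + norm (snd z)"
      using norm_triangle_ineq[of "- hs_apply (fst z) (F s)" "snd z"] by simp
    also have "\<dots> \<le> norm z * U + norm z"
      using FU[OF s] U(2) norm_fst_le[of "fst z" "snd z"] norm_snd_le[of "snd z" "fst z"]
      by (intro add_mono order_trans[OF norm_hs_apply_le] mult_mono) auto
    finally show "norm (- hs_apply (fst z) (F s) + snd z) \<le> norm z * (U + 1)"
      by (simp add: distrib_left)
  qed (simp_all add: plus_hs.rep_eq scaleR_hs.rep_eq blinfun.bilinear_simps algebra_simps)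
  then show ?thesis by (simp add: flow_map_def case_prod_beta')
qed

text \<open>A finite combination of values of the flow is a bounded linear functional of the
  Gaussian pair, hence by Riesz an inner product with a fixed vector.\<close>

lemma flow_map_gaussian_process:
  fixes F :: "real \<Rightarrow> 'h::{real_inner,banach,second_countable_topology}"
  assumes F: "continuous_on {0..} F" and X: "centered_gaussian N X"
  shows "centered_gaussian_process N {0..} (\<lambda>\<omega>. flow_map F (\<beta>, X \<omega>))"
  unfolding centered_gaussian_process_def
proof (intro conjI ballI allI impI)
  have Xm: "X \<in> borel_measurable N" using X by (simp add: centered_gaussian_def)
  show "(\<lambda>\<omega>. flow_map F (\<beta>, X \<omega>) t) \<in> borel_measurable N" if "t \<in> {0..}" for t
    using flow_map_bounded_linear[OF F, of t \<beta>] that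
    by (intro measurable_compose[OF Xm] borel_measurable_continuous_onI linear_continuous_on) auto
  fix J :: "real set" and h :: "real \<Rightarrow> 'h" assume J: "finite J \<and> J \<subseteq> {0..}"
  have "bounded_linear (\<lambda>z. \<Sum>t\<in>J. h t \<bullet> flow_map F (\<beta>, z) t)"
    using J by (intro bounded_linear_sum bounded_linear_compose[OF bounded_linear_inner_right]
        flow_map_bounded_linear[OF F]) auto
  then obtain r where r: "\<And>z. (\<Sum>t\<in>J. h t \<bullet> flow_map F (\<beta>, z) t) = z \<bullet> r"
    using riesz_representation by blast
  have "centered_gaussian_real N (\<lambda>\<omega>. r \<bullet> X \<omega>)"
    using X unfolding centered_gaussian_def by blast
  then show "centered_gaussian_real N (\<lambda>\<omega>. \<Sum>t\<in>J. h t \<bullet> flow_map F (\<beta>, X \<omega>) t)"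
    by (simp only: r inner_commute[of _ r])
qed

text \<open>The limit pair is any Gaussian pair with the right covariance on any probability space.
  The existence clause keeps this from being vacuous: its measure \<open>G\<close> with the two
  coordinate maps is such a pair. The equivalence with \<open>f = \<FF> \<omega>\<close> encodes
  existence and uniqueness for the limiting equation, path by path.\<close>

theorem theorem3p3:
  fixes P :: "('x::{metric_space,second_countable_topology} \<times> real) measure"
    and M :: "'w measure" and Z :: "nat \<Rightarrow> 'w \<Rightarrow> 'x \<times> real"
    and fun_of :: "'h::{real_inner,banach,second_countable_topology} \<Rightarrow> 'x \<Rightarrow> real"
    and k :: "'x \<Rightarrow> 'x \<Rightarrow> real" and \<Phi> :: "'x \<Rightarrow> 'h"
    and Bn :: "nat \<Rightarrow> 'w \<Rightarrow> 'h hs" and Cn :: "nat \<Rightarrow> 'w \<Rightarrow> 'h" and B :: "'h hs" and C :: "'h"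
    and Fn :: "nat \<Rightarrow> 'w \<Rightarrow> real \<Rightarrow> 'h" and F :: "real \<Rightarrow> 'h"
  assumes P: "prob_space P" "sets P = sets borel"
    and y2: "integrable P (\<lambda>(x, y). y\<^sup>2)"
    and M: "prob_space M"
    and iid: "prob_space.indep_vars M (\<lambda>_. borel) Z UNIV" "\<And>i. distr M borel (Z i) = P"
    and H: "rkhs fun_of k \<Phi>"
    and k: "continuous_on UNIV (\<lambda>(x, y). k x y)" "bdd_above (range (\<lambda>x. k x x))"
    and Bn: "\<And>n \<omega>. Bn n \<omega> = (1 / real n) *\<^sub>R (\<Sum>i<n. case Z i \<omega> of (x, y) \<Rightarrow> tensor (\<Phi> x) (\<Phi> x))"
    and Cn: "\<And>n \<omega>. Cn n \<omega> = (1 / real n) *\<^sub>R (\<Sum>i<n. case Z i \<omega> of (x, y) \<Rightarrow> y *\<^sub>R \<Phi> x)"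
    and B: "B = (\<integral>(x, y). tensor (\<Phi> x) (\<Phi> x) \<partial>P)"
    and C: "C = (\<integral>(x, y). y *\<^sub>R \<Phi> x \<partial>P)"
    and Fn: "\<And>n \<omega>. \<omega> \<in> space M \<Longrightarrow> solves_ivp (\<lambda>t f. - hs_apply (Bn n \<omega>) f + Cn n \<omega>) (Fn n \<omega>)"
    and F: "solves_ivp (\<lambda>t f. - hs_apply B f + C) F"
  shows "(AE \<omega> in M. (\<lambda>n. (Bn n \<omega>, Cn n \<omega>)) \<longlonglongrightarrow> (B, C))
    \<and> (AE \<omega> in M. limitin C1_topology (\<lambda>n. Fn n \<omega>) F sequentially)
    \<and> (\<exists>G :: ('h hs \<times> 'h) measure. prob_space G \<and> sets G = sets borel
        \<and> centered_gaussian G (\<lambda>z. z)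
        \<and> same_covariance G (\<lambda>z. z) P (\<lambda>(x, y). (tensor (\<Phi> x) (\<Phi> x), y *\<^sub>R \<Phi> x)))
    \<and> (\<forall>(N :: 'v measure) (\<BB> :: 'v \<Rightarrow> 'h hs) (\<CC> :: 'v \<Rightarrow> 'h).
        prob_space N
        \<and> centered_gaussian N (\<lambda>\<omega>. (\<BB> \<omega>, \<CC> \<omega>))
        \<and> same_covariance N (\<lambda>\<omega>. (\<BB> \<omega>, \<CC> \<omega>)) P (\<lambda>(x, y). (tensor (\<Phi> x) (\<Phi> x), y *\<^sub>R \<Phi> x))
        \<longrightarrow> conv_in_distr euclidean
              M (\<lambda>n \<omega>. (sqrt (real n) *\<^sub>R (Bn n \<omega> - B), sqrt (real n) *\<^sub>R (Cn n \<omega> - C)))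
              N (\<lambda>\<omega>. (\<BB> \<omega>, \<CC> \<omega>))
          \<and> (\<exists>\<FF> :: 'v \<Rightarrow> real \<Rightarrow> 'h.
              conv_in_distr C1_topology
                M (\<lambda>n \<omega>. \<lambda>t\<in>{0..}. sqrt (real n) *\<^sub>R (Fn n \<omega> t - F t)) N \<FF>
              \<and> centered_gaussian_process N {0..} \<FF>
              \<and> (\<forall>\<omega>\<in>space N. \<forall>f.
                  solves_ivp (\<lambda>t u. - hs_apply B u - hs_apply (\<BB> \<omega>) (F t) + \<CC> \<omega>) f \<longleftrightarrow> f = \<FF> \<omega>)
              \<and> (\<forall>\<omega>\<in>space N. \<forall>t\<ge>0.
                  (\<lambda>s. blinfun_apply (op_exp (- ((t - s) *\<^sub>R hs_op B))) (- hs_apply (\<BB> \<omega>) (F s) + \<CC> \<omega>))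
                    integrable_on {0..t} \<and>
                  \<FF> \<omega> t = integral {0..t} (\<lambda>s.
                    blinfun_apply (op_exp (- ((t - s) *\<^sub>R hs_op B))) (- hs_apply (\<BB> \<omega>) (F s) + \<CC> \<omega>)))))"
proof -
  interpret P: prob_space P by fact
  interpret M: prob_space M by fact
  define \<psi> :: "'x \<times> real \<Rightarrow> 'h hs \<times> 'h" where "\<psi> = (\<lambda>(x, y). (tensor (\<Phi> x) (\<Phi> x), y *\<^sub>R \<Phi> x))"
  have \<Phi>: "continuous_on UNIV \<Phi>"
    by (rule rkhs_feature_continuous[OF H k(1)])
  have \<psi>_borel [measurable]: "\<psi> \<in> borel_measurable borel"
    unfolding \<psi>_def case_prod_beta'
    by (intro borel_measurable_continuous_onI continuous_intros continuous_on_compose2[OF \<Phi>]) auto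
  have \<psi>_P [measurable]: "\<psi> \<in> borel_measurable P"
    using \<psi>_borel by (simp add: measurable_cong_sets[OF P(2) refl])
  have \<psi>_sq: "integrable P (\<lambda>z. (norm (\<psi> z))\<^sup>2)"
  proof -
    obtain K where K: "\<And>x. k x x \<le> K" using k(2) by (auto simp: bdd_above_def)
    have \<Phi>k: "(norm (\<Phi> x))\<^sup>2 = k x x" for x
      using H unfolding rkhs_def power2_norm_eq_inner by metis
    have k0: "0 \<le> k x x" for x unfolding \<Phi>k[symmetric] by simp
    \<comment> \<open>The squared norm of \<open>\<Phi> x\<close> is \<open>k x x\<close>, hence at
      most \<open>K\<close>: the operator component contributes at most \<open>K\<^sup>2\<close> and
      the vector component at most \<open>y\<^sup>2 * K\<close>.\<close>
    have "integrable P (\<lambda>z. K\<^sup>2 + (case z of (x, y) \<Rightarrow> y\<^sup>2) * K)"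
      using y2 by simp
    then show ?thesis
    proof (rule Bochner_Integration.integrable_bound)
      have "(norm (\<psi> (x, y)))\<^sup>2 \<le> K\<^sup>2 + y\<^sup>2 * K" for x y
      proof -
        have "(norm (\<psi> (x, y)))\<^sup>2 = (k x x)\<^sup>2 + y\<^sup>2 * k x x"
          unfolding \<Phi>k[symmetric] by (simp add: \<psi>_def norm_Pair norm_tensor power_mult_distrib power2_eq_square)
        then show ?thesis
          using K[of x] k0[of x] by (auto intro!: add_mono power_mono mult_left_mono)
      qed
      then show "AE z in P. norm ((norm (\<psi> z))\<^sup>2) \<le> norm (K\<^sup>2 + (case z of (x, y) \<Rightarrow> y\<^sup>2) * K)"
        by (intro AE_I2) (auto intro: order_trans[OF _ abs_ge_self])
    qed measurable
  qed
  have \<psi>_int: "integrable P \<psi>"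
    by (rule P.integrable_of_square[OF \<psi>_P \<psi>_sq])
  have Z: "Z i \<in> borel_measurable M" for i
    using iid(1) by (simp add: M.indep_vars_def2)
  interpret X: iid_square_integrable M "\<lambda>i \<omega>. \<psi> (Z i \<omega>)" "distr P borel \<psi>"
  proof
    show "M.indep_vars (\<lambda>_. borel) (\<lambda>i \<omega>. \<psi> (Z i \<omega>)) UNIV"
      by (rule M.indep_vars_compose2[OF iid(1)]) simp
    show "distr M borel (\<lambda>\<omega>. \<psi> (Z i \<omega>)) = distr P borel \<psi>" for i
      unfolding iid(2)[of i, symmetric] using Z[of i] by (simp add: distr_distr comp_def)
    show "integrable (distr P borel \<psi>) (\<lambda>x. (norm x)\<^sup>2)"
      using \<psi>_sq by (subst integrable_distr_eq) auto
  qed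
  have mean_P: "X.mean = P.expectation \<psi>"
    unfolding X.mean_def by (subst integral_distr) auto
  have mean: "X.mean = (B, C)"
    unfolding mean_P
  proof (rule prod_eqI)
    show "fst (P.expectation \<psi>) = fst (B, C)"
      using integral_bounded_linear[OF bounded_linear_fst \<psi>_int]
      by (simp add: B \<psi>_def case_prod_beta')
    show "snd (P.expectation \<psi>) = snd (B, C)"
      using integral_bounded_linear[OF bounded_linear_snd \<psi>_int]
      by (simp add: C \<psi>_def case_prod_beta')
  qed
  have average: "(1 / real n) *\<^sub>R (\<Sum>i<n. \<psi> (Z i \<omega>)) = (Bn n \<omega>, Cn n \<omega>)" for n \<omega>
    by (rule prod_eqI) (simp_all add: Bn Cn \<psi>_def fst_sum snd_sum case_prod_beta')
  have normalized: "X.normalized n \<omega> = (sqrt (real n) *\<^sub>R (Bn n \<omega> - B), sqrt (real n) *\<^sub>R (Cn n \<omega> - C))" for n \<omega>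
    by (simp add: X.normalized_def average mean)
  have slln: "AE \<omega> in M. (\<lambda>n. (Bn n \<omega>, Cn n \<omega>)) \<longlonglongrightarrow> (B, C)"
    using X.strong_law by (simp add: average mean)
  have F_eq: "F = lin_flow (hs_op B) (\<lambda>_. C)"
    using F by (rule solves_ivp_iff_lin_flow[OF continuous_on_const, THEN iffD1])
  have Fn_eq: "Fn n \<omega> = lin_flow (hs_op (Bn n \<omega>)) (\<lambda>_. Cn n \<omega>)" if "\<omega> \<in> space M" for n \<omega>
    using Fn[OF that] by (rule solves_ivp_iff_lin_flow[OF continuous_on_const, THEN iffD1])
  have F_cont: "continuous_on {0..} F"
    using F C1_halfline_continuous_on by (auto simp: solves_ivp_def)
  have flow_slln: "AE \<omega> in M. limitin C1_topology (\<lambda>n. Fn n \<omega>) F sequentially"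
    using slln AE_space
  proof eventually_elim
    case (elim \<omega>)
    have BC: "(\<lambda>n. Bn n \<omega>) \<longlonglongrightarrow> B" "(\<lambda>n. Cn n \<omega>) \<longlonglongrightarrow> C"
      using tendsto_fst[OF elim(1)] tendsto_snd[OF elim(1)] by simp_all
    show ?case
      unfolding F_eq Fn_eq[OF elim(2)]
    proof (rule lin_flow_limitin)
      show "(\<lambda>n. hs_op (Bn n \<omega>)) \<longlonglongrightarrow> hs_op B"
        by (intro bounded_linear.tendsto[OF bounded_linear_hs_op] BC)
      show "uniform_limit {0..T} (\<lambda>n _. Cn n \<omega>) (\<lambda>_. C) sequentially" for T
        by (intro uniform_limitI) (use tendstoD[OF BC(2)] in \<open>auto elim: eventually_mono\<close>)
    qed (intro continuous_intros)+
  qed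
  have limit: "conv_in_distr euclidean M X.normalized N (\<lambda>\<omega>. (\<BB> \<omega>, \<CC> \<omega>))
      \<and> conv_in_distr C1_topology M (\<lambda>n \<omega>. \<lambda>t\<in>{0..}. sqrt (real n) *\<^sub>R (Fn n \<omega> t - F t))
          N (\<lambda>\<omega>. flow_map F (B, \<BB> \<omega>, \<CC> \<omega>))"
    if N: "prob_space N" and G: "centered_gaussian N (\<lambda>\<omega>. (\<BB> \<omega>, \<CC> \<omega>))"
      and cov: "same_covariance N (\<lambda>\<omega>. (\<BB> \<omega>, \<CC> \<omega>)) P \<psi>"
    for N :: "'v measure" and \<BB> \<CC>
  proof
    interpret N: prob_space N by fact
    have Gi: "(\<lambda>\<omega>. (\<BB> \<omega>, \<CC> \<omega>)) \<in> borel_measurable N" "integrable N (\<lambda>\<omega>. (norm (\<BB> \<omega>, \<CC> \<omega>))\<^sup>2)"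
      using cov by (simp_all add: same_covariance_def)
    have G0: "N.expectation (\<lambda>\<omega>. (\<BB> \<omega>, \<CC> \<omega>)) = 0"
      by (rule N.centered_gaussian_mean[OF G N.integrable_of_square[OF Gi]])
    show conv: "conv_in_distr euclidean M X.normalized N (\<lambda>\<omega>. (\<BB> \<omega>, \<CC> \<omega>))"
    proof (rule X.hilbert_central_limit_theorem[OF N G Gi(2)])
      fix t
      have "N.expectation (\<lambda>\<omega>. (t \<bullet> (\<BB> \<omega>, \<CC> \<omega>))\<^sup>2) = P.expectation (\<lambda>z. (t \<bullet> (\<psi> z - X.mean))\<^sup>2)"
        using same_covariance_variance[OF cov N P(1), of t] unfolding G0 mean_P by (simp only: diff_zero)
      also have "\<dots> = (\<integral>x. (t \<bullet> (x - X.mean))\<^sup>2 \<partial>distr P borel \<psi>)"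
        by (subst integral_distr) auto
      finally show "N.expectation (\<lambda>\<omega>. (t \<bullet> (\<BB> \<omega>, \<CC> \<omega>))\<^sup>2) = (\<integral>x. (t \<bullet> (x - X.mean))\<^sup>2 \<partial>distr P borel \<psi>)" .
    qed
    have "(\<lambda>\<omega>. (1 / real n) *\<^sub>R (\<Sum>i<n. \<psi> (Z i \<omega>))) \<in> borel_measurable M" for n
      using X.X_measurable by measurable
    then have "(\<lambda>\<omega>. fst ((1 / real n) *\<^sub>R (\<Sum>i<n. \<psi> (Z i \<omega>)))) \<in> borel_measurable M" for n
      by (rule measurable_compose)
        (intro borel_measurable_continuous_onI linear_continuous_on bounded_linear_fst)
    then have Bn_meas: "Bn n \<in> borel_measurable M" for n
      by (simp add: average)
    have "AE \<omega> in M. (\<lambda>n. Bn n \<omega>) \<longlonglongrightarrow> B"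
      using slln by eventually_elim (drule tendsto_fst, simp)
    from conv_in_distr_continuous_map[OF conv_in_distr_Pair_const[OF M N conv Bn_meas this] flow_map_continuous[OF F_cont]]
    have "conv_in_distr C1_topology M (\<lambda>n \<omega>. flow_map F (Bn n \<omega>, X.normalized n \<omega>)) N (\<lambda>\<omega>. flow_map F (B, \<BB> \<omega>, \<CC> \<omega>))" .
    then show "conv_in_distr C1_topology M (\<lambda>n \<omega>. \<lambda>t\<in>{0..}. sqrt (real n) *\<^sub>R (Fn n \<omega> t - F t))
        N (\<lambda>\<omega>. flow_map F (B, \<BB> \<omega>, \<CC> \<omega>))"
    proof (rule conv_in_distr_cong)
      fix n \<omega> assume \<omega>: "\<omega> \<in> space M"
      let ?s = "sqrt (real n)" and ?u = "\<lambda>t\<in>{0..}. sqrt (real n) *\<^sub>R (Fn n \<omega> t - F t)"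
      have "?u = lin_flow (hs_op (Bn n \<omega>)) (\<lambda>t. - hs_apply (?s *\<^sub>R (Bn n \<omega> - B)) (F t) + ?s *\<^sub>R (Cn n \<omega> - C))"
      proof (rule lin_flow_unique)
        fix t :: real assume t: "0 \<le> t"
        have "(F has_vector_derivative - hs_apply B (F t) + C) (at t within {0..})"
          "(Fn n \<omega> has_vector_derivative - hs_apply (Bn n \<omega>) (Fn n \<omega> t) + Cn n \<omega>) (at t within {0..})"
          using F Fn[OF \<omega>] t by (auto simp: solves_ivp_def)
        then have "((\<lambda>t. ?s *\<^sub>R (Fn n \<omega> t - F t)) has_vector_derivative
            ?s *\<^sub>R ((- hs_apply (Bn n \<omega>) (Fn n \<omega> t) + Cn n \<omega>) - (- hs_apply B (F t) + C))) (at t within {0..})"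
          by (intro bounded_linear.has_vector_derivative[OF bounded_linear_scaleR_right] has_vector_derivative_diff)
        \<comment> \<open>Up to the factor \<open>?s\<close>, the operator terms are regrouped by
          adding and subtracting \<open>hs_apply (Bn n \<omega>) (F t)\<close>, so that the operator
          difference acts only on the deterministic path \<open>F\<close>.\<close>
        also have "?s *\<^sub>R ((- hs_apply (Bn n \<omega>) (Fn n \<omega> t) + Cn n \<omega>) - (- hs_apply B (F t) + C))
            = - hs_apply (Bn n \<omega>) (?u t) + (- hs_apply (?s *\<^sub>R (Bn n \<omega> - B)) (F t) + ?s *\<^sub>R (Cn n \<omega> - C))"
          using t by (simp add: scaleR_hs.rep_eq minus_hs.rep_eq blinfun.bilinear_simps algebra_simps)
        finally show "(?u has_vector_derivative - hs_apply (Bn n \<omega>) (?u t)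
            + (- hs_apply (?s *\<^sub>R (Bn n \<omega> - B)) (F t) + ?s *\<^sub>R (Cn n \<omega> - C))) (at t within {0..})"
          by (rule has_vector_derivative_transform[rotated 2]) (use t in auto)
      qed (use F Fn[OF \<omega>] in \<open>auto simp: solves_ivp_def intro!: continuous_intros F_cont\<close>)
      then show "?u = flow_map F (Bn n \<omega>, X.normalized n \<omega>)"
        by (simp add: flow_map_def normalized)
    qed
  qed
  have flow_map_ivp: "solves_ivp (\<lambda>t u. - hs_apply B u - hs_apply b (F t) + c) f \<longleftrightarrow> f = flow_map F (B, b, c)"
    and flow_map_integral: "0 \<le> t \<Longrightarrow>
      ((\<lambda>s. blinfun_apply (op_exp (- ((t - s) *\<^sub>R hs_op B))) (- hs_apply b (F s) + c)) has_integral flow_map F (B, b, c) t) {0..t}"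
    for b c f t
  proof -
    have cont: "continuous_on {0..} (\<lambda>t. - hs_apply b (F t) + c)"
      by (intro continuous_intros F_cont)
    have "(\<lambda>t u. - hs_apply B u - hs_apply b (F t) + c) = (\<lambda>t u. - hs_apply B u + (- hs_apply b (F t) + c))"
      by (simp add: fun_eq_iff)
    then show "solves_ivp (\<lambda>t u. - hs_apply B u - hs_apply b (F t) + c) f \<longleftrightarrow> f = flow_map F (B, b, c)"
      using solves_ivp_iff_lin_flow[OF cont] by (simp only: flow_map_def prod.case)
    show "((\<lambda>s. blinfun_apply (op_exp (- ((t - s) *\<^sub>R hs_op B))) (- hs_apply b (F s) + c)) has_integral flow_map F (B, b, c) t) {0..t}"
      if "0 \<le> t"
      using lin_flow_has_integral[OF cont that] by (simp only: flow_map_def prod.case)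
  qed
  show ?thesis
    unfolding \<psi>_def[symmetric]
  proof (intro conjI allI impI slln flow_slln)
    show "\<exists>G :: ('h hs \<times> 'h) measure. prob_space G \<and> sets G = sets borel
        \<and> centered_gaussian G (\<lambda>z. z) \<and> same_covariance G (\<lambda>z. z) P \<psi>"
      by (rule gaussian_exists[OF P(1) \<psi>_P \<psi>_sq])
    fix N :: "'v measure" and \<BB> \<CC>
    assume "prob_space N \<and> centered_gaussian N (\<lambda>\<omega>. (\<BB> \<omega>, \<CC> \<omega>)) \<and> same_covariance N (\<lambda>\<omega>. (\<BB> \<omega>, \<CC> \<omega>)) P \<psi>"
    then have N: "prob_space N" "centered_gaussian N (\<lambda>\<omega>. (\<BB> \<omega>, \<CC> \<omega>))" "same_covariance N (\<lambda>\<omega>. (\<BB> \<omega>, \<CC> \<omega>)) P \<psi>"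
      by simp_all
    note lim = limit[OF N]
    show "conv_in_distr euclidean M (\<lambda>n \<omega>. (sqrt (real n) *\<^sub>R (Bn n \<omega> - B), sqrt (real n) *\<^sub>R (Cn n \<omega> - C)))
        N (\<lambda>\<omega>. (\<BB> \<omega>, \<CC> \<omega>))"
      using lim by (simp only: normalized[abs_def])
    let ?\<FF> = "\<lambda>\<omega>. flow_map F (B, \<BB> \<omega>, \<CC> \<omega>)"
    have "centered_gaussian_process N {0..} ?\<FF>"
      by (rule flow_map_gaussian_process[OF F_cont N(2)])
    with lim flow_map_ivp flow_map_integral
    show "\<exists>\<FF>. conv_in_distr C1_topology M (\<lambda>n \<omega>. \<lambda>t\<in>{0..}. sqrt (real n) *\<^sub>R (Fn n \<omega> t - F t)) N \<FF>
        \<and> centered_gaussian_process N {0..} \<FF>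
        \<and> (\<forall>\<omega>\<in>space N. \<forall>f.
            solves_ivp (\<lambda>t u. - hs_apply B u - hs_apply (\<BB> \<omega>) (F t) + \<CC> \<omega>) f \<longleftrightarrow> f = \<FF> \<omega>)
        \<and> (\<forall>\<omega>\<in>space N. \<forall>t\<ge>0.
            (\<lambda>s. blinfun_apply (op_exp (- ((t - s) *\<^sub>R hs_op B))) (- hs_apply (\<BB> \<omega>) (F s) + \<CC> \<omega>))
              integrable_on {0..t} \<and>
            \<FF> \<omega> t = integral {0..t} (\<lambda>s.
              blinfun_apply (op_exp (- ((t - s) *\<^sub>R hs_op B))) (- hs_apply (\<BB> \<omega>) (F s) + \<CC> \<omega>)))"
      by (intro exI[of _ ?\<FF>] conjI ballI allI impI)
        (blast intro: has_integral_integrable integral_unique[symmetric])+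
  qed
qed

end
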